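(* Let $\Omega$ be a procyclic group satisfying condition $\mathcal{A}$, and let $T:\Omega\to\Omega$ be a minimal translation. Then there exists $f\in C(\Omega,\mathbb{R})$ such that for every $\omega\in\Omega$ the Schrödinger operator $(H_\omega\psi)(n)=\psi(n+1)+\psi(n-1)+f(T^n\omega)\psi(n)$ on $\ell^2(\mathbb{Z})$ has ULE with constants $r,c$ independent of $\omega$. In particular, there are constants $C,r'\in(0,\infty)$ such that for every $\omega\in\Omega$ and all $m,n\in\mathbb{Z}$, $$\sup_{t\in\mathbb{R}}\left|\langle\delta_n,e^{-itH_\omega}\delta_m\rangle\right|\le C e^{-r'|n-m|}.$$
   Context: A procyclic group is a compact Hausdorff topological group that is an inverse limit of finite cyclic (discrete) groups. A translation of $\Omega$ is a map $T(\omega)=\omega\cdot\omega_0$ for some fixed $\omega_0\in\Omega$; it is minimal if every orbit $\{T^n\omega:n\in\mathbb{Z}\}$ is dense in $\Omega$. Condition $\mathcal{A}$: $\Omega$ is isomorphic, as a topological group, to the inverse limit $\varprojlim_k \mathbb{Z}/n_k\mathbb{Z}$ (with the natural reduction maps) for an infinite sequence of integers $2\le n_1<n_2<\cdots$ such that $n_k\mid n_{k+1}$ and $n_{k+1}/n_k$ is prime for every $k$, and there is an integer $m\ge2$ such that $n_k<n_{k+1}\le n_k^m$ for every $k$. ULE: A family $\{u_k\}\subset\ell^2(\mathbb{Z})$ is uniformly localized if there are constants $r>0$ and $c<\infty$ such that for every member $u_k$ there is $m_k\in\mathbb{Z}$ with $|u_k(n)|\le c\,e^{-r|n-m_k|}$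 for all $n\in\mathbb{Z}$. An operator has ULE (with constants $r,c$) if it has a complete set of eigenfunctions (finite linear combinations are dense in $\ell^2(\mathbb{Z})$) that is uniformly localized (with constants $r,c$). $\{\delta_n\}_{n\in\mathbb{Z}}$ is the standard basis of $\ell^2(\mathbb{Z})$. *)

theory Defs
  imports
    "HOL-Analysis.Analysis"
    "HOL-Algebra.Product_Groups"
    "HOL-Computational_Algebra.Primes"
begin

section \<open>Topological groups and inverse limits\<close>

definition topological_group :: "('a, 'b) monoid_scheme \<Rightarrow> 'a topology \<Rightarrow> bool" where
  "topological_group G X \<longleftrightarrow>
     group G \<and> topspace X = carrier G \<and>
     continuous_map (prod_topology X X) X (\<lambda>(x, y). x \<otimes>\<^bsub>G\<^esub> y) \<and>
     continuous_map X X (\<lambda>x. inv\<^bsub>G\<^esub> x)"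

definition topological_group_isomorphic ::
    "('a, 'b) monoid_scheme \<Rightarrow> 'a topology \<Rightarrow> ('c, 'd) monoid_scheme \<Rightarrow> 'c topology \<Rightarrow> bool" where
  "topological_group_isomorphic G X H Y \<longleftrightarrow> (\<exists>\<phi> \<in> iso G H. homeomorphic_map X Y \<phi>)"

text \<open>An inverse system over a directed preordered set \<open>I\<close> of indices; for \<open>i \<preceq> j\<close> the bonding
  map \<open>p i j\<close> goes from \<open>D j\<close> to \<open>D i\<close>.\<close>

definition inverse_system ::
    "'i set \<Rightarrow> ('i \<Rightarrow> 'i \<Rightarrow> bool) \<Rightarrow> ('i \<Rightarrow> ('c, 'd) monoid_scheme) \<Rightarrow> ('i \<Rightarrow> 'i \<Rightarrow> 'c \<Rightarrow> 'c) \<Rightarrow> bool" where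
  "inverse_system I pre D p \<longleftrightarrow>
     I \<noteq> {} \<and>
     (\<forall>i\<in>I. pre i i) \<and>
     (\<forall>i\<in>I. \<forall>j\<in>I. \<forall>k\<in>I. pre i j \<longrightarrow> pre j k \<longrightarrow> pre i k) \<and>
     (\<forall>i\<in>I. \<forall>j\<in>I. \<exists>k\<in>I. pre i k \<and> pre j k) \<and>
     (\<forall>i\<in>I. group (D i)) \<and>
     (\<forall>i\<in>I. \<forall>j\<in>I. pre i j \<longrightarrow> p i j \<in> hom (D j) (D i)) \<and>
     (\<forall>i\<in>I. \<forall>x\<in>carrier (D i). p i i x = x) \<and>
     (\<forall>i\<in>I. \<forall>j\<in>I. \<forall>k\<in>I. pre i j \<longrightarrow> pre j k \<longrightarrow>
        (\<forall>x\<in>carrier (D k). p i j (p j k x) = p i k x))"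

definition inverse_limit ::
    "'i set \<Rightarrow> ('i \<Rightarrow> 'i \<Rightarrow> bool) \<Rightarrow> ('i \<Rightarrow> ('c, 'd) monoid_scheme) \<Rightarrow> ('i \<Rightarrow> 'i \<Rightarrow> 'c \<Rightarrow> 'c) \<Rightarrow>
     ('i \<Rightarrow> 'c) monoid" where
  "inverse_limit I pre D p =
     (product_group I D)\<lparr>carrier :=
        {x \<in> carrier (product_group I D). \<forall>i\<in>I. \<forall>j\<in>I. pre i j \<longrightarrow> p i j (x j) = x i}\<rparr>"

definition inverse_limit_topology ::
    "'i set \<Rightarrow> ('i \<Rightarrow> 'i \<Rightarrow> bool) \<Rightarrow> ('i \<Rightarrow> ('c, 'd) monoid_scheme) \<Rightarrow> ('i \<Rightarrow> 'i \<Rightarrow> 'c \<Rightarrow> 'c) \<Rightarrow>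
     ('i \<Rightarrow> 'c) topology" where
  "inverse_limit_topology I pre D p =
     subtopology (product_topology (\<lambda>i. discrete_topology (carrier (D i))) I)
       (carrier (inverse_limit I pre D p))"

text \<open>The index set and the finite cyclic groups range over the types \<open>'a set\<close> and
  \<open>'a set monoid\<close>. This loses no generality: a group \<open>G\<close> that is an inverse limit of finite cyclic
  groups in any universe is the inverse limit of the quotients \<open>G Mod N\<close>, which are finite cyclic,
  over its open normal subgroups \<open>N\<close>.\<close>

definition procyclic_group :: "('a, 'b) monoid_scheme \<Rightarrow> 'a topology \<Rightarrow> bool" where
  "procyclic_group G X \<longleftrightarrow>
     topological_group G X \<and> compact_space X \<and> Hausdorff_space X \<and>
     (\<exists>(I :: 'a set set) pre (D :: 'a set \<Rightarrow> 'a set monoid) p.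
        inverse_system I pre D p \<and>
        (\<forall>i\<in>I. finite (carrier (D i)) \<and> cyclic_group (D i)) \<and>
        topological_group_isomorphic G X (inverse_limit I pre D p) (inverse_limit_topology I pre D p))"

text \<open>The sequence of the \<open>n\<^sub>k\<close> is indexed from \<open>0\<close>; the residue groups are realised on
  \<open>{0..<n\<^sub>k}\<close>, so that the natural map from \<open>D l\<close> to \<open>D k\<close> is reduction modulo \<open>n\<^sub>k\<close>.\<close>

definition condition_A :: "('a, 'b) monoid_scheme \<Rightarrow> 'a topology \<Rightarrow> bool" where
  "condition_A G X \<longleftrightarrow>
     (\<exists>n :: nat \<Rightarrow> nat.
        2 \<le> n 0 \<and> strict_mono n \<and>
        (\<forall>k. n k dvd n (Suc k) \<and> prime (n (Suc k) div n k)) \<and>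
        (\<exists>m\<ge>2. \<forall>k. n k < n (Suc k) \<and> n (Suc k) \<le> n k ^ m) \<and>
        (let D = (\<lambda>k. integer_mod_group (n k)); p = (\<lambda>k l x. x mod int (n k)) in
           topological_group_isomorphic G X
             (inverse_limit UNIV (\<le>) D p) (inverse_limit_topology UNIV (\<le>) D p)))"


section \<open>Minimal translations\<close>

definition translation_on :: "('a, 'b) monoid_scheme \<Rightarrow> ('a \<Rightarrow> 'a) \<Rightarrow> bool" where
  "translation_on G T \<longleftrightarrow> (\<exists>a\<in>carrier G. \<forall>x\<in>carrier G. T x = x \<otimes>\<^bsub>G\<^esub> a)"

text \<open>\<open>T\<^sup>n x\<close> for integer \<open>n\<close> and a bijection \<open>T\<close> of \<open>S\<close>.\<close>

definition iterate_int :: "'a set \<Rightarrow> ('a \<Rightarrow> 'a) \<Rightarrow> int \<Rightarrow> 'a \<Rightarrow> 'a" where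
  "iterate_int S T n x = (if n \<ge> 0 then (T ^^ nat n) x else (inv_into S T ^^ nat (- n)) x)"

definition minimal_on :: "'a topology \<Rightarrow> ('a \<Rightarrow> 'a) \<Rightarrow> bool" where
  "minimal_on X T \<longleftrightarrow>
     (\<forall>x\<in>topspace X. X closure_of (range (\<lambda>n. iterate_int (topspace X) T n x)) = topspace X)"


section \<open>The Hilbert space \<open>\<ell>\<^sup>2(\<int>)\<close>\<close>

definition l2 :: "(int \<Rightarrow> complex) set" where
  "l2 = {u. (\<lambda>n. (cmod (u n))\<^sup>2) summable_on UNIV}"

text \<open>The norm and the inner product are meaningful only on \<open>l2\<close>, since \<open>infsum\<close> is \<open>0\<close> for
  families that are not summable.\<close>

definition l2_norm :: "(int \<Rightarrow> complex) \<Rightarrow> real" where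
  "l2_norm u = sqrt (\<Sum>\<^sub>\<infinity>n. (cmod (u n))\<^sup>2)"

definition l2_inner :: "(int \<Rightarrow> complex) \<Rightarrow> (int \<Rightarrow> complex) \<Rightarrow> complex" where
  "l2_inner u v = (\<Sum>\<^sub>\<infinity>n. cnj (u n) * v n)"

definition delta :: "int \<Rightarrow> int \<Rightarrow> complex" where
  "delta n = (\<lambda>k. if k = n then 1 else 0)"

definition l2_sums :: "(nat \<Rightarrow> int \<Rightarrow> complex) \<Rightarrow> (int \<Rightarrow> complex) \<Rightarrow> bool" where
  "l2_sums u v \<longleftrightarrow>
     (\<forall>k. u k \<in> l2) \<and> v \<in> l2 \<and>
     (\<lambda>N. l2_norm (\<lambda>n. (\<Sum>k<N. u k n) - v n)) \<longlonglongrightarrow> 0"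

text \<open>The exponential \<open>e\<^sup>A \<psi> = (\<Sum>k. A\<^sup>k \<psi> / k!)\<close> of a bounded operator \<open>A\<close>, as a series converging
  in the norm of \<open>\<ell>\<^sup>2(\<int>)\<close>.\<close>

definition op_exp ::
    "((int \<Rightarrow> complex) \<Rightarrow> (int \<Rightarrow> complex)) \<Rightarrow> (int \<Rightarrow> complex) \<Rightarrow> (int \<Rightarrow> complex)" where
  "op_exp A \<psi> = (THE \<phi>. l2_sums (\<lambda>k n. (A ^^ k) \<psi> n / fact k) \<phi>)"


section \<open>Schroedinger operators and uniform localization\<close>

definition schrodinger :: "(int \<Rightarrow> real) \<Rightarrow> (int \<Rightarrow> complex) \<Rightarrow> (int \<Rightarrow> complex)" where
  "schrodinger V \<psi> = (\<lambda>n. \<psi> (n + 1) + \<psi> (n - 1) + complex_of_real (V n) * \<psi> n)"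

text \<open>\<open>e\<^sup>-\<^sup>i\<^sup>t\<^sup>H\<close>\<close>

definition evolution ::
    "((int \<Rightarrow> complex) \<Rightarrow> (int \<Rightarrow> complex)) \<Rightarrow> real \<Rightarrow> (int \<Rightarrow> complex) \<Rightarrow> (int \<Rightarrow> complex)" where
  "evolution H t = op_exp (\<lambda>\<psi> n. - \<i> * complex_of_real t * H \<psi> n)"

definition eigenfunction ::
    "((int \<Rightarrow> complex) \<Rightarrow> (int \<Rightarrow> complex)) \<Rightarrow> (int \<Rightarrow> complex) \<Rightarrow> bool" where
  "eigenfunction H u \<longleftrightarrow>
     u \<in> l2 \<and> u \<noteq> (\<lambda>n. 0) \<and> (\<exists>E :: complex. H u = (\<lambda>n. E * u n))"

definition complete_in_l2 :: "(int \<Rightarrow> complex) set \<Rightarrow> bool" where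
  "complete_in_l2 U \<longleftrightarrow>
     (\<forall>\<psi>\<in>l2. \<forall>\<epsilon>>0. \<exists>F a. finite F \<and> F \<subseteq> U \<and> l2_norm (\<lambda>n. \<psi> n - (\<Sum>u\<in>F. a u * u n)) < \<epsilon>)"

definition uniformly_localized :: "real \<Rightarrow> real \<Rightarrow> (int \<Rightarrow> complex) set \<Rightarrow> bool" where
  "uniformly_localized r c U \<longleftrightarrow>
     (\<forall>u\<in>U. \<exists>m :: int. \<forall>n. cmod (u n) \<le> c * exp (- r * real_of_int \<bar>n - m\<bar>))"

text \<open>The eigenfunctions are nonzero, but not required to have norm \<open>1\<close>.\<close>

definition ULE :: "real \<Rightarrow> real \<Rightarrow> ((int \<Rightarrow> complex) \<Rightarrow> (int \<Rightarrow> complex)) \<Rightarrow> bool" where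
  "ULE r c H \<longleftrightarrow>
     r > 0 \<and> (\<exists>U. (\<forall>u\<in>U. eigenfunction H u) \<and> complete_in_l2 U \<and> uniformly_localized r c U)"

end

theory Submission
  imports Defs "HOL-Real_Asymp.Real_Asymp"
begin

text \<open>
  In coordinates, the translation is \<open>x \<mapsto> x + 1\<close> on \<open>lim \<int>/n\<^sub>k\<close> up to a unit, so a sampling function is a limit
  of \<open>n\<^sub>k\<close>-periodic potentials on \<open>\<int>\<close>. The potential is built one period at a time, together with an
  almost diagonalisation of the operator. Suppose that \<open>V + \<epsilon> \<Delta>\<close> with an \<open>M\<close>-periodic \<open>V\<close> is conjugate to
  \<open>D + R\<close>, where the diagonal \<open>D\<close> takes well separated values at sites that differ modulo \<open>M\<close>, and \<open>R\<close>
  only couples sites at nonzero multiples of \<open>M\<close>, hence is exponentially small in \<open>M\<close>. For the next period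
  \<open>M p\<close> one adds to \<open>V\<close> a tiny potential \<open>F\<close> whose effect on the diagonal, after conjugation, is exactly a
  multiple of the next digit of the site. This separates the remaining degenerate sites by an amount that
  decays much slower than any \<open>exp (- c M)\<close>, thanks to condition \<open>\<A>\<close>, and a contraction argument
  removes all entries between sites that differ modulo \<open>M p\<close>. The errors and the losses in the exponential
  weight are summable, so the limit conjugates the limiting operator to a diagonal one, with a kernel that
  decays exponentially off the diagonal. All bounds are invariant under shifts of \<open>\<int>\<close> and so hold uniformly
  in \<open>\<omega>\<close>.
\<close>


section \<open>The Banach algebra of kernels with summable columns\<close>

text \<open>Dividing entries by differences of diagonal values is an entrywise multiplication, which
  need not be bounded in the operator norm of \<open>l2\<close>; in weighted column sums it costs
  only the supremum 1 / g of the multiplier. This dictates the norm. The obstacle is one of scale: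
  separating p residues by g' needs a potential of size p g', far above the new gap g', so the
  entries it creates cannot all be divided by g'. Hence two eliminations. Entries off the old
  lattice are divided by the old gap g; what this leaves on the lattice is of second order, (p g')^2
  / g, or exponentially small in M, and only that is divided by g'. So p^2 g' must be small against
  g, and g decays like M^-2 up to exp (- O(j^2)). The loss of rate \<delta> with exp (- \<delta> M)
  below g' is of order (log of the next period + j^2) / M, which is summable. The columns of the
  limiting Q are eigenfunctions, not claimed orthonormal; the expansion Q a(D) Qi replaces the
  spectral theorem and yields completeness and the evolution.\<close>

text \<open>Finite partial sums are used so that summability need not be asserted separately and the
  bound survives entrywise limits.\<close>

definition col_bound :: "real \<Rightarrow> real \<Rightarrow> (int \<Rightarrow> int \<Rightarrow> real) \<Rightarrow> bool" where
  "col_bound \<kappa> C A \<longleftrightarrow>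
     (\<forall>n F. finite F \<longrightarrow> (\<Sum>m\<in>F. \<bar>A m n\<bar> * exp (\<kappa> * \<bar>of_int (m - n)\<bar>)) \<le> C)"

lemma col_boundD:
  "col_bound \<kappa> C A \<Longrightarrow> finite F \<Longrightarrow> (\<Sum>m\<in>F. \<bar>A m n\<bar> * exp (\<kappa> * \<bar>of_int (m - n)\<bar>)) \<le> C"
  by (auto simp: col_bound_def)

lemma col_bound_nonneg: "col_bound \<kappa> C A \<Longrightarrow> 0 \<le> C"
  using col_boundD[of \<kappa> C A "{}" 0] by simp

lemma col_bound_entry: "col_bound \<kappa> C A \<Longrightarrow> \<bar>A m n\<bar> * exp (\<kappa> * \<bar>of_int (m - n)\<bar>) \<le> C"
  using col_boundD[of \<kappa> C A "{m}" n] by simp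

lemma col_bound_dominated:
  assumes "col_bound \<kappa> C A" "\<And>m n. \<bar>B m n\<bar> \<le> c * \<bar>A m n\<bar>" "0 \<le> c"
  shows "col_bound \<kappa> (c * C) B"
  unfolding col_bound_def
proof (intro allI impI)
  fix n and F :: "int set" assume F: "finite F"
  have "(\<Sum>m\<in>F. \<bar>B m n\<bar> * exp (\<kappa> * \<bar>of_int (m - n)\<bar>))
      \<le> (\<Sum>m\<in>F. c * (\<bar>A m n\<bar> * exp (\<kappa> * \<bar>of_int (m - n)\<bar>)))"
    by (intro sum_mono) (simp add: mult.assoc[symmetric] mult_right_mono assms)
  also have "\<dots> = c * (\<Sum>m\<in>F. \<bar>A m n\<bar> * exp (\<kappa> * \<bar>of_int (m - n)\<bar>))"
    by (simp add: sum_distrib_left)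
  also have "\<dots> \<le> c * C"
    using col_boundD[OF assms(1) F] assms(3) by (intro mult_left_mono) auto
  finally show "(\<Sum>m\<in>F. \<bar>B m n\<bar> * exp (\<kappa> * \<bar>of_int (m - n)\<bar>)) \<le> c * C" .
qed

lemma col_bound_mono: "col_bound \<kappa> C A \<Longrightarrow> C \<le> C' \<Longrightarrow> col_bound \<kappa> C' A"
  unfolding col_bound_def by (meson order_trans)

lemma col_bound_anti_weight:
  assumes "col_bound \<kappa> C A" "\<kappa>' \<le> \<kappa>"
  shows "col_bound \<kappa>' C A"
  unfolding col_bound_def
proof (intro allI impI)
  fix n and F :: "int set" assume F: "finite F"
  have "(\<Sum>m\<in>F. \<bar>A m n\<bar> * exp (\<kappa>' * \<bar>of_int (m - n)\<bar>))
      \<le> (\<Sum>m\<in>F. \<bar>A m n\<bar> * exp (\<kappa> * \<bar>of_int (m - n)\<bar>))"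
    using assms(2) by (intro sum_mono mult_left_mono) (auto intro: mult_right_mono)
  also have "\<dots> \<le> C" using col_boundD[OF assms(1) F] .
  finally show "(\<Sum>m\<in>F. \<bar>A m n\<bar> * exp (\<kappa>' * \<bar>of_int (m - n)\<bar>)) \<le> C" .
qed

lemma col_bound_add:
  assumes "col_bound \<kappa> C A" "col_bound \<kappa> C' B"
  shows "col_bound \<kappa> (C + C') (\<lambda>m n. A m n + B m n)"
  unfolding col_bound_def
proof (intro allI impI)
  fix n and F :: "int set" assume F: "finite F"
  have "(\<Sum>m\<in>F. \<bar>A m n + B m n\<bar> * exp (\<kappa> * \<bar>of_int (m - n)\<bar>))
      \<le> (\<Sum>m\<in>F. \<bar>A m n\<bar> * exp (\<kappa> * \<bar>of_int (m - n)\<bar>) + \<bar>B m n\<bar> * exp (\<kappa> * \<bar>of_int (m - n)\<bar>))"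
    by (intro sum_mono) (simp add: ring_distribs(2)[symmetric])
  also have "\<dots> \<le> C + C'"
    using col_boundD[OF assms(1) F] col_boundD[OF assms(2) F] by (simp add: sum.distrib add_mono)
  finally show "(\<Sum>m\<in>F. \<bar>A m n + B m n\<bar> * exp (\<kappa> * \<bar>of_int (m - n)\<bar>)) \<le> C + C'" .
qed

lemma col_bound_scale: "col_bound \<kappa> C A \<Longrightarrow> col_bound \<kappa> (\<bar>c\<bar> * C) (\<lambda>m n. c * A m n)"
  by (erule col_bound_dominated) (auto simp: abs_mult)

lemma col_bound_column:
  assumes "col_bound \<kappa> C A"
  shows "(\<lambda>m. \<bar>A m n\<bar> * exp (\<kappa> * \<bar>of_int (m - n)\<bar>)) summable_on UNIV" (is "?f summable_on _")
    and "(\<Sum>\<^sub>\<infinity>m. \<bar>A m n\<bar> * exp (\<kappa> * \<bar>of_int (m - n)\<bar>)) \<le> C"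
proof -
  show *: "?f summable_on UNIV"
    by (rule nonneg_bdd_above_summable_on) (auto intro!: bdd_aboveI2[where M = C] col_boundD[OF assms] simp del: of_int_diff)
  show "infsum ?f UNIV \<le> C"
    by (rule infsum_le_finite_sums[OF *]) (auto intro!: col_boundD[OF assms] simp del: of_int_diff)
qed

lemma col_bound_0_column:
  assumes "col_bound 0 C A"
  shows "(\<lambda>m. \<bar>A m n\<bar>) summable_on UNIV" "(\<Sum>\<^sub>\<infinity>m. \<bar>A m n\<bar>) \<le> C"
  using col_bound_column[OF assms, of n] by simp_all

lemma abs_summable_bounded_mult:
  fixes f g :: "'i \<Rightarrow> real"
  assumes "\<And>l. \<bar>f l\<bar> \<le> C" "(\<lambda>l. \<bar>g l\<bar>) summable_on UNIV"
  shows "(\<lambda>l. \<bar>f l * g l\<bar>) summable_on UNIV"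
proof (rule summable_on_comparison_test)
  show "(\<lambda>l. C * \<bar>g l\<bar>) summable_on UNIV" using assms(2) by (rule summable_on_cmult_right)
qed (auto simp: abs_mult intro: mult_right_mono assms(1))

lemma infsum_sum_swap:
  fixes f :: "'i \<Rightarrow> 'j \<Rightarrow> real"
  assumes "finite F" "\<And>m. m \<in> F \<Longrightarrow> f m summable_on A"
  shows "(\<lambda>l. \<Sum>m\<in>F. f m l) summable_on A" "(\<Sum>\<^sub>\<infinity>l\<in>A. \<Sum>m\<in>F. f m l) = (\<Sum>m\<in>F. \<Sum>\<^sub>\<infinity>l\<in>A. f m l)"
  using assms
proof (induction F)
  case (insert x F)
  { case 1 then show ?case using insert by (auto intro: summable_on_add) }
  { case 2 then show ?case using insert by (subst sum.insert) (auto simp: infsum_add) }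
qed auto

lemma exp_weight_triangle:
  fixes m l n :: int and \<kappa> :: real
  assumes "0 \<le> \<kappa>"
  shows "exp (\<kappa> * \<bar>of_int (m - n)\<bar>) \<le> exp (\<kappa> * \<bar>of_int (m - l)\<bar>) * exp (\<kappa> * \<bar>of_int (l - n)\<bar>)"
proof -
  have "\<bar>of_int (m - n) :: real\<bar> \<le> \<bar>of_int (m - l)\<bar> + \<bar>of_int (l - n)\<bar>" by linarith
  from mult_left_mono[OF this assms] show ?thesis
    by (simp add: exp_add[symmetric] ring_distribs(1))
qed

text \<open>The weight is submultiplicative by the triangle inequality, so it is distributed over
  the two factors. Summing over m first, for fixed l, leaves at most C times the weighted column sum
  of \<open>B\<close>.\<close>

lemma col_bound_mult:
  assumes A: "col_bound \<kappa> C A" and B: "col_bound \<kappa> C' B" and "0 \<le> \<kappa>"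
  shows "col_bound \<kappa> (C * C') (\<lambda>m n. \<Sum>\<^sub>\<infinity>l. A m l * B l n)"
  unfolding col_bound_def
proof (intro allI impI)
  fix n and F :: "int set" assume F: "finite F"
  let ?w = "\<lambda>m n :: int. exp (\<kappa> * \<bar>of_int (m - n)\<bar>) :: real"
  have w: "?w m n \<le> ?w m l * ?w l n" for m l by (rule exp_weight_triangle[OF assms(3)])
  note sB = col_bound_column[OF B, of n]
  have sW: "(\<lambda>l. \<bar>A m l\<bar> * ?w m l * (\<bar>B l n\<bar> * ?w l n)) summable_on UNIV" for m
  proof -
    have "(\<lambda>l. \<bar>\<bar>A m l\<bar> * ?w m l * (\<bar>B l n\<bar> * ?w l n)\<bar>) summable_on UNIV"
      by (rule abs_summable_bounded_mult[where C = C])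
         (use sB(1) col_bound_entry[OF A] in \<open>auto simp: abs_mult\<close>)
    then show ?thesis by (simp add: abs_mult)
  qed
  have term_le: "\<bar>A m l * B l n\<bar> * ?w m n \<le> \<bar>A m l\<bar> * ?w m l * (\<bar>B l n\<bar> * ?w l n)" for m l
    using mult_left_mono[OF w[of m l], of "\<bar>A m l * B l n\<bar>"] by (simp add: abs_mult mult_ac)
  have sAw: "(\<lambda>l. \<bar>A m l * B l n\<bar> * ?w m n) summable_on UNIV" for m
    by (rule summable_on_comparison_test[OF sW[of m]]) (use term_le in auto)
  have sA: "(\<lambda>l. \<bar>A m l * B l n\<bar>) summable_on UNIV" for m
    using summable_on_cmult_left[OF sAw[of m], of "inverse (?w m n)"] by (simp add: mult.assoc)
  have "(\<Sum>m\<in>F. \<bar>\<Sum>\<^sub>\<infinity>l. A m l * B l n\<bar> * ?w m n)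
      \<le> (\<Sum>m\<in>F. \<Sum>\<^sub>\<infinity>l. \<bar>A m l\<bar> * ?w m l * (\<bar>B l n\<bar> * ?w l n))"
  proof (rule sum_mono)
    fix m
    have "\<bar>\<Sum>\<^sub>\<infinity>l. A m l * B l n\<bar> * ?w m n \<le> (\<Sum>\<^sub>\<infinity>l. \<bar>A m l * B l n\<bar>) * ?w m n"
      using norm_infsum_bound[of "\<lambda>l. A m l * B l n" UNIV] sA[of m] by (intro mult_right_mono) auto
    also have "\<dots> = (\<Sum>\<^sub>\<infinity>l. \<bar>A m l * B l n\<bar> * ?w m n)"
      using sA[of m] by (simp add: infsum_cmult_left)
    also have "\<dots> \<le> (\<Sum>\<^sub>\<infinity>l. \<bar>A m l\<bar> * ?w m l * (\<bar>B l n\<bar> * ?w l n))"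
      using sAw sW term_le by (intro infsum_mono) auto
    finally show "\<bar>\<Sum>\<^sub>\<infinity>l. A m l * B l n\<bar> * ?w m n
      \<le> (\<Sum>\<^sub>\<infinity>l. \<bar>A m l\<bar> * ?w m l * (\<bar>B l n\<bar> * ?w l n))" .
  qed
  also have "\<dots> = (\<Sum>\<^sub>\<infinity>l. \<Sum>m\<in>F. \<bar>A m l\<bar> * ?w m l * (\<bar>B l n\<bar> * ?w l n))"
    using F sW by (intro infsum_sum_swap(2)[symmetric]) auto
  also have "\<dots> = (\<Sum>\<^sub>\<infinity>l. (\<Sum>m\<in>F. \<bar>A m l\<bar> * ?w m l) * (\<bar>B l n\<bar> * ?w l n))"
    by (simp add: sum_distrib_right)
  also have "\<dots> \<le> (\<Sum>\<^sub>\<infinity>l. C * (\<bar>B l n\<bar> * ?w l n))"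
  proof (intro infsum_mono)
    show "(\<lambda>l. (\<Sum>m\<in>F. \<bar>A m l\<bar> * ?w m l) * (\<bar>B l n\<bar> * ?w l n)) summable_on UNIV"
      using F sW by (simp only: sum_distrib_right) (intro infsum_sum_swap(1); simp)
    show "(\<lambda>l. C * (\<bar>B l n\<bar> * ?w l n)) summable_on UNIV"
      using sB(1) by (rule summable_on_cmult_right)
  qed (use col_boundD[OF A F] in \<open>auto intro!: mult_right_mono\<close>)
  also have "\<dots> = C * (\<Sum>\<^sub>\<infinity>l. \<bar>B l n\<bar> * ?w l n)"
    using sB(1) by (intro infsum_cmult_right) auto
  also have "\<dots> \<le> C * C'"
    using sB(2) col_bound_nonneg[OF A] by (intro mult_left_mono) auto
  finally show "(\<Sum>m\<in>F. \<bar>\<Sum>\<^sub>\<infinity>l. A m l * B l n\<bar> * ?w m n) \<le> C * C'" .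
qed

section \<open>Kernels as a Banach algebra\<close>

typedef kernel = "{A :: int \<Rightarrow> int \<Rightarrow> real. \<exists>C. col_bound 0 C A}"
  morphisms ent Kernel
  by (rule exI[of _ "\<lambda>_ _. 0"]) (auto simp: col_bound_def)

setup_lifting type_definition_kernel

lemma kernel_eqI: "(\<And>m n. ent A m n = ent B m n) \<Longrightarrow> A = B"
  by (metis ent_inject ext)

lemma kernel_mult_summable:
  assumes "col_bound 0 C A" "col_bound 0 C' B"
  shows "(\<lambda>l. \<bar>A m l * B l n\<bar>) summable_on UNIV"
  using col_bound_entry[OF assms(1)] col_bound_0_column(1)[OF assms(2)]
  by (intro abs_summable_bounded_mult[where C = C]) auto

instantiation kernel :: real_vector
begin

lift_definition zero_kernel :: kernel is "\<lambda>_ _. 0" by (auto simp: col_bound_def)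
lift_definition plus_kernel :: "kernel \<Rightarrow> kernel \<Rightarrow> kernel" is "\<lambda>A B m n. A m n + B m n"
  using col_bound_add by blast
lift_definition uminus_kernel :: "kernel \<Rightarrow> kernel" is "\<lambda>A m n. - A m n"
  by (auto simp: col_bound_def)
lift_definition minus_kernel :: "kernel \<Rightarrow> kernel \<Rightarrow> kernel" is "\<lambda>A B m n. A m n - B m n"
  using col_bound_add[OF _ col_bound_scale[where c = "-1"], of 0 _ _ _ _] by fastforce
lift_definition scaleR_kernel :: "real \<Rightarrow> kernel \<Rightarrow> kernel" is "\<lambda>c A m n. c * A m n"
  using col_bound_scale by blast

instance
  by standard (transfer; auto simp: algebra_simps fun_eq_iff)+

end

instantiation kernel :: real_algebra_1
begin

lift_definition one_kernel :: kernel is "\<lambda>m n. if m = n then 1 else 0"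
proof (intro exI[of _ 1])
  show "col_bound 0 1 (\<lambda>m n. if m = n then 1 else 0)"
    unfolding col_bound_def
  proof (intro allI impI)
    fix n :: int and F :: "int set" assume "finite F"
    have "(\<Sum>m\<in>F. \<bar>if m = n then 1 else 0\<bar> * exp (0 * \<bar>of_int (m - n)\<bar>)) = (\<Sum>m\<in>F. if m = n then 1 else (0::real))"
      by (intro sum.cong) auto
    also have "\<dots> \<le> 1" using \<open>finite F\<close> by simp
    finally show "(\<Sum>m\<in>F. \<bar>if m = n then 1 else 0\<bar> * exp (0 * \<bar>of_int (m - n)\<bar>)) \<le> (1::real)" .
  qed
qed

lift_definition times_kernel :: "kernel \<Rightarrow> kernel \<Rightarrow> kernel" is "\<lambda>A B m n. \<Sum>\<^sub>\<infinity>l. A m l * B l n"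
  using col_bound_mult by blast

instance
proof
  fix A B C :: kernel and a :: real
  have summ: "(\<lambda>l. f m l * g l n) summable_on UNIV"
    if "\<exists>C. col_bound 0 C f" "\<exists>C. col_bound 0 C g" for f g m n
    using that kernel_mult_summable abs_summable_summable[of "\<lambda>l. f m l * g l n"] by fastforce
  show "A * B * C = A * (B * C)"
  proof (transfer, clarify, intro ext)
    fix A B C a b c m n
    assume A: "col_bound 0 a A" and B: "col_bound 0 b B" and C: "col_bound 0 c C"
    have AB: "\<exists>c. col_bound 0 c (\<lambda>m n. \<Sum>\<^sub>\<infinity>l. A m l * B l n)" using col_bound_mult[OF A B] by auto
    let ?f = "\<lambda>l k. A m l * (B l k * C k n)"
    have sBC: "(\<lambda>l. \<bar>B l k * C k n\<bar>) summable_on UNIV" for k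
      using summable_on_cmult_left[OF col_bound_0_column(1)[OF B, of k], of "\<bar>C k n\<bar>"] by (simp add: abs_mult)
    have nBC: "(\<Sum>\<^sub>\<infinity>l. \<bar>B l k * C k n\<bar>) \<le> b * \<bar>C k n\<bar>" for k
      using col_bound_0_column[OF B, of k]
      by (simp add: abs_mult infsum_cmult_left' mult_right_mono)
    \<comment> \<open>Summing over l first bounds the k-th term by a * b * |C k n|; this absolute
      summability licenses the interchange of the two infinite sums.\<close>
    have "(\<lambda>x. norm (case x of (k, l) \<Rightarrow> ?f l k)) summable_on Sigma UNIV (\<lambda>_. UNIV)"
      unfolding Infinite_Sum.abs_summable_on_Sigma_iff
    proof (intro conjI ballI)
      have s1: "(\<lambda>l. \<bar>?f l k\<bar>) summable_on UNIV" for k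
        using abs_summable_bounded_mult[of "\<lambda>l. A m l" a "\<lambda>l. B l k * C k n"] col_bound_entry[OF A] sBC
        by simp
      then show "(\<lambda>l. norm (case (k, l) of (k, l) \<Rightarrow> ?f l k)) summable_on UNIV" for k by simp
      show "(\<lambda>k. norm (\<Sum>\<^sub>\<infinity>l. norm (case (k, l) of (k, l) \<Rightarrow> ?f l k))) summable_on UNIV"
      proof (rule summable_on_comparison_test)
        show "(\<lambda>k. a * (b * \<bar>C k n\<bar>)) summable_on UNIV"
          by (intro summable_on_cmult_right col_bound_0_column(1)[OF C])
        fix k
        have "(\<Sum>\<^sub>\<infinity>l. \<bar>?f l k\<bar>) \<le> (\<Sum>\<^sub>\<infinity>l. a * \<bar>B l k * C k n\<bar>)"
          using s1 sBC col_bound_entry[OF A]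
          by (intro infsum_mono summable_on_cmult_right) (auto simp: abs_mult intro!: mult_right_mono)
        also have "\<dots> \<le> a * (b * \<bar>C k n\<bar>)"
          using nBC[of k] col_bound_nonneg[OF A] by (simp add: infsum_cmult_right' mult_left_mono)
        finally show "norm (\<Sum>\<^sub>\<infinity>l. norm (case (k, l) of (k, l) \<Rightarrow> ?f l k)) \<le> a * (b * \<bar>C k n\<bar>)"
          by (simp add: infsum_nonneg)
      qed auto
    qed
    then have sw: "(\<lambda>(k, l). ?f l k) summable_on UNIV \<times> UNIV"
      by (rule abs_summable_summable)
    have "(\<Sum>\<^sub>\<infinity>k. (\<Sum>\<^sub>\<infinity>l. A m l * B l k) * C k n) = (\<Sum>\<^sub>\<infinity>k. \<Sum>\<^sub>\<infinity>l. ?f l k)"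
      by (simp add: infsum_cmult_left'[symmetric] mult.assoc)
    also have "\<dots> = (\<Sum>\<^sub>\<infinity>l. \<Sum>\<^sub>\<infinity>k. ?f l k)"
      using infsum_swap_banach[OF sw] .
    also have "\<dots> = (\<Sum>\<^sub>\<infinity>l. A m l * (\<Sum>\<^sub>\<infinity>k. B l k * C k n))"
      by (simp add: infsum_cmult_right')
    finally show "(\<Sum>\<^sub>\<infinity>l. (\<Sum>\<^sub>\<infinity>la. A m la * B la l) * C l n)
      = (\<Sum>\<^sub>\<infinity>l. A m l * (\<Sum>\<^sub>\<infinity>la. B l la * C la n))" .
  qed
  show "(A + B) * C = A * C + B * C"
    by (transfer, intro ext) (simp only: ring_distribs, intro infsum_add summ)
  show "A * (B + C) = A * B + A * C"
    by (transfer, intro ext) (simp only: ring_distribs, intro infsum_add summ)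
  show "a *\<^sub>R A * B = a *\<^sub>R (A * B)"
    by transfer (simp only: mult.assoc infsum_cmult_right')
  show "A * a *\<^sub>R B = a *\<^sub>R (A * B)"
    by (transfer, intro ext) (simp only: infsum_cmult_right'[symmetric] mult.left_commute)
  have delta: "(\<Sum>\<^sub>\<infinity>l. (if k = l then 1 else 0) * f l) = f k"
    "(\<Sum>\<^sub>\<infinity>l. f l * (if l = k then 1 else 0)) = f k" for f :: "int \<Rightarrow> real" and k
    using infsum_cong_neutral[of "{k}" UNIV f "\<lambda>l. (if k = l then 1 else 0) * f l"]
      infsum_cong_neutral[of "{k}" UNIV f "\<lambda>l. f l * (if l = k then 1 else 0)"] by auto
  show "1 * A = A"
    by transfer (simp only: delta)
  show "A * 1 = A"
    by transfer (simp only: delta)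
  show "(0::kernel) \<noteq> 1"
    by transfer (auto simp: fun_eq_iff)
qed

end

instantiation kernel :: real_normed_algebra_1
begin

text \<open>This is the operator norm on absolutely summable sequences.\<close>

definition norm_kernel :: "kernel \<Rightarrow> real" where
  "norm_kernel A = (SUP (n, F)\<in>UNIV \<times> Collect finite. \<Sum>m\<in>F. \<bar>ent A m n\<bar>)"

definition dist_kernel :: "kernel \<Rightarrow> kernel \<Rightarrow> real" where
  "dist_kernel A B = norm (A - B)"

definition sgn_kernel :: "kernel \<Rightarrow> kernel" where
  "sgn_kernel A = inverse (norm A) *\<^sub>R A"

definition uniformity_kernel :: "(kernel \<times> kernel) filter" where
  "uniformity_kernel = (INF e\<in>{0 <..}. principal {(x, y). dist x y < e})"

definition open_kernel :: "kernel set \<Rightarrow> bool" where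
  "open_kernel U = (\<forall>x\<in>U. eventually (\<lambda>(x', y). x' = x \<longrightarrow> y \<in> U) uniformity)"

lemma norm_kernel_le: "norm A \<le> C \<longleftrightarrow> col_bound 0 C (ent A)"
proof -
  obtain C0 where "col_bound 0 C0 (ent A)" using ent[of A] by auto
  then have "bdd_above ((\<lambda>(n, F). \<Sum>m\<in>F. \<bar>ent A m n\<bar>) ` (UNIV \<times> Collect finite))"
    by (intro bdd_aboveI2[where M = C0]) (auto simp: col_bound_def)
  then have "norm A \<le> C \<longleftrightarrow> (\<forall>x\<in>UNIV \<times> Collect finite. (\<lambda>(n, F). \<Sum>m\<in>F. \<bar>ent A m n\<bar>) x \<le> C)"
    unfolding norm_kernel_def by (intro cSUP_le_iff) auto
  then show ?thesis by (auto simp: col_bound_def)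
qed

lemma col_bound_norm: "col_bound 0 (norm A) (ent A)"
  using norm_kernel_le by blast

instance
proof
  fix A B :: kernel and a :: real
  have nn: "0 \<le> norm A" for A :: kernel using col_bound_nonneg[OF col_bound_norm] .
  show "norm A = 0 \<longleftrightarrow> A = 0"
  proof
    assume "norm A = 0"
    then have "\<bar>ent A m n\<bar> \<le> 0" for m n
      using col_bound_entry[OF col_bound_norm[of A], of m n] by simp
    then show "A = 0" by (intro kernel_eqI) (simp add: zero_kernel.rep_eq)
  next
    assume "A = 0"
    then have "norm A \<le> 0" unfolding norm_kernel_le by (simp add: col_bound_def zero_kernel.rep_eq)
    then show "norm A = 0" using nn[of A] by simp
  qed
  show "norm (A + B) \<le> norm A + norm B"
    unfolding norm_kernel_le plus_kernel.rep_eq by (intro col_bound_add col_bound_norm)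
  have scale: "norm (a *\<^sub>R A) \<le> \<bar>a\<bar> * norm A" for a and A :: kernel
    unfolding norm_kernel_le scaleR_kernel.rep_eq by (intro col_bound_scale col_bound_norm)
  show "norm (a *\<^sub>R A) = \<bar>a\<bar> * norm A"
  proof (cases "a = 0")
    case True
    then show ?thesis using scale[of a A] nn[of "a *\<^sub>R A"] by simp
  next
    case False
    then have "norm A \<le> \<bar>inverse a\<bar> * norm (a *\<^sub>R A)" using scale[of "inverse a" "a *\<^sub>R A"] by simp
    then have "\<bar>a\<bar> * norm A \<le> norm (a *\<^sub>R A)" using False by (simp add: field_simps abs_inverse)
    then show ?thesis using scale[of a A] by simp
  qed
  show "norm (A * B) \<le> norm A * norm B"
    unfolding norm_kernel_le times_kernel.rep_eq by (intro col_bound_mult col_bound_norm) simp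
  show "norm (1::kernel) = 1"
  proof (rule antisym)
    show "norm (1::kernel) \<le> 1"
      unfolding norm_kernel_le col_bound_def
    proof (intro allI impI)
      fix n :: int and F :: "int set" assume "finite F"
      then have "(\<Sum>m\<in>F. if m = n then 1 else (0::real)) \<le> 1" by simp
      moreover have "(\<Sum>m\<in>F. \<bar>ent 1 m n\<bar> * exp (0 * \<bar>of_int (m - n)\<bar>)) = (\<Sum>m\<in>F. if m = n then 1 else 0)"
        by (intro sum.cong) (auto simp: one_kernel.rep_eq)
      ultimately show "(\<Sum>m\<in>F. \<bar>ent 1 m n\<bar> * exp (0 * \<bar>of_int (m - n)\<bar>)) \<le> 1" by simp
    qed
    show "1 \<le> norm (1::kernel)"
      using col_bound_entry[OF col_bound_norm[of 1], of 0 0] by (simp add: one_kernel.rep_eq)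
  qed
qed (auto simp: dist_kernel_def sgn_kernel_def uniformity_kernel_def open_kernel_def)

end

lemma ent_abs_le_norm: "\<bar>ent A m n\<bar> \<le> norm A"
  using col_bound_entry[OF col_bound_norm[of A], of m n] by simp

lemma ent_tendsto:
  assumes "(A \<longlongrightarrow> L) F"
  shows "((\<lambda>k. ent (A k) m n) \<longlongrightarrow> ent L m n) F"
proof -
  have "((\<lambda>k. norm (A k - L)) \<longlongrightarrow> 0) F" using assms by (simp add: tendsto_norm_zero_iff LIM_zero_iff)
  then have "((\<lambda>k. ent (A k) m n - ent L m n) \<longlongrightarrow> 0) F"
    by (rule Lim_null_comparison[rotated])
       (use ent_abs_le_norm[of "_ - L" m n] in \<open>auto simp: minus_kernel.rep_eq\<close>)
  then show ?thesis by (simp add: LIM_zero_iff)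
qed

text \<open>Each inequality in \<open>col_bound\<close> involves finitely many entries, so entrywise
  convergence suffices. This turns the entrywise limit of a Cauchy sequence into a limit in
  norm.\<close>

lemma col_bound_limit:
  assumes "\<And>m n. (\<lambda>k. A k m n) \<longlonglongrightarrow> L m n" "\<forall>\<^sub>F k in sequentially. col_bound \<kappa> C (A k)"
  shows "col_bound \<kappa> C L"
  unfolding col_bound_def
proof (intro allI impI)
  fix n and F :: "int set" assume F: "finite F"
  have "(\<lambda>k. \<Sum>m\<in>F. \<bar>A k m n\<bar> * exp (\<kappa> * \<bar>of_int (m - n)\<bar>)) \<longlonglongrightarrow> (\<Sum>m\<in>F. \<bar>L m n\<bar> * exp (\<kappa> * \<bar>of_int (m - n)\<bar>))"
    by (intro tendsto_intros assms)
  then show "(\<Sum>m\<in>F. \<bar>L m n\<bar> * exp (\<kappa> * \<bar>of_int (m - n)\<bar>)) \<le> C"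
    by (rule tendsto_upperbound)
       (use assms(2) F in \<open>auto simp: col_bound_def elim!: eventually_mono\<close>)
qed

instance kernel :: banach
proof
  fix A :: "nat \<Rightarrow> kernel" assume A: "Cauchy A"
  define L where "L m n = lim (\<lambda>k. ent (A k) m n)" for m n
  have lim: "(\<lambda>k. ent (A k) m n) \<longlonglongrightarrow> L m n" for m n
  proof -
    have "Cauchy (\<lambda>k. ent (A k) m n)"
    proof (rule metric_CauchyI)
      fix e :: real assume "0 < e"
      then obtain M where M: "\<And>i j. i \<ge> M \<Longrightarrow> j \<ge> M \<Longrightarrow> norm (A i - A j) < e"
        using A by (metis Cauchy_def dist_norm)
      have "dist (ent (A i) m n) (ent (A j) m n) < e" if "i \<ge> M" "j \<ge> M" for i j
        using M[OF that] ent_abs_le_norm[of "A i - A j" m n] by (simp add: dist_real_def minus_kernel.rep_eq)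
      then show "\<exists>M. \<forall>i\<ge>M. \<forall>j\<ge>M. dist (ent (A i) m n) (ent (A j) m n) < e" by blast
    qed
    then show ?thesis unfolding L_def by (simp add: Cauchy_convergent_iff convergent_LIMSEQ_iff)
  qed
  have close: "col_bound 0 e (\<lambda>m n. ent (A i) m n - L m n)" if "\<And>j. j \<ge> M \<Longrightarrow> norm (A i - A j) \<le> e" for i M e
  proof (rule col_bound_limit)
    show "(\<lambda>j. ent (A i) m n - ent (A j) m n) \<longlonglongrightarrow> ent (A i) m n - L m n" for m n
      by (intro tendsto_intros lim)
    show "\<forall>\<^sub>F j in sequentially. col_bound 0 e (\<lambda>m n. ent (A i) m n - ent (A j) m n)"
      using that unfolding norm_kernel_le minus_kernel.rep_eq eventually_sequentially by blast
  qed
  obtain M where M: "\<And>i j. i \<ge> M \<Longrightarrow> j \<ge> M \<Longrightarrow> norm (A i - A j) < 1"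
    using A unfolding Cauchy_def by (metis dist_norm zero_less_one)
  have cb: "col_bound 0 1 (\<lambda>m n. ent (A M) m n - L m n)"
    by (rule close[of M]) (use M in \<open>force intro: less_imp_le\<close>)
  have "col_bound 0 (norm (A M) + \<bar>-1\<bar> * 1) (\<lambda>m n. ent (A M) m n + -1 * (ent (A M) m n - L m n))"
    by (intro col_bound_add col_bound_norm col_bound_scale cb)
  then have "L \<in> {A. \<exists>C. col_bound 0 C A}" by auto
  then have L: "ent (Kernel L) = L" by (rule Kernel_inverse)
  have "A \<longlonglongrightarrow> Kernel L"
  proof (rule metric_LIMSEQ_I)
    fix e :: real assume e: "0 < e"
    then obtain M where M: "\<And>i j. i \<ge> M \<Longrightarrow> j \<ge> M \<Longrightarrow> norm (A i - A j) < e / 2"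
      using A unfolding Cauchy_def by (metis dist_norm half_gt_zero)
    have "dist (A i) (Kernel L) < e" if "i \<ge> M" for i
    proof -
      have "norm (A i - Kernel L) \<le> e / 2"
        unfolding norm_kernel_le minus_kernel.rep_eq L
        by (rule close[of M]) (use M that in \<open>force intro: less_imp_le\<close>)
      then show ?thesis using e by (simp add: dist_norm)
    qed
    then show "\<exists>M. \<forall>i\<ge>M. dist (A i) (Kernel L) < e" by blast
  qed
  then show "convergent A" by (auto simp: convergent_def)
qed

text \<open>The type carries only the weight 0; larger weights stay predicates, because the rate
  drops at every scale and all scales must live in one algebra.\<close>

abbreviation weight_bound :: "real \<Rightarrow> real \<Rightarrow> kernel \<Rightarrow> bool" where
  "weight_bound \<kappa> C A \<equiv> col_bound \<kappa> C (ent A)"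

lemma ent_mult: "ent (A * B) m n = (\<Sum>\<^sub>\<infinity>l. ent A m l * ent B l n)"
  by (simp add: times_kernel.rep_eq)

lemma ent_one: "ent 1 m n = (if m = n then 1 else 0)"
  by (simp add: one_kernel.rep_eq)

lemmas ent_simps [simp] = zero_kernel.rep_eq plus_kernel.rep_eq minus_kernel.rep_eq
  uminus_kernel.rep_eq scaleR_kernel.rep_eq ent_one

lemma weight_bound_add:
  "weight_bound \<kappa> C A \<Longrightarrow> weight_bound \<kappa> C' B \<Longrightarrow> weight_bound \<kappa> (C + C') (A + B)"
  using col_bound_add[of \<kappa> C "ent A" C' "ent B"] by (simp add: plus_kernel.rep_eq[abs_def])

lemma weight_bound_uminus: "weight_bound \<kappa> C A \<Longrightarrow> weight_bound \<kappa> C (- A)"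
  by (simp add: col_bound_def)

lemma weight_bound_diff:
  "weight_bound \<kappa> C A \<Longrightarrow> weight_bound \<kappa> C' B \<Longrightarrow> weight_bound \<kappa> (C + C') (A - B)"
  using weight_bound_add[of \<kappa> C A C' "- B"] weight_bound_uminus[of \<kappa> C' B] by simp

lemma weight_bound_mult:
  "weight_bound \<kappa> C A \<Longrightarrow> weight_bound \<kappa> C' B \<Longrightarrow> 0 \<le> \<kappa> \<Longrightarrow> weight_bound \<kappa> (C * C') (A * B)"
  using col_bound_mult[of \<kappa> C "ent A" C' "ent B"] by (simp add: times_kernel.rep_eq)

lemma weight_bound_scaleR: "weight_bound \<kappa> C A \<Longrightarrow> weight_bound \<kappa> (\<bar>c\<bar> * C) (c *\<^sub>R A)"
  using col_bound_scale[of \<kappa> C "ent A" c] by (simp add: scaleR_kernel.rep_eq[abs_def])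

lemma weight_bound_zero [simp]: "weight_bound \<kappa> 0 0"
  by (simp add: col_bound_def)

lemma weight_bound_imp_norm: "weight_bound \<kappa> C A \<Longrightarrow> 0 \<le> \<kappa> \<Longrightarrow> norm A \<le> C"
  unfolding norm_kernel_le by (rule col_bound_anti_weight)

definition diagonal :: "kernel \<Rightarrow> bool" where
  "diagonal A \<longleftrightarrow> (\<forall>m n. m \<noteq> n \<longrightarrow> ent A m n = 0)"

lemma col_bound_diagonal:
  assumes "\<And>m n. m \<noteq> n \<Longrightarrow> A m n = 0" "\<And>n. \<bar>A n n\<bar> \<le> C"
  shows "col_bound \<kappa> C A"
  unfolding col_bound_def
proof (intro allI impI)
  fix n and F :: "int set" assume F: "finite F"
  have "(\<Sum>m\<in>F. \<bar>A m n\<bar> * exp (\<kappa> * \<bar>of_int (m - n)\<bar>)) = (\<Sum>m\<in>F. if m = n then \<bar>A n n\<bar> else 0)"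
    using assms(1) by (intro sum.cong) auto
  also have "\<dots> \<le> \<bar>A n n\<bar>" using F by simp
  also have "\<dots> \<le> C" by (rule assms(2))
  finally show "(\<Sum>m\<in>F. \<bar>A m n\<bar> * exp (\<kappa> * \<bar>of_int (m - n)\<bar>)) \<le> C" .
qed

lemma weight_bound_diagonal:
  assumes "diagonal A" "\<And>n. \<bar>ent A n n\<bar> \<le> C"
  shows "weight_bound \<kappa> C A"
  using assms by (intro col_bound_diagonal) (auto simp: diagonal_def)

lemma weight_bound_diagonal_norm: "diagonal A \<Longrightarrow> weight_bound \<kappa> (norm A) A"
  by (intro weight_bound_diagonal ent_abs_le_norm)

lemma weight_bound_one: "weight_bound \<kappa> 1 1"
  by (intro weight_bound_diagonal) (auto simp: diagonal_def)

lemma diagonal_add: "diagonal A \<Longrightarrow> diagonal B \<Longrightarrow> diagonal (A + B)"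
  by (simp add: diagonal_def)

lemma infsum_single:
  fixes f :: "int \<Rightarrow> 'b :: {topological_comm_monoid_add, t2_space}"
  assumes "\<And>l. l \<noteq> k \<Longrightarrow> f l = 0"
  shows "(\<Sum>\<^sub>\<infinity>l. f l) = f k"
  using infsum_cong_neutral[of "{k}" UNIV f f] assms by auto

lemma ent_diagonal_mult_left: "diagonal D \<Longrightarrow> ent (D * A) m n = ent D m m * ent A m n"
  unfolding ent_mult by (subst infsum_single[of m]) (auto simp: diagonal_def)

lemma ent_diagonal_mult_right: "diagonal D \<Longrightarrow> ent (A * D) m n = ent A m n * ent D n n"
  unfolding ent_mult by (subst infsum_single[of n]) (auto simp: diagonal_def)

text \<open>Unspecified for unbounded \<open>\<phi>\<close>.\<close>
definition hadamard :: "(int \<Rightarrow> int \<Rightarrow> real) \<Rightarrow> kernel \<Rightarrow> kernel" where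
  "hadamard \<phi> A = Kernel (\<lambda>m n. \<phi> m n * ent A m n)"

lemma ent_hadamard:
  assumes \<phi>: "\<And>m n. \<bar>\<phi> m n\<bar> \<le> c"
  shows "ent (hadamard \<phi> A) m n = \<phi> m n * ent A m n"
proof -
  have "0 \<le> c" using \<phi>[of 0 0] by linarith
  then have "col_bound 0 (c * norm A) (\<lambda>m n. \<phi> m n * ent A m n)"
    using \<phi> by (intro col_bound_dominated[OF col_bound_norm]) (auto simp: abs_mult intro: mult_right_mono)
  then have "(\<lambda>m n. \<phi> m n * ent A m n) \<in> {A. \<exists>C. col_bound 0 C A}" by blast
  then show ?thesis unfolding hadamard_def by (simp add: Kernel_inverse)
qed

text \<open>The norms see only absolute values of entries, so a multiplier costs its supremum. This
  is the estimate behind dividing by diagonal differences.\<close>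

lemma weight_bound_hadamard:
  assumes "\<And>m n. \<bar>\<phi> m n\<bar> \<le> c" "weight_bound \<kappa> C A"
  shows "weight_bound \<kappa> (c * C) (hadamard \<phi> A)"
  using assms(1)[of 0 0] assms(2)
  by (elim col_bound_dominated) (auto simp: ent_hadamard[OF assms(1)] abs_mult intro: mult_right_mono assms(1))

definition lattice_part :: "int \<Rightarrow> kernel \<Rightarrow> kernel" where
  "lattice_part N = hadamard (\<lambda>m n. of_bool (N dvd m - n))"

definition diagonal_part :: "kernel \<Rightarrow> kernel" where
  "diagonal_part = hadamard (\<lambda>m n. of_bool (m = n))"

lemma ent_lattice_part [simp]: "ent (lattice_part N A) m n = (if N dvd m - n then ent A m n else 0)"
  unfolding lattice_part_def by (subst ent_hadamard[where c = 1]) auto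

lemma ent_diagonal_part [simp]: "ent (diagonal_part A) m n = (if m = n then ent A m n else 0)"
  unfolding diagonal_part_def by (subst ent_hadamard[where c = 1]) auto

lemma diagonal_diagonal_part: "diagonal (diagonal_part A)"
  by (simp add: diagonal_def)

lemma weight_bound_subentries:
  assumes "weight_bound \<kappa> C A" "\<And>m n. ent B m n = ent A m n \<or> ent B m n = 0"
  shows "weight_bound \<kappa> C B"
proof -
  have "\<bar>ent B m n\<bar> \<le> 1 * \<bar>ent A m n\<bar>" for m n using assms(2)[of m n] by auto
  then show ?thesis using col_bound_dominated[OF assms(1), of "ent B" 1] by simp
qed

lemma weight_bound_lattice_part: "weight_bound \<kappa> C A \<Longrightarrow> weight_bound \<kappa> C (lattice_part N A)"
  by (erule weight_bound_subentries) auto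

lemma weight_bound_diagonal_part: "weight_bound \<kappa> C A \<Longrightarrow> weight_bound \<kappa> C (diagonal_part A)"
  by (erule weight_bound_subentries) auto

lemma weight_bound_off_lattice: "weight_bound \<kappa> C A \<Longrightarrow> weight_bound \<kappa> C (A - lattice_part N A)"
  by (erule weight_bound_subentries) auto

lemma weight_bound_off_diagonal: "weight_bound \<kappa> C A \<Longrightarrow> weight_bound \<kappa> C (A - diagonal_part A)"
  by (erule weight_bound_subentries) auto

section \<open>Supports on and off a lattice\<close>

definition on_lattice :: "int \<Rightarrow> kernel \<Rightarrow> bool" where
  "on_lattice N A \<longleftrightarrow> (\<forall>m n. \<not> N dvd m - n \<longrightarrow> ent A m n = 0)"

definition off_lattice :: "int \<Rightarrow> kernel \<Rightarrow> bool" where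
  "off_lattice N A \<longleftrightarrow> (\<forall>m n. N dvd m - n \<longrightarrow> ent A m n = 0)"

text \<open>Congruence modulo \<open>N\<close> splits the sites into classes: \<open>B\<close> stays
  inside a class and \<open>A\<close> always leaves it, so the product leaves it too.\<close>

lemma off_lattice_mult:
  assumes "off_lattice N A" "on_lattice N B"
  shows "off_lattice N (A * B)"
  unfolding off_lattice_def ent_mult
proof (intro allI impI infsum_0)
  fix m n l assume "N dvd m - n"
  then have "N dvd m - l" if "N dvd l - n"
    using dvd_diff[OF _ that, of "m - n"] by simp
  then show "ent A m l * ent B l n = 0"
    using assms unfolding off_lattice_def on_lattice_def by auto
qed

text \<open>Off the diagonal, a kernel supported on a lattice only has entries at distance at least \<open>N\<close>,
  so lowering the weight gains an exponential factor.\<close>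
lemma weight_bound_on_lattice:
  assumes "on_lattice N A" "\<And>n. ent A n n = 0" "0 < N" "weight_bound \<kappa> C A" "0 \<le> \<delta>"
  shows "weight_bound (\<kappa> - \<delta>) (exp (- \<delta> * of_int N) * C) A"
  unfolding col_bound_def
proof (intro allI impI)
  fix n and F :: "int set" assume F: "finite F"
  have "(\<Sum>m\<in>F. \<bar>ent A m n\<bar> * exp ((\<kappa> - \<delta>) * \<bar>of_int (m - n)\<bar>))
      \<le> (\<Sum>m\<in>F. exp (- \<delta> * of_int N) * (\<bar>ent A m n\<bar> * exp (\<kappa> * \<bar>of_int (m - n)\<bar>)))"
  proof (rule sum_mono)
    fix m
    show "\<bar>ent A m n\<bar> * exp ((\<kappa> - \<delta>) * \<bar>of_int (m - n)\<bar>)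
      \<le> exp (- \<delta> * of_int N) * (\<bar>ent A m n\<bar> * exp (\<kappa> * \<bar>of_int (m - n)\<bar>))"
    proof (cases "m \<noteq> n \<and> N dvd m - n")
      case True
      then have "N \<le> \<bar>m - n\<bar>" using assms(3) by (intro zdvd_imp_le) auto
      then have "of_int N \<le> \<bar>of_int (m - n) :: real\<bar>" by linarith
      from mult_left_mono[OF this assms(5)]
      have "exp ((\<kappa> - \<delta>) * \<bar>of_int (m - n)\<bar>) \<le> exp (- \<delta> * of_int N) * exp (\<kappa> * \<bar>of_int (m - n)\<bar>)"
        unfolding exp_add[symmetric] exp_le_cancel_iff by (simp add: algebra_simps)
      from mult_left_mono[OF this, of "\<bar>ent A m n\<bar>"] show ?thesis by (simp add: mult_ac)
    qed (use assms(1,2) in \<open>auto simp: on_lattice_def\<close>)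
  qed
  also have "\<dots> = exp (- \<delta> * of_int N) * (\<Sum>m\<in>F. \<bar>ent A m n\<bar> * exp (\<kappa> * \<bar>of_int (m - n)\<bar>))"
    by (simp add: sum_distrib_left)
  also have "\<dots> \<le> exp (- \<delta> * of_int N) * C"
    using col_boundD[OF assms(4) F] by (intro mult_left_mono) auto
  finally show "(\<Sum>m\<in>F. \<bar>ent A m n\<bar> * exp ((\<kappa> - \<delta>) * \<bar>of_int (m - n)\<bar>)) \<le> exp (- \<delta> * of_int N) * C" .
qed

section \<open>Periodic kernels and closed conditions\<close>

definition periodic :: "int \<Rightarrow> kernel \<Rightarrow> bool" where
  "periodic K A \<longleftrightarrow> (\<forall>m n. ent A (m + K) (n + K) = ent A m n)"

lemma ent_mult_shift:
  "ent (A * B) (m + K) (n + K) = (\<Sum>\<^sub>\<infinity>l. ent A (m + K) (l + K) * ent B (l + K) (n + K))"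
  unfolding ent_mult
  by (rule infsum_reindex_bij_witness[of UNIV "\<lambda>l. l - K" "\<lambda>l. l + K", symmetric]) auto

lemma periodic_mult: "periodic K A \<Longrightarrow> periodic K B \<Longrightarrow> periodic K (A * B)"
  unfolding periodic_def ent_mult_shift by (simp add: ent_mult)

lemma periodic_add: "periodic K A \<Longrightarrow> periodic K B \<Longrightarrow> periodic K (A + B)"
  and periodic_diff: "periodic K A \<Longrightarrow> periodic K B \<Longrightarrow> periodic K (A - B)"
  and periodic_uminus: "periodic K A \<Longrightarrow> periodic K (- A)"
  and periodic_one: "periodic K 1"
  and periodic_zero: "periodic K 0"
  by (simp_all add: periodic_def)

lemma periodic_lattice_part: "periodic K A \<Longrightarrow> periodic K (lattice_part N A)"
  and periodic_diagonal_part: "periodic K A \<Longrightarrow> periodic K (diagonal_part A)"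
  by (simp_all add: periodic_def)

lemma periodic_dvd:
  assumes "periodic K A" "K dvd L"
  shows "periodic L A"
proof -
  have nat: "ent A (m + int j * K) (n + int j * K) = ent A m n" for m n j
  proof (induction j)
    case (Suc j)
    have "ent A (m + int (Suc j) * K) (n + int (Suc j) * K) = ent A ((m + int j * K) + K) ((n + int j * K) + K)"
      by (simp add: algebra_simps)
    then show ?case using assms(1) Suc unfolding periodic_def by metis
  qed simp
  obtain q where q: "L = K * q" using assms(2) by (elim dvdE)
  show ?thesis
    unfolding periodic_def
  proof (intro allI)
    fix m n
    show "ent A (m + L) (n + L) = ent A m n"
    proof (cases "q \<ge> 0")
      case True
      then show ?thesis using nat[of m "nat q" n] q by (simp add: mult.commute)
    next
      case False
      then show ?thesis using nat[of "m + L" "nat (- q)" "n + L"] q by (simp add: mult.commute)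
    qed
  qed
qed

lemma continuous_ent [continuous_intros]: "continuous_on S (\<lambda>A. ent A m n)"
  unfolding continuous_on_def by (intro ballI ent_tendsto tendsto_ident_at)

text \<open>Closed conditions can cut out the domains of contractions, whose fixed points then
  inherit decay, period and support. They are closed in the unweighted norm, so only there must a
  map contract; for the weight, invariance of the domain suffices.\<close>

lemma closed_weight_bound: "closed {A. weight_bound \<kappa> C A}"
  unfolding col_bound_def
  by (intro closed_Collect_all closed_Collect_imp closed_Collect_le continuous_intros) auto

lemma closed_periodic: "closed {A. periodic K A}"
  unfolding periodic_def by (intro closed_Collect_all closed_Collect_eq continuous_intros)

lemma closed_diagonal: "closed {A. diagonal A}"
  unfolding diagonal_def
  by (intro closed_Collect_all closed_Collect_imp closed_Collect_eq continuous_intros) auto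

lemma closed_off_lattice: "closed {A. off_lattice N A}"
  unfolding off_lattice_def
  by (intro closed_Collect_all closed_Collect_imp closed_Collect_eq continuous_intros) auto


section \<open>Removing entries off a lattice\<close>

text \<open>Conjugation by \<open>1 + W\<close> removes from the perturbation \<open>P\<close> all entries off the lattice, where the
  divisors are at least \<open>g\<close>. The equation for \<open>W\<close> is the off-lattice part of
  \<open>(D + P) (1 + W) = (1 + W) (D + R)\<close>, in which \<open>R\<close> is the lattice part of \<open>P (1 + W)\<close>.\<close>
lemma eliminate_off_lattice:
  fixes D P :: kernel
  assumes D: "diagonal D" and gap: "\<And>m n. \<not> N dvd m - n \<Longrightarrow> g \<le> \<bar>ent D m m - ent D n n\<bar>"
    and g: "0 < g" and \<kappa>: "0 \<le> \<kappa>" and P: "weight_bound \<kappa> \<beta> P" and \<beta>: "16 * \<beta> \<le> g"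
    and per: "periodic K D" "periodic K P"
  shows "\<exists>W. weight_bound \<kappa> (4 * \<beta> / g) W \<and> periodic K W \<and>
    (D + P) * (1 + W) = (1 + W) * (D + lattice_part N (P * (1 + W)))"
proof -
  \<comment> \<open>Inverts, up to sign, the commutator with \<open>D\<close> on off-lattice
    entries: the (m, n) entry of \<open>D * W - W * D\<close> is the difference of diagonal values
    times that of \<open>W\<close>. The value 0 on the lattice keeps \<open>W\<close> off the
    lattice.\<close>
  define \<phi> where "\<phi> m n = (if N dvd m - n then 0 else 1 / (ent D n n - ent D m m))" for m n
  have \<phi>: "\<bar>\<phi> m n\<bar> \<le> 1 / g" for m n
    using gap[of m n] g by (auto simp: \<phi>_def abs_minus_commute intro!: divide_left_mono mult_pos_pos)
  have \<phi>_per: "\<phi> (m + K) (n + K) = \<phi> m n" for m n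
    using per(1) by (simp add: \<phi>_def periodic_def)
  \<comment> \<open>Radius of an invariant ball: images have weighted bound \<beta> (1 + w)^2 / g,
    and (1 + w)^2 < 4 because 16 \<beta> \<le> g gives w \<le> 1/4.\<close>
  define w where "w = 4 * \<beta> / g"
  have \<beta>0: "0 \<le> \<beta>" using col_bound_nonneg[OF P] .
  have w: "0 \<le> w" "w \<le> 1 / 4" using \<beta> \<beta>0 g by (auto simp: w_def field_simps)
  define Z where "Z W = (P * (1 + W) - lattice_part N (P * (1 + W))) - W * lattice_part N (P * (1 + W))" for W
  define \<Phi> where "\<Phi> W = hadamard \<phi> (Z W)" for W
  define S where "S = {W. weight_bound \<kappa> w W} \<inter> {W. periodic K W} \<inter> {W. off_lattice N W}"
  have "complete S"
    unfolding complete_eq_closed S_def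
    by (intro closed_Int closed_weight_bound closed_periodic closed_off_lattice)
  moreover have "S \<noteq> {}"
  proof -
    have "0 \<in> S" using w col_bound_mono[OF weight_bound_zero] by (auto simp: S_def periodic_zero off_lattice_def)
    then show ?thesis by blast
  qed
  moreover have "\<Phi> ` S \<subseteq> S"
  proof (rule image_subsetI)
    fix W assume "W \<in> S"
    then have W: "weight_bound \<kappa> w W" "periodic K W" "off_lattice N W" by (auto simp: S_def)
    have PW: "weight_bound \<kappa> (\<beta> * (1 + w)) (P * (1 + W))"
      by (intro weight_bound_mult weight_bound_add weight_bound_one P W \<kappa>)
    have "weight_bound \<kappa> (\<beta> * (1 + w) + w * (\<beta> * (1 + w))) (Z W)"
      unfolding Z_def
      by (intro weight_bound_diff weight_bound_off_lattice weight_bound_mult weight_bound_lattice_part PW W \<kappa>)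
    from weight_bound_hadamard[of \<phi>, OF \<phi> this]
    have "weight_bound \<kappa> (1 / g * (\<beta> * (1 + w) + w * (\<beta> * (1 + w)))) (\<Phi> W)"
      by (simp add: \<Phi>_def)
    moreover have "1 / g * (\<beta> * (1 + w) + w * (\<beta> * (1 + w))) \<le> w"
    proof -
      have "(1 + w) * (1 + w) \<le> (5/4) * (5/4)" using w by (intro mult_mono) auto
      then have "\<beta> * ((1 + w) * (1 + w)) \<le> \<beta> * 4" using \<beta>0 by (intro mult_left_mono) auto
      then have "1 / g * (\<beta> * ((1 + w) * (1 + w))) \<le> 1 / g * (\<beta> * 4)"
        by (rule mult_left_mono) (use g in simp)
      also have "\<dots> = w" by (simp add: w_def)
      finally show ?thesis by (simp add: algebra_simps)
    qed
    ultimately have "weight_bound \<kappa> w (\<Phi> W)" by (rule col_bound_mono)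
    moreover have "periodic K (Z W)"
      unfolding Z_def
      by (intro periodic_diff periodic_mult periodic_lattice_part periodic_add periodic_one W per)
    then have "periodic K (\<Phi> W)"
      unfolding periodic_def \<Phi>_def ent_hadamard[of \<phi>, OF \<phi>] by (simp add: \<phi>_per)
    moreover have "off_lattice N (\<Phi> W)"
      unfolding off_lattice_def \<Phi>_def ent_hadamard[of \<phi>, OF \<phi>] by (simp add: \<phi>_def)
    ultimately show "\<Phi> W \<in> S" by (simp add: S_def)
  qed
  moreover have "dist (\<Phi> V) (\<Phi> W) \<le> 1 / 2 * dist V W" if "V \<in> S" "W \<in> S" for V W
  proof -
    define \<delta> where "\<delta> = norm (V - W)"
    have \<delta>0: "0 \<le> \<delta>" by (simp add: \<delta>_def)
    have VW: "weight_bound 0 w V" "weight_bound 0 w W" "weight_bound 0 \<beta> P"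
      using that \<kappa> P by (auto simp: S_def intro: col_bound_anti_weight)
    have \<delta>: "weight_bound 0 \<delta> (V - W)" unfolding \<delta>_def by (rule col_bound_norm)
    let ?L = "lattice_part N"
    have lin: "?L (P * (1 + V)) - ?L (P * (1 + W)) = ?L (P * (V - W))"
    proof -
      have "P * (V - W) = P * (1 + V) - P * (1 + W)" by (simp add: algebra_simps)
      then show ?thesis by (intro kernel_eqI) simp
    qed
    have "Z V - Z W = (P * (1 + V) - P * (1 + W)) - (?L (P * (1 + V)) - ?L (P * (1 + W)))
        - ((V - W) * ?L (P * (1 + V)) + W * (?L (P * (1 + V)) - ?L (P * (1 + W))))"
      unfolding Z_def by (simp add: algebra_simps)
    also have "\<dots> = (P * (V - W) - ?L (P * (V - W)))
        - ((V - W) * ?L (P * (1 + V)) + W * ?L (P * (V - W)))"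
      unfolding lin by (simp add: algebra_simps)
    finally have Zeq: "Z V - Z W = \<dots>" .
    have "weight_bound 0 (\<beta> * \<delta> + (\<delta> * (\<beta> * (1 + w)) + w * (\<beta> * \<delta>))) (Z V - Z W)"
      unfolding Zeq
      by (intro weight_bound_diff weight_bound_off_lattice weight_bound_mult weight_bound_lattice_part
          weight_bound_add weight_bound_one VW \<delta>) auto
    from weight_bound_hadamard[of \<phi>, OF \<phi> this]
    have "norm (\<Phi> V - \<Phi> W) \<le> 1 / g * (\<beta> * \<delta> + (\<delta> * (\<beta> * (1 + w)) + w * (\<beta> * \<delta>)))"
      unfolding norm_kernel_le \<Phi>_def
      by (rule weight_bound_subentries) (simp add: ent_hadamard[of \<phi>, OF \<phi>] right_diff_distrib)
    also have "\<dots> = \<beta> * (2 + 2 * w) / g * \<delta>" by (simp add: field_simps)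
    also have "\<dots> \<le> 1 / 2 * \<delta>"
    proof -
      have "\<beta> * (2 + 2 * w) \<le> \<beta> * 4" using \<beta>0 w by (intro mult_left_mono) auto
      then have "\<beta> * (2 + 2 * w) / g \<le> 1 / 2" using g \<beta> \<beta>0 by (simp add: field_simps)
      then show ?thesis using \<delta>0 by (rule mult_right_mono)
    qed
    finally show ?thesis by (simp add: dist_norm \<delta>_def)
  qed
  ultimately obtain W where "W \<in> S" and fixpoint: "\<Phi> W = W"
    using Banach_fix[of S "1 / 2" \<Phi>] by auto
  then have W: "weight_bound \<kappa> w W" "periodic K W" "off_lattice N W" by (auto simp: S_def)
  define R where "R = lattice_part N (P * (1 + W))"
  have "on_lattice N R" by (simp add: R_def on_lattice_def)
  \<comment> \<open>Makes \<open>Z W\<close> vanish on the lattice, so that the fixed-point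
    equation, multiplied back by the divisors, holds for all entries.\<close>
  then have offWR: "off_lattice N (W * R)" using W(3) by (intro off_lattice_mult)
  have "D * W - W * D = W * R - (P * (1 + W) - R)"
  proof (rule kernel_eqI)
    fix m n
    have ZW: "Z W = (P * (1 + W) - R) - W * R" by (simp add: Z_def R_def)
    have Zoff: "ent (Z W) m n = 0" if "N dvd m - n"
      using offWR that unfolding off_lattice_def by (simp add: ZW) (simp add: R_def)
    have eq: "ent W m n = \<phi> m n * ent (Z W) m n"
      using arg_cong[OF fixpoint, of "\<lambda>A. ent A m n"] by (simp add: \<Phi>_def ent_hadamard[of \<phi>, OF \<phi>])
    have "(ent D m m - ent D n n) * ent W m n = - ent (Z W) m n"
    proof (cases "N dvd m - n")
      case True
      then show ?thesis using eq Zoff by (simp add: \<phi>_def)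
    next
      case False
      then have "ent D n n - ent D m m \<noteq> 0" using gap[of m n] g by auto
      then show ?thesis unfolding eq using False by (simp add: \<phi>_def field_simps)
    qed
    then show "ent (D * W - W * D) m n = ent (W * R - (P * (1 + W) - R)) m n"
      by (simp add: ent_diagonal_mult_left[OF D] ent_diagonal_mult_right[OF D] ZW algebra_simps)
  qed
  then have "(D + P) * (1 + W) = (1 + W) * (D + R)"
    by (simp add: algebra_simps)
  then show ?thesis using W by (auto simp: w_def R_def)
qed

text \<open>\<open>Y\<close> is the fixed point of Y = - W - W Y instead of a Neumann series, so
  that weight and period come with the closed ball. Its radius 2 w works because w + 2 w^2 \<le> 2 w
  for w \<le> 1/2.\<close>

lemma one_plus_right_inverse:
  assumes W: "weight_bound \<kappa> w W" and w: "w \<le> 1 / 2" and \<kappa>: "0 \<le> \<kappa>" and per: "periodic K W"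
  shows "\<exists>Y. (1 + W) * (1 + Y) = 1 \<and> weight_bound \<kappa> (2 * w) Y \<and> periodic K Y"
proof -
  define S where "S = {Y. weight_bound \<kappa> (2 * w) Y} \<inter> {Y. periodic K Y}"
  define \<Phi> where "\<Phi> Y = - W - W * Y" for Y
  have w0: "0 \<le> w" using col_bound_nonneg[OF W] .
  have "complete S"
    unfolding complete_eq_closed S_def by (intro closed_Int closed_weight_bound closed_periodic)
  moreover have "S \<noteq> {}"
  proof -
    have "0 \<in> S" using w0 col_bound_mono[OF weight_bound_zero] by (auto simp: S_def periodic_zero)
    then show ?thesis by blast
  qed
  moreover have "\<Phi> ` S \<subseteq> S"
  proof (rule image_subsetI)
    fix Y assume "Y \<in> S"
    then have Y: "weight_bound \<kappa> (2 * w) Y" "periodic K Y" by (auto simp: S_def)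
    have "weight_bound \<kappa> (w + w * (2 * w)) (\<Phi> Y)"
      unfolding \<Phi>_def by (intro weight_bound_diff weight_bound_uminus weight_bound_mult W Y \<kappa>)
    moreover have "w + w * (2 * w) \<le> 2 * w"
      using mult_left_mono[OF w w0] by simp
    ultimately have "weight_bound \<kappa> (2 * w) (\<Phi> Y)" by (rule col_bound_mono)
    then show "\<Phi> Y \<in> S"
      using Y per by (simp add: S_def \<Phi>_def periodic_diff periodic_uminus periodic_mult)
  qed
  moreover have "dist (\<Phi> X) (\<Phi> Y) \<le> 1 / 2 * dist X Y" for X Y
  proof -
    have "\<Phi> X - \<Phi> Y = - (W * (X - Y))" by (simp add: \<Phi>_def algebra_simps)
    then have "norm (\<Phi> X - \<Phi> Y) \<le> norm W * norm (X - Y)" by (metis norm_minus_cancel norm_mult_ineq)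
    also have "\<dots> \<le> 1 / 2 * norm (X - Y)"
      using weight_bound_imp_norm[OF W \<kappa>] w by (intro mult_right_mono) auto
    finally show ?thesis by (simp add: dist_norm)
  qed
  ultimately obtain Y where "Y \<in> S" and "\<Phi> Y = Y"
    using Banach_fix[of S "1 / 2" \<Phi>] by auto
  then have "(1 + W) * (1 + Y) = 1"
    by (simp add: \<Phi>_def algebra_simps) (metis add.right_inverse)
  with \<open>Y \<in> S\<close> show ?thesis by (auto simp: S_def)
qed

text \<open>The right inverse has a right inverse in turn, which must equal \<open>1 + W\<close>.
  With w \<le> 1/4 the bound 2 w of \<open>Y\<close> is still at most 1/2.\<close>

lemma one_plus_inverse:
  assumes W: "weight_bound \<kappa> w W" and w: "w \<le> 1 / 4" and \<kappa>: "0 \<le> \<kappa>" and per: "periodic K W"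
  shows "\<exists>Y. (1 + W) * (1 + Y) = 1 \<and> (1 + Y) * (1 + W) = 1 \<and> weight_bound \<kappa> (2 * w) Y \<and> periodic K Y"
proof -
  obtain Y where Y: "(1 + W) * (1 + Y) = 1" "weight_bound \<kappa> (2 * w) Y" "periodic K Y"
    using one_plus_right_inverse[OF W _ \<kappa> per] w by auto
  obtain X where X: "(1 + Y) * (1 + X) = 1"
    using one_plus_right_inverse[OF Y(2) _ \<kappa> Y(3)] w by auto
  have "1 + W = (1 + W) * ((1 + Y) * (1 + X))" by (simp add: X)
  also have "\<dots> = 1 + X" unfolding mult.assoc[symmetric] Y(1) by simp
  finally show ?thesis using X Y by auto
qed

text \<open>In the multiscale step, \<open>h\<close> is a multiple of the next digit of the site and \<open>F\<close> the increment of the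
  potential.\<close>
lemma diagonal_part_conjugate_surj:
  assumes Q: "norm (Q - 1) \<le> 1 / 8" "norm (Qi - 1) \<le> 1 / 8"
    and h: "diagonal h" and per: "periodic K Q" "periodic K Qi" "periodic K h"
  shows "\<exists>F. diagonal F \<and> periodic K F \<and> norm F \<le> 2 * norm h \<and> diagonal_part (Qi * F * Q) = h"
proof -
  define S where "S = {F. diagonal F} \<inter> {F. periodic K F}"
  \<comment> \<open>This is Qi F Q - F, arranged so that each summand has a factor of norm at most
    1/8; hence it contracts and \<open>F\<close> can be solved for among diagonal kernels.\<close>
  define Z where "Z F = (Qi - 1) * F * Q + F * (Q - 1)" for F
  define \<Phi> where "\<Phi> F = h - diagonal_part (Z F)" for F
  have Zeq: "Z F = Qi * F * Q - F" for F by (simp add: Z_def algebra_simps)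
  have dp: "norm (diagonal_part A) \<le> norm A" for A
    unfolding norm_kernel_le by (intro weight_bound_diagonal_part col_bound_norm)
  have nQ: "norm Q \<le> 9 / 8" using norm_triangle_ineq[of "Q - 1" 1] Q(1) by simp
  have ZF: "norm (Z F) \<le> 1 / 2 * norm F" for F
  proof -
    have "norm (Z F) \<le> norm (Qi - 1) * norm F * norm Q + norm F * norm (Q - 1)"
      unfolding Z_def by (intro norm_triangle_le add_mono order_trans[OF norm_mult_ineq] mult_right_mono norm_mult_ineq) auto
    also have "\<dots> \<le> (1 / 8) * norm F * (9 / 8) + norm F * (1 / 8)"
      using Q nQ by (intro add_mono mult_mono) auto
    also have "\<dots> \<le> 1 / 2 * norm F" by simp
    finally show ?thesis .
  qed
  have "complete S"
    unfolding complete_eq_closed S_def by (intro closed_Int closed_diagonal closed_periodic)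
  moreover have "S \<noteq> {}"
    using h per by (auto simp: S_def)
  moreover have "\<Phi> ` S \<subseteq> S"
  proof (rule image_subsetI)
    fix F assume "F \<in> S"
    then have F: "diagonal F" "periodic K F" by (auto simp: S_def)
    have "diagonal (\<Phi> F)" using h by (simp add: \<Phi>_def diagonal_def)
    moreover have "periodic K (\<Phi> F)"
      unfolding \<Phi>_def Zeq by (intro periodic_diff periodic_diagonal_part periodic_mult per F)
    ultimately show "\<Phi> F \<in> S" by (simp add: S_def)
  qed
  moreover have "dist (\<Phi> F) (\<Phi> G) \<le> 1 / 2 * dist F G" for F G
  proof -
    have "Z G - Z F = Z (G - F)" by (simp add: Z_def algebra_simps)
    then have "\<Phi> F - \<Phi> G = diagonal_part (Z (G - F))"
      by (intro kernel_eqI) (auto simp: \<Phi>_def dest: arg_cong[where f = "\<lambda>A. ent A _ _"])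
    then have "norm (\<Phi> F - \<Phi> G) \<le> norm (Z (G - F))" using dp by simp
    also have "\<dots> \<le> 1 / 2 * norm (G - F)" by (rule ZF)
    finally show ?thesis by (simp add: dist_norm norm_minus_commute)
  qed
  ultimately obtain F where F: "F \<in> S" "\<Phi> F = F"
    using Banach_fix[of S "1 / 2" \<Phi>] by auto
  have "norm F \<le> norm h + norm (diagonal_part (Z F))"
    by (subst F(2)[symmetric]) (simp add: \<Phi>_def norm_triangle_ineq4)
  also have "\<dots> \<le> norm h + 1 / 2 * norm F" using dp[of "Z F"] ZF[of F] by simp
  finally have "norm F \<le> 2 * norm h" by simp
  moreover have "diagonal_part (Qi * F * Q) = h"
  proof (rule kernel_eqI)
    fix m n
    have "ent F m n = ent h m n - ent (diagonal_part (Qi * F * Q - F)) m n"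
      using arg_cong[OF F(2), of "\<lambda>A. ent A m n"] by (simp add: \<Phi>_def Zeq)
    moreover have "ent F m n = 0" if "m \<noteq> n" using F(1) that by (simp add: S_def diagonal_def)
    ultimately show "ent (diagonal_part (Qi * F * Q)) m n = ent h m n"
      by (auto split: if_splits)
  qed
  ultimately show ?thesis using F(1) by (auto simp: S_def)
qed


section \<open>One step of the multiscale construction\<close>

text \<open>Stage of the multiscale diagonalisation of \<open>V + L\<close> at period \<open>M\<close>: conjugation by \<open>Q\<close> (with inverse
  \<open>Qi\<close>) leaves a diagonal \<open>D\<close>, whose entries at sites inequivalent modulo \<open>M\<close> are \<open>g\<close>-separated, and
  a remainder \<open>R\<close> that only couples distinct equivalent sites.\<close>
definition stage ::
    "kernel \<Rightarrow> real \<Rightarrow> real \<Rightarrow> int \<Rightarrow> real \<Rightarrow> kernel \<Rightarrow> kernel \<Rightarrow> kernel \<Rightarrow> kernel \<Rightarrow> kernel \<Rightarrow> bool" where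
  "stage L \<kappa> b M g V Q Qi D R \<longleftrightarrow>
     diagonal V \<and> diagonal D \<and> on_lattice M R \<and> (\<forall>n. ent R n n = 0) \<and>
     periodic M V \<and> periodic M Q \<and> periodic M Qi \<and> periodic M D \<and> periodic M R \<and>
     Q * Qi = 1 \<and> Qi * Q = 1 \<and>
     weight_bound \<kappa> b (Q - 1) \<and> weight_bound \<kappa> b (Qi - 1) \<and> weight_bound \<kappa> 1 R \<and>
     (\<forall>m n. \<not> M dvd m - n \<longrightarrow> g \<le> \<bar>ent D m m - ent D n n\<bar>) \<and>
     (V + L) * Q = Q * (D + R)"

lemma ex_diagonal_kernel:
  assumes "\<And>n. \<bar>f n\<bar> \<le> c"
  shows "\<exists>h. diagonal h \<and> (\<forall>n. ent h n n = f n)"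
proof (intro exI conjI allI)
  have e: "ent (hadamard (\<lambda>m n. f n) 1) m n = f n * ent 1 m n" for m n
    by (rule ent_hadamard) (rule assms)
  show "diagonal (hadamard (\<lambda>m n. f n) 1)" by (simp add: diagonal_def e)
  show "ent (hadamard (\<lambda>m n. f n) 1) n n = f n" for n by (simp add: e)
qed

lemma digit_neq:
  fixes M p m n :: int
  assumes "M dvd m - n" "\<not> M * p dvd m - n" "0 < M"
  shows "(m mod (M * p)) div M \<noteq> (n mod (M * p)) div M"
proof
  assume eq: "(m mod (M * p)) div M = (n mod (M * p)) div M"
  have "(m mod (M * p)) mod M = (n mod (M * p)) mod M"
    using assms(1) by (simp add: mod_mod_cancel mod_eq_dvd_iff)
  with eq have "m mod (M * p) = n mod (M * p)" by (metis div_mult_mod_eq)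
  then show False using assms(2) by (simp add: mod_eq_dvd_iff)
qed

text \<open>The entries are \<open>c\<close> times the digit (n mod M p) div M. Distinct digits
  differ by at least 1, and their spread over [0, p) is why the norm grows with
  \<open>p\<close>.\<close>

lemma ex_digit_kernel:
  fixes M p :: int
  assumes "0 < M" "0 < p" "0 \<le> c"
  shows "\<exists>h. diagonal h \<and> periodic (M * p) h \<and> norm h \<le> c * of_int p \<and>
    (\<forall>m n. M dvd m - n \<and> \<not> M * p dvd m - n \<longrightarrow> c \<le> \<bar>ent h m m - ent h n n\<bar>)"
proof -
  define a where "a n = (n mod (M * p)) div M" for n
  have a: "0 \<le> a n" "a n < p" for n
  proof -
    show "0 \<le> a n" using assms by (simp add: a_def pos_imp_zdiv_nonneg_iff)
    have "M * a n \<le> n mod (M * p)"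
      using assms mult_div_mod_eq[of M "n mod (M * p)"] pos_mod_sign[of M "n mod (M * p)"]
      unfolding a_def by linarith
    also have "\<dots> < M * p" using assms by simp
    finally show "a n < p" using assms by simp
  qed
  have ab: "\<bar>c * of_int (a n)\<bar> \<le> c * of_int p" for n
    using a[of n] assms(3) by (auto simp: abs_mult intro!: mult_left_mono)
  then obtain h where h: "diagonal h" "\<And>n. ent h n n = c * of_int (a n)"
    using ex_diagonal_kernel[of "\<lambda>n. c * of_int (a n)"] by blast
  have "ent h (m + M * p) (n + M * p) = ent h m n" for m n
  proof (cases "m = n")
    case True
    then show ?thesis by (simp add: h(2) a_def)
  next
    case False
    then show ?thesis using h(1) by (simp add: diagonal_def)
  qed
  then have "periodic (M * p) h" by (simp add: periodic_def)
  moreover have "norm h \<le> c * of_int p"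
    unfolding norm_kernel_le by (intro weight_bound_diagonal h(1)) (simp add: h(2) ab)
  moreover have "c \<le> \<bar>ent h m m - ent h n n\<bar>" if "M dvd m - n" "\<not> M * p dvd m - n" for m n
  proof -
    have "a m \<noteq> a n" unfolding a_def by (rule digit_neq[OF that assms(1)])
    then have "1 \<le> \<bar>of_int (a m - a n) :: real\<bar>" by linarith
    from mult_left_mono[OF this assms(3)] show ?thesis
      using assms(3) by (simp add: h(2) abs_mult right_diff_distrib[symmetric])
  qed
  ultimately show ?thesis using h(1) by blast
qed

text \<open>Adding \<open>h\<close> itself to the potential would not do: conjugation could change
  its diagonal by a fraction of its norm, of order p g', and swamp a spacing of order g'. So
  \<open>F\<close> is chosen with the diagonal of Qi F Q exactly \<open>h\<close>. Then
  \<open>R\<close> and Qi F Q - h both have zero diagonal, and their lattice parts gain an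
  exponential factor.\<close>

lemma stage_step:
  assumes st: "stage L \<kappa> b M g V Q Qi D R" and b: "b \<le> 1 / 8" and M: "0 < M" and p: "0 < p"
    and L: "periodic 1 L" and \<delta>: "0 \<le> \<delta>" "\<delta> \<le> \<kappa>" and g: "0 < g" "g \<le> 1"
    and \<eta>: "0 < \<eta>" "\<eta> \<le> 1 / 10000"
    and g': "0 < g'" "of_int p ^ 2 * g' \<le> \<eta> * g" and e: "exp (- \<delta> * of_int M) \<le> \<eta> * g'"
  shows "\<exists>V' Q' Qi' D' R'. stage L (\<kappa> - \<delta>) (b + 10000 * \<eta>) (M * p) g' V' Q' Qi' D' R' \<and>
    norm (V' - V) \<le> 10000 * \<eta> \<and> norm (Q' - Q) \<le> 10000 * \<eta> \<and> norm (Qi' - Qi) \<le> 10000 * \<eta> \<and>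
    norm (D' - D) \<le> 10000 * \<eta> \<and> norm R' \<le> 10000 * \<eta>"
proof -
  define \<kappa>' where "\<kappa>' = \<kappa> - \<delta>"
  have \<kappa>: "0 \<le> \<kappa>" "0 \<le> \<kappa>'" "\<kappa>' \<le> \<kappa>" using \<delta> by (auto simp: \<kappa>'_def)
  have V: "diagonal V" and D: "diagonal D" and Ron: "on_lattice M R" and R0: "\<And>n. ent R n n = 0"
    and perM: "periodic M V" "periodic M Q" "periodic M Qi" "periodic M D" "periodic M R"
    and QQi: "Q * Qi = 1" and QiQ: "Qi * Q = 1"
    and wQ: "weight_bound \<kappa> b (Q - 1)" and wQi: "weight_bound \<kappa> b (Qi - 1)"
    and wR: "weight_bound \<kappa> 1 R"
    and gap: "\<And>m n. \<not> M dvd m - n \<Longrightarrow> g \<le> \<bar>ent D m m - ent D n n\<bar>"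
    and eq: "(V + L) * Q = Q * (D + R)"
    using st unfolding stage_def by auto
  have b0: "0 \<le> b" using col_bound_nonneg[OF wQ] .
  define M' where "M' = M * p"
  have dvd: "M dvd M'" by (simp add: M'_def)
  note per = perM[THEN periodic_dvd, OF dvd]
  have wQ98: "weight_bound \<kappa> (9 / 8) Q" "weight_bound \<kappa> (9 / 8) Qi"
    using weight_bound_add[OF wQ weight_bound_one] weight_bound_add[OF wQi weight_bound_one] b
    by (auto elim: col_bound_mono)
  \<comment> \<open>Size of the digit kernel up to the factor 4. First-order quantities below are
    multiples of \<open>x\<close>, second-order ones of x * x / g.\<close>
  define x where "x = of_int p * g'"
  have p1: "1 \<le> (of_int p :: real)" using p by simp
  have g'x: "g' \<le> x" using mult_right_mono[OF p1, of g'] g' by (simp add: x_def)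
  have x0: "0 < x" using g' p by (simp add: x_def)
  have px: "of_int p * x \<le> \<eta> * g" using g'(2) by (simp add: x_def power2_eq_square mult_ac)
  have x\<eta>: "x \<le> \<eta> * g" using mult_right_mono[OF p1, of x] x0 px by linarith
  have \<eta>g: "\<eta> * g \<le> \<eta>" using \<eta> g mult_left_mono[of g 1 \<eta>] by simp
  have g'1: "g' \<le> 1" using g'x x\<eta> \<eta>g \<eta> by linarith
  have \<eta>g': "\<eta> * g' \<le> \<eta>" "\<eta> * g' \<le> g' / 10000"
    using g'1 g' \<eta> mult_left_mono[of g' 1 \<eta>] mult_right_mono[OF \<eta>(2), of g'] by simp_all
  have \<eta>g1000: "\<eta> * g \<le> g / 10000" using mult_right_mono[OF \<eta>(2), of g] g by simp
  have xs: "x \<le> \<eta>" "x \<le> g / 10000" "x \<le> 1" using x\<eta> \<eta>g \<eta>g1000 \<eta> by linarith+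
  \<comment> \<open>The origin of \<open>of_int p ^ 2\<close> in the hypothesis: the second-order
    error must be small against the new gap.\<close>
  have xx: "x * x / g \<le> \<eta> * g'"
  proof -
    have "x * x = (of_int p * x) * g'" by (simp add: x_def)
    also have "\<dots> \<le> (\<eta> * g) * g'" using px g'(1) by (intro mult_right_mono) auto
    finally show ?thesis using g by (simp add: field_simps)
  qed

  \<comment> \<open>The factor 4 leaves room twice: the second elimination needs 16 y \<le> 4 g',
    and the diagonal corrections at two sites must afterwards leave a gap g'.\<close>
  obtain h where h: "diagonal h" "periodic M' h" "norm h \<le> 4 * g' * of_int p"
    and hgap: "\<And>m n. M dvd m - n \<Longrightarrow> \<not> M' dvd m - n \<Longrightarrow> 4 * g' \<le> \<bar>ent h m m - ent h n n\<bar>"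
    using ex_digit_kernel[OF M p, of "4 * g'"] g' unfolding M'_def by auto
  have hx: "norm h \<le> 4 * x" using h(3) by (simp add: x_def mult_ac)
  obtain F where F: "diagonal F" "periodic M' F" "norm F \<le> 2 * norm h" "diagonal_part (Qi * F * Q) = h"
    using diagonal_part_conjugate_surj[OF _ _ h(1) per(2,3) h(2)]
      weight_bound_imp_norm[OF wQ \<kappa>(1)] weight_bound_imp_norm[OF wQi \<kappa>(1)] b by auto
  have Fx: "norm F \<le> 8 * x" using F(3) hx by simp
  define P0 where "P0 = Qi * F * Q - h"
  have P0_diag: "ent P0 n n = 0" for n
    using arg_cong[OF F(4), of "\<lambda>A. ent A n n"] by (simp add: P0_def)
  have wP0: "weight_bound \<kappa> (15 * x) P0"
  proof (rule col_bound_mono)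
    show "weight_bound \<kappa> (9 / 8 * (8 * x) * (9 / 8) + 4 * x) P0"
      unfolding P0_def
      by (intro weight_bound_diff weight_bound_mult wQ98 \<kappa>
          col_bound_mono[OF weight_bound_diagonal_norm[OF F(1)] Fx]
          col_bound_mono[OF weight_bound_diagonal_norm[OF h(1)] hx])
    show "9 / 8 * (8 * x) * (9 / 8) + 4 * x \<le> 15 * x" using x0 by simp
  qed
  define P where "P = R + P0"
  have wR': "weight_bound \<kappa>' (\<eta> * g') R"
    using weight_bound_on_lattice[OF Ron R0 M wR \<delta>(1)] e unfolding \<kappa>'_def by (auto elim: col_bound_mono)
  have wP: "weight_bound \<kappa>' (16 * x) P"
  proof (rule col_bound_mono)
    show "weight_bound \<kappa>' (\<eta> * g' + 15 * x) P"
      unfolding P_def by (intro weight_bound_add wR' col_bound_anti_weight[OF wP0] \<kappa>)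
    show "\<eta> * g' + 15 * x \<le> 16 * x" using \<eta>g' g' g'x by linarith
  qed
  have perP0: "periodic M' P0" unfolding P0_def by (intro periodic_diff periodic_mult per F h)
  have perP: "periodic M' P" unfolding P_def by (intro periodic_add per perP0)
  have Dh: "diagonal (D + h)" "periodic M' (D + h)" using D h per by (auto intro: diagonal_add periodic_add)
  have gapA: "g / 2 \<le> \<bar>ent (D + h) m m - ent (D + h) n n\<bar>" if "\<not> M dvd m - n" for m n
    using gap[OF that] ent_abs_le_norm[of h m m] ent_abs_le_norm[of h n n] hx xs g
    unfolding plus_kernel.rep_eq by linarith
  \<comment> \<open>\<open>h\<close> is too small to spoil the separation of sites inequivalent
    modulo \<open>M\<close>, so the whole of \<open>P\<close> can be removed off this lattice with
    divisors g / 2.\<close>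
  obtain WA where WA: "weight_bound \<kappa>' (4 * (16 * x) / (g / 2)) WA" "periodic M' WA"
    and eqA: "(D + h + P) * (1 + WA) = (1 + WA) * (D + h + lattice_part M (P * (1 + WA)))"
    using eliminate_off_lattice[OF Dh(1) gapA _ \<kappa>(2) wP _ Dh(2) perP] g xs by auto
  define RA where "RA = lattice_part M (P * (1 + WA))"
  define y where "y = 2064 * (\<eta> * g')"
  have perRA: "periodic M' RA" unfolding RA_def
    by (intro periodic_lattice_part periodic_mult periodic_add periodic_one perP WA)
  have wRA: "weight_bound \<kappa>' y RA"
  proof (rule col_bound_mono)
    \<comment> \<open>\<open>R\<close> and the lattice part of \<open>P0\<close> have zero diagonal
      and gain exp (- \<delta> M); only the term with P WA is not exponentially small, and it is of
      size x * x / g. The sum of the three bounds gives 2064 = 1 + 15 + 2048.\<close>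
    have "RA = R + (lattice_part M P0 + lattice_part M (P * WA))"
      using Ron by (intro kernel_eqI) (auto simp: RA_def P_def on_lattice_def ring_distribs)
    moreover have lat: "weight_bound \<kappa>' (\<eta> * g' * (15 * x)) (lattice_part M P0)"
    proof (rule col_bound_mono)
      have "weight_bound (\<kappa> - \<delta>) (exp (- \<delta> * of_int M) * (15 * x)) (lattice_part M P0)"
        by (rule weight_bound_on_lattice)
           (auto simp: on_lattice_def P0_diag M \<delta> intro!: weight_bound_subentries[OF wP0])
      then show "weight_bound \<kappa>' (exp (- \<delta> * of_int M) * (15 * x)) (lattice_part M P0)" by (simp add: \<kappa>'_def)
      show "exp (- \<delta> * of_int M) * (15 * x) \<le> \<eta> * g' * (15 * x)" using e x0 by (intro mult_right_mono) auto
    qed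
    ultimately show "weight_bound \<kappa>' (\<eta> * g' + (\<eta> * g' * (15 * x) + 16 * x * (4 * (16 * x) / (g / 2)))) RA"
      by (simp only:) (intro weight_bound_add wR' lat weight_bound_lattice_part[of _ _ "P * WA"]
          weight_bound_mult wP WA \<kappa>)
    have "\<eta> * g' * (15 * x) \<le> \<eta> * g' * 15"
      using xs \<eta> g' by (intro mult_left_mono) auto
    moreover have "16 * x * (4 * (16 * x) / (g / 2)) = 2048 * (x * x / g)" by simp
    ultimately show "\<eta> * g' + (\<eta> * g' * (15 * x) + 16 * x * (4 * (16 * x) / (g / 2))) \<le> y"
      using xx unfolding y_def by linarith
  qed
  have y: "0 \<le> y" "y \<le> 2064 * g' / 10000" "y \<le> 2064 * \<eta>"
    using \<eta>g' \<eta> g' by (auto simp: y_def)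
  have gapB: "4 * g' \<le> \<bar>ent (D + h) m m - ent (D + h) n n\<bar>" if "\<not> M' dvd m - n" for m n
  proof (cases "M dvd m - n")
    case True
    \<comment> \<open>\<open>D\<close> has period \<open>M\<close> and agrees at equivalent sites,
      so the whole separation comes from \<open>h\<close>.\<close>
    then obtain j where "m = n + M * j" by (metis add_diff_cancel_left' diff_add_cancel dvdE add.commute)
    then have "ent D m m = ent D n n"
      using periodic_dvd[OF perM(4), of "M * j"] unfolding periodic_def by auto
    then show ?thesis using hgap[OF True that] by simp
  next
    case False
    then show ?thesis using gapA[OF False] g'x xs g by linarith
  qed
  \<comment> \<open>The remaining off-diagonal entries are now small against the new gap, so sites
    equivalent modulo \<open>M\<close> but not modulo \<open>M'\<close> can be decoupled.\<close>
  obtain WB where WB: "weight_bound \<kappa>' (4 * y / (4 * g')) WB" "periodic M' WB"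
    and eqB: "(D + h + RA) * (1 + WB) = (1 + WB) * (D + h + lattice_part M' (RA * (1 + WB)))"
    using eliminate_off_lattice[OF Dh(1) gapB _ \<kappa>(2) wRA _ Dh(2) perRA] g' y by auto
  define RB where "RB = lattice_part M' (RA * (1 + WB))"
  have WA': "weight_bound \<kappa>' (128 * \<eta>) WA"
    using x\<eta> g by (intro col_bound_mono[OF WA(1)]) (simp add: field_simps)
  have WB': "weight_bound \<kappa>' (2064 * \<eta>) WB"
    using g' by (intro col_bound_mono[OF WB(1)]) (simp add: y_def)
  obtain YA where YA: "(1 + WA) * (1 + YA) = 1" "(1 + YA) * (1 + WA) = 1"
      "weight_bound \<kappa>' (2 * (128 * \<eta>)) YA" "periodic M' YA"
    using one_plus_inverse[OF WA' _ \<kappa>(2) WA(2)] \<eta> by auto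
  obtain YB where YB: "(1 + WB) * (1 + YB) = 1" "(1 + YB) * (1 + WB) = 1"
      "weight_bound \<kappa>' (2 * (2064 * \<eta>)) YB" "periodic M' YB"
    using one_plus_inverse[OF WB' _ \<kappa>(2) WB(2)] \<eta> by auto
  have perRB: "periodic M' RB" unfolding RB_def
    by (intro periodic_lattice_part periodic_mult periodic_add periodic_one perRA WB)
  have wRB: "weight_bound \<kappa>' (2 * y) RB"
  proof (rule col_bound_mono)
    show "weight_bound \<kappa>' (y * (1 + 2064 * \<eta>)) RB"
      unfolding RB_def
      by (intro weight_bound_lattice_part weight_bound_mult weight_bound_add weight_bound_one wRA WB' \<kappa>)
    show "y * (1 + 2064 * \<eta>) \<le> 2 * y" using y \<eta> mult_left_mono[of "1 + 2064 * \<eta>" 2 y] by simp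
  qed

  define V' where "V' = V + F"
  define Q' where "Q' = Q * ((1 + WA) * (1 + WB))"
  define Qi' where "Qi' = (1 + YB) * (1 + YA) * Qi"
  \<comment> \<open>The diagonal of \<open>RB\<close> is absorbed here. Its size is at most 2 y, so
    differences move by at most 4 y < g'.\<close>
  define D' where "D' = D + h + diagonal_part RB"
  define R' where "R' = RB - diagonal_part RB"
  have "L * Q = Q * (D + R) - V * Q" using eq by (simp add: algebra_simps)
  moreover have "Q * (Qi * F * Q) = F * Q" by (simp add: mult.assoc[symmetric] QQi)
  ultimately have "(V' + L) * Q = Q * (D + h + P)"
    by (simp add: V'_def P_def P0_def ring_distribs)
  then have "(V' + L) * Q' = Q * ((D + h + P) * (1 + WA)) * (1 + WB)"
    by (simp add: Q'_def mult.assoc[symmetric])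
  also have "\<dots> = Q * (1 + WA) * ((D + h + RA) * (1 + WB))"
    unfolding eqA RA_def by (simp add: mult.assoc)
  also have "\<dots> = Q' * (D + h + RB)"
    unfolding eqB RB_def Q'_def by (simp add: mult.assoc)
  also have "\<dots> = Q' * (D' + R')" by (simp add: D'_def R'_def)
  finally have eq': "(V' + L) * Q' = Q' * (D' + R')" .

  have inv1: "Q' * Qi' = 1"
  proof -
    have "Q' * Qi' = Q * ((1 + WA) * ((1 + WB) * (1 + YB)) * (1 + YA)) * Qi"
      by (simp add: Q'_def Qi'_def mult.assoc)
    then show ?thesis by (simp add: YA YB QQi)
  qed
  have inv2: "Qi' * Q' = 1"
  proof -
    have "Qi' * Q' = (1 + YB) * ((1 + YA) * ((Qi * Q) * (1 + WA))) * (1 + WB)"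
      by (simp add: Q'_def Qi'_def mult.assoc)
    then show ?thesis by (simp add: YA YB QiQ)
  qed
  have wQ'Q: "weight_bound \<kappa>' (10000 * \<eta>) (Q' - Q)"
  proof (rule col_bound_mono)
    have "Q' - Q = Q * (WA + WB + WA * WB)" by (simp add: Q'_def algebra_simps)
    then show "weight_bound \<kappa>' (9 / 8 * (128 * \<eta> + 2064 * \<eta> + 128 * \<eta> * (2064 * \<eta>))) (Q' - Q)"
      by (simp only:) (intro weight_bound_mult weight_bound_add WA' WB' \<kappa> col_bound_anti_weight[OF wQ98(1)])
    have "128 * \<eta> * (2064 * \<eta>) \<le> 1 * (2064 * \<eta>)" using \<eta> by (intro mult_right_mono) auto
    then show "9 / 8 * (128 * \<eta> + 2064 * \<eta> + 128 * \<eta> * (2064 * \<eta>)) \<le> 10000 * \<eta>" using \<eta> by simp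
  qed
  have wQi'Qi: "weight_bound \<kappa>' (10000 * \<eta>) (Qi' - Qi)"
  proof (rule col_bound_mono)
    have "Qi' - Qi = (YB + YA + YB * YA) * Qi" by (simp add: Qi'_def algebra_simps)
    then show "weight_bound \<kappa>' ((2 * (2064 * \<eta>) + 2 * (128 * \<eta>) + 2 * (2064 * \<eta>) * (2 * (128 * \<eta>))) * (9 / 8)) (Qi' - Qi)"
      by (simp only:) (intro weight_bound_mult weight_bound_add YA YB \<kappa> col_bound_anti_weight[OF wQ98(2)])
    have "2 * (2064 * \<eta>) * (2 * (128 * \<eta>)) \<le> 2 * (2064 * \<eta>) * 1" using \<eta> by (intro mult_left_mono) auto
    then show "(2 * (2064 * \<eta>) + 2 * (128 * \<eta>) + 2 * (2064 * \<eta>) * (2 * (128 * \<eta>))) * (9 / 8) \<le> 10000 * \<eta>"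
      using \<eta> by simp
  qed
  have wdRB: "norm (diagonal_part RB) \<le> 2 * y"
    using weight_bound_diagonal_part[OF wRB] \<kappa>(2) by (rule weight_bound_imp_norm)
  have gap': "g' \<le> \<bar>ent D' m m - ent D' n n\<bar>" if "\<not> M' dvd m - n" for m n
    using gapB[OF that] ent_abs_le_norm[of "diagonal_part RB" m m] ent_abs_le_norm[of "diagonal_part RB" n n]
      wdRB y unfolding D'_def by (simp del: ent_diagonal_part)
  have wR2: "weight_bound \<kappa>' (2 * y) R'"
    unfolding R'_def by (rule weight_bound_off_diagonal[OF wRB])
  have "stage L \<kappa>' (b + 10000 * \<eta>) M' g' V' Q' Qi' D' R'"
    unfolding stage_def
  proof (intro conjI allI impI)
    show "diagonal V'" using V F by (simp add: V'_def diagonal_add)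
    show "diagonal D'" unfolding D'_def by (intro diagonal_add D h diagonal_diagonal_part)
    show "on_lattice M' R'" by (auto simp: R'_def RB_def on_lattice_def)
    show "periodic M' V'" "periodic M' D'" "periodic M' R'"
      unfolding V'_def D'_def R'_def
      by (intro periodic_add periodic_diff periodic_diagonal_part per F h perRB)+
    show "periodic M' Q'" "periodic M' Qi'"
      unfolding Q'_def Qi'_def
      by (intro periodic_mult periodic_add periodic_one per WA WB YA YB)+
    have "weight_bound \<kappa>' (b + 10000 * \<eta>) ((Q - 1) + (Q' - Q))"
      by (intro weight_bound_add wQ'Q col_bound_anti_weight[OF wQ] \<kappa>)
    then show "weight_bound \<kappa>' (b + 10000 * \<eta>) (Q' - 1)" by simp
    have "weight_bound \<kappa>' (b + 10000 * \<eta>) ((Qi - 1) + (Qi' - Qi))"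
      by (intro weight_bound_add wQi'Qi col_bound_anti_weight[OF wQi] \<kappa>)
    then show "weight_bound \<kappa>' (b + 10000 * \<eta>) (Qi' - 1)" by simp
    show "weight_bound \<kappa>' 1 R'" using wR2 by (rule col_bound_mono) (use y \<eta> in simp)
  qed (use gap' eq' inv1 inv2 in \<open>auto simp: R'_def\<close>)
  moreover have "norm (V' - V) \<le> 10000 * \<eta>"
    using Fx xs \<eta> by (simp add: V'_def)
  moreover have "norm (D' - D) \<le> 10000 * \<eta>"
    using norm_triangle_ineq[of h "diagonal_part RB"] hx wdRB y xs \<eta> by (simp add: D'_def)
  moreover have "norm R' \<le> 10000 * \<eta>"
    using weight_bound_imp_norm[OF wR2 \<kappa>(2)] y \<eta> by simp
  ultimately show ?thesis
    using weight_bound_imp_norm[OF wQ'Q \<kappa>(2)] weight_bound_imp_norm[OF wQi'Qi \<kappa>(2)]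
    unfolding \<kappa>'_def M'_def by blast
qed


section \<open>Iterating the step\<close>

text \<open>Equality in the gap constraint defines g, then equality in the exponential constraint
  defines \<delta>. The content is that \<delta> is summable, so that \<kappa> can start high enough
  to stay above 1.\<close>

lemma ex_scale_parameters:
  fixes M p :: "nat \<Rightarrow> int" and C :: real and d :: nat
  assumes M0: "M 0 = 1" and MS: "\<And>j. M (Suc j) = M j * p j" and p: "\<And>j. 2 \<le> p j"
    and poly: "\<And>j. of_int (M (Suc j)) \<le> C * of_int (M j) ^ d"
  shows "\<exists>(\<eta> :: nat \<Rightarrow> real) (g :: nat \<Rightarrow> real) (\<kappa> :: nat \<Rightarrow> real) (\<delta> :: nat \<Rightarrow> real).
    g 0 = 1 \<and> (\<forall>j. \<eta> j = (1 / 2) ^ j / 1000000 \<and> 0 < g j \<and> g j \<le> 1 \<and> of_int (p j) ^ 2 * g (Suc j) \<le> \<eta> j * g j \<and>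
      0 \<le> \<delta> j \<and> \<delta> j \<le> \<kappa> j \<and> \<kappa> (Suc j) = \<kappa> j - \<delta> j \<and> 1 \<le> \<kappa> j \<and>
      exp (- \<delta> j * of_int (M j)) \<le> \<eta> j * g (Suc j))"
proof -
  \<comment> \<open>The denominator makes 10000 times the sum of all \<eta> equal to 1/50, so the
    conjugations stay within 1/8 of the identity, and keeps each \<eta> below the 1/10000 that a
    step needs.\<close>
  define \<eta> :: "nat \<Rightarrow> real" where "\<eta> j = (1 / 2) ^ j / 1000000" for j
  define g where "g = rec_nat (1::real) (\<lambda>j x. \<eta> j * x / of_int (p j) ^ 2)"
  have g0: "g 0 = 1" and gS: "g (Suc j) = \<eta> j * g j / of_int (p j) ^ 2" for j by (simp_all add: g_def)
  have p0: "0 < (of_int (p j) :: real)" and p1: "1 \<le> (of_int (p j) :: real)" for j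
    using p[of j] by linarith+
  have \<eta>: "0 < \<eta> j" "\<eta> j \<le> 1" for j
    using power_le_one[of "1 / 2 :: real" j] by (auto simp: \<eta>_def)
  have M: "2 ^ j \<le> M j" for j
  proof (induction j)
    case (Suc j)
    have "2 ^ j * 2 \<le> M j * p j" using Suc p[of j] by (intro mult_mono) (auto intro: order_trans[of 0 "2 ^ j"])
    then show ?case by (simp add: MS mult.commute)
  qed (simp add: M0)
  have M1: "0 < M j" for j using M[of j] by (meson less_le_trans zero_less_numeral zero_less_power)
  have Mr: "1 \<le> (of_int (M j) :: real)" "(2 :: real) ^ j \<le> of_int (M j)" for j
    using M1[of j] M[of j] by (simp, metis of_int_le_iff of_int_numeral of_int_power)
  have g: "0 < g j" for j by (induction j) (auto simp: g0 gS intro!: divide_pos_pos mult_pos_pos \<eta> zero_less_power p0)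
  have gSle: "g (Suc j) \<le> g j" for j
  proof -
    have "\<eta> j * g j \<le> 1 * g j" using \<eta> g by (intro mult_right_mono) (auto intro: less_imp_le)
    also have "\<dots> \<le> g j * of_int (p j) ^ 2" using g[of j] p1[of j] by (simp add: one_le_power)
    finally show ?thesis using p0[of j] by (simp add: gS field_simps)
  qed
  have g1: "g j \<le> 1" for j by (induction j) (auto simp: g0 intro: order_trans[OF gSle])
  define c :: real where "c = ln 1000000"
  have c0: "0 \<le> c" by (simp add: c_def)
  have ln\<eta>: "- ln (\<eta> j) \<le> c + j" for j
  proof -
    have "ln (\<eta> j) = j * ln (1 / 2) - c" by (simp add: \<eta>_def c_def ln_div ln_realpow)
    moreover have "- 1 \<le> ln (1 / 2 :: real)" using ln_2_less_1 by (simp add: ln_div)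
    then have "real j * (- 1) \<le> real j * ln (1 / 2)" by (intro mult_left_mono) auto
    ultimately show ?thesis by simp
  qed
  \<comment> \<open>Each step multiplies g by \<eta> / p^2, and the product of the p is
    \<open>M\<close>: up to exp (- O(j^2)) the gap is M^-2.\<close>
  have lng: "- ln (g j) \<le> j * (c + j) + 2 * ln (of_int (M j))" for j
  proof (induction j)
    case (Suc j)
    have "ln (g (Suc j)) = ln (\<eta> j) + ln (g j) - 2 * ln (of_int (p j))"
      using \<eta>[of j] g[of j] p0[of j] by (simp add: gS ln_mult ln_div ln_realpow)
    moreover have "ln (of_int (M (Suc j)) :: real) = ln (of_int (M j)) + ln (of_int (p j))"
      using p0[of j] Mr(1)[of j] by (simp add: MS ln_mult)
    moreover have "c + real j + real j * (c + real j) \<le> real (Suc j) * (c + real (Suc j))"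
      by (simp add: algebra_simps)
    ultimately show ?case using Suc ln\<eta>[of j] by linarith
  qed (simp add: g0 M0)
  define \<theta> where "\<theta> j = - ln (\<eta> j * g (Suc j))" for j
  define \<delta> where "\<delta> j = \<theta> j / of_int (M j)" for j
  have \<theta>0: "0 \<le> \<theta> j" for j
    using \<eta>[of j] g[of "Suc j"] g1[of "Suc j"] by (simp add: \<theta>_def mult_le_one)
  have \<delta>0: "0 \<le> \<delta> j" for j using \<theta>0[of j] M1[of j] by (simp add: \<delta>_def)
  have C1: "1 \<le> C" using poly[of 0] Mr(1)[of 1] by (simp add: M0)
  \<comment> \<open>Majorant of \<delta>: the growth bound reduces ln of the next period to
    \<open>d\<close> times ln of the present one, ln M \<le> 2 sqrt M leaves 1 / sqrt M after
    division by M, and M \<ge> 2^j makes everything summable.\<close>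
  define u where "u j = (c + real j + real (Suc j) * (c + real (Suc j)) + 2 * ln C) / 2 ^ j + 4 * real d / sqrt 2 ^ j" for j
  have \<delta>u: "\<delta> j \<le> u j" for j
  proof -
    let ?M = "of_int (M j) :: real"
    have "\<theta> j = - ln (\<eta> j) - ln (g (Suc j))"
      using \<eta>[of j] g[of "Suc j"] by (simp add: \<theta>_def ln_mult)
    moreover have "ln (of_int (M (Suc j)) :: real) \<le> ln C + d * ln ?M"
    proof -
      have "ln (of_int (M (Suc j)) :: real) \<le> ln (C * ?M ^ d)"
        using poly[of j] Mr(1)[of "Suc j"] by (intro ln_mono) auto
      also have "\<dots> = ln C + d * ln ?M" using C1 Mr(1)[of j] by (simp add: ln_mult ln_realpow)
      finally show ?thesis .
    qed
    moreover have "real d * ln ?M \<le> real d * (2 * sqrt ?M)"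
    proof (rule mult_left_mono)
      have "ln ?M = 2 * ln (sqrt ?M)" using Mr(1)[of j] by (simp add: ln_sqrt)
      also have "\<dots> \<le> 2 * sqrt ?M" using Mr(1)[of j] ln_le_minus_one[of "sqrt ?M"] by simp
      finally show "ln ?M \<le> 2 * sqrt ?M" .
    qed simp
    ultimately have \<theta>: "\<theta> j \<le> (c + real j + real (Suc j) * (c + real (Suc j)) + 2 * ln C) + 4 * real d * sqrt ?M"
      using ln\<eta>[of j] lng[of "Suc j"] by simp
    have "\<delta> j \<le> ((c + real j + real (Suc j) * (c + real (Suc j)) + 2 * ln C) + 4 * real d * sqrt ?M) / ?M"
      unfolding \<delta>_def using \<theta> Mr(1)[of j] by (intro divide_right_mono) auto
    also have "\<dots> = (c + real j + real (Suc j) * (c + real (Suc j)) + 2 * ln C) / ?M + 4 * real d / sqrt ?M"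
    proof -
      have "B * s / (s * s) = B / s" if "s \<noteq> 0" for B s :: real using that by simp
      from this[of "sqrt ?M" "4 * real d"] show ?thesis
        using Mr(1)[of j] by (simp only: add_divide_distrib) simp
    qed
    also have "\<dots> \<le> u j"
    proof -
      have "sqrt 2 ^ j = sqrt (2 ^ j)" by (simp add: real_sqrt_power)
      also have "\<dots> \<le> sqrt ?M" using Mr(2)[of j] by simp
      finally show ?thesis
        unfolding u_def using c0 C1 Mr(2)[of j] Mr(1)[of j]
        by (intro add_mono divide_left_mono) auto
    qed
    finally show ?thesis .
  qed
  have "summable u"
  proof -
    have geo: "summable f" if "f \<in> O(\<lambda>j. inverse (real j ^ 2))" for f :: "nat \<Rightarrow> real"
      using that by (rule summable_comparison_test_bigo[rotated]) (simp add: inverse_power_summable)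
    have s2: "summable (\<lambda>j. real j ^ 2 / 2 ^ j)" by (rule geo) real_asymp
    have s1: "summable (\<lambda>j. real j / 2 ^ j)" by (rule geo) real_asymp
    have s0: "summable (\<lambda>j. (1 :: real) / 2 ^ j)" by (rule geo) real_asymp
    have s3: "summable (\<lambda>j. (1 :: real) / sqrt 2 ^ j)"
      using summable_geometric[of "1 / sqrt 2 :: real"] by (simp add: power_divide)
    have "u = (\<lambda>j. (2 * c + 1 + 2 * ln C) * (1 / 2 ^ j) + (c + 3) * (real j / 2 ^ j) + real j ^ 2 / 2 ^ j
        + 4 * real d * (1 / sqrt 2 ^ j))"
    proof
      fix j
      have "c + real j + real (Suc j) * (c + real (Suc j)) + 2 * ln C
          = (2 * c + 1 + 2 * ln C) + (c + 3) * real j + real j ^ 2"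
        by (simp add: algebra_simps power2_eq_square)
      then show "u j = (2 * c + 1 + 2 * ln C) * (1 / 2 ^ j) + (c + 3) * (real j / 2 ^ j) + real j ^ 2 / 2 ^ j
        + 4 * real d * (1 / sqrt 2 ^ j)"
        unfolding u_def by (simp only: add_divide_distrib distrib_right times_divide_eq_right mult_1_right)
    qed
    then show ?thesis by (simp only:) (intro summable_add summable_mult s0 s1 s2 s3)
  qed
  then have sum\<delta>: "summable \<delta>"
    using \<delta>u \<delta>0 by (intro summable_comparison_test[of \<delta> u]) auto
  \<comment> \<open>One plus the weight still to be spent, so that \<kappa> decreases to 1.\<close>
  define \<kappa> where "\<kappa> j = 1 + (\<Sum>i. \<delta> (i + j))" for j
  have sumj: "summable (\<lambda>i. \<delta> (i + j))" for j using sum\<delta> by (simp add: summable_iff_shift)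
  have \<kappa>S: "\<kappa> j = \<delta> j + \<kappa> (Suc j)" for j
    using suminf_split_head[OF sumj[of j]] by (simp add: \<kappa>_def)
  have \<kappa>1: "1 \<le> \<kappa> j" for j using suminf_nonneg[OF sumj[of j]] \<delta>0 by (simp add: \<kappa>_def)
  have "exp (- \<delta> j * of_int (M j)) = \<eta> j * g (Suc j)" for j
    using M1[of j] \<eta>[of j] g[of "Suc j"] by (simp add: \<delta>_def \<theta>_def)
  moreover have "of_int (p j) ^ 2 * g (Suc j) = \<eta> j * g j" for j
    using p0[of j] by (simp add: gS)
  moreover have "\<delta> j \<le> \<kappa> j" "\<kappa> (Suc j) = \<kappa> j - \<delta> j" for j using \<kappa>S[of j] \<kappa>1[of "Suc j"] by auto
  ultimately show ?thesis
    using g0 g g1 \<delta>0 \<kappa>1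
    by (intro exI[of _ \<eta>] exI[of _ g] exI[of _ \<kappa>] exI[of _ \<delta>]) (auto simp: \<eta>_def)
qed

section \<open>The hopping kernel and the sequence of stages\<close>

definition laplacian :: kernel where
  "laplacian = Kernel (\<lambda>m n. if \<bar>m - n\<bar> = 1 then 1 else 0)"

lemma col_bound_laplacian:
  "col_bound \<kappa> (2 * exp \<kappa>) (\<lambda>m n. if \<bar>m - n\<bar> = 1 then 1 else 0)"
  unfolding col_bound_def
proof (intro allI impI)
  fix n and F :: "int set" assume F: "finite F"
  let ?f = "\<lambda>m. \<bar>if \<bar>m - n\<bar> = 1 then 1 else 0\<bar> * exp (\<kappa> * \<bar>of_int (m - n)\<bar>)"
  have "sum ?f F = sum ?f (F \<inter> {n - 1, n + 1})"
    using F by (intro sum.mono_neutral_right) (auto simp: abs_if split: if_splits)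
  also have "\<dots> \<le> sum ?f {n - 1, n + 1}" by (intro sum_mono2) auto
  also have "\<dots> = 2 * exp \<kappa>" by simp
  finally show "sum ?f F \<le> 2 * exp \<kappa>" .
qed

lemma ent_laplacian: "ent laplacian m n = (if \<bar>m - n\<bar> = 1 then 1 else 0)"
proof -
  have "(\<lambda>m n :: int. if \<bar>m - n\<bar> = 1 then 1 else 0) \<in> {A. \<exists>C. col_bound 0 C A}"
    using col_bound_laplacian[of 0] by blast
  then show ?thesis unfolding laplacian_def by (simp add: Kernel_inverse)
qed

lemma weight_bound_laplacian: "weight_bound \<kappa> (2 * exp \<kappa>) laplacian"
  using col_bound_laplacian[of \<kappa>] by (simp add: ent_laplacian[abs_def])

lemma ent_laplacian_mult: "ent (laplacian * A) m n = ent A (m - 1) n + ent A (m + 1) n"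
proof -
  have "(\<Sum>\<^sub>\<infinity>l. ent laplacian m l * ent A l n) = (\<Sum>\<^sub>\<infinity>l\<in>{m - 1, m + 1}. ent A l n)"
    by (rule infsum_cong_neutral) (auto simp: ent_laplacian)
  then show ?thesis by (simp add: ent_mult)
qed

text \<open>A step only asserts existence, so the sequence comes from dependent choice. Afterwards
  the scale-dependent weights and radii are relaxed to the common values 1 and 1/8.\<close>

lemma ex_stages:
  fixes M p :: "nat \<Rightarrow> int" and C :: real and d :: nat
  assumes M0: "M 0 = 1" and MS: "\<And>j. M (Suc j) = M j * p j" and p: "\<And>j. 2 \<le> p j"
    and poly: "\<And>j. of_int (M (Suc j)) \<le> C * of_int (M j) ^ d"
  shows "\<exists>\<epsilon> V Q Qi D R. 0 < \<epsilon> \<and> (\<forall>j.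
    diagonal (V j) \<and> diagonal (D j) \<and> periodic (M j) (V j) \<and> periodic (M j) (Q j) \<and>
    periodic (M j) (Qi j) \<and> periodic (M j) (D j) \<and> periodic (M j) (R j) \<and>
    Q j * Qi j = 1 \<and> weight_bound 1 (1 / 8) (Q j - 1) \<and> weight_bound 1 (1 / 8) (Qi j - 1) \<and>
    (V j + \<epsilon> *\<^sub>R laplacian) * Q j = Q j * (D j + R j) \<and>
    norm (V (Suc j) - V j) \<le> (1 / 2) ^ j \<and> norm (Q (Suc j) - Q j) \<le> (1 / 2) ^ j \<and>
    norm (Qi (Suc j) - Qi j) \<le> (1 / 2) ^ j \<and> norm (D (Suc j) - D j) \<le> (1 / 2) ^ j \<and>
    norm (R (Suc j)) \<le> (1 / 2) ^ j)"
proof -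
  obtain \<eta> g \<kappa> \<delta> :: "nat \<Rightarrow> real" where g0: "g 0 = 1" and par: "\<And>j. \<eta> j = (1 / 2) ^ j / 1000000"
    "\<And>j. 0 < g j" "\<And>j. g j \<le> 1" "\<And>j. of_int (p j) ^ 2 * g (Suc j) \<le> \<eta> j * g j"
    "\<And>j. 0 \<le> \<delta> j" "\<And>j. \<delta> j \<le> \<kappa> j" "\<And>j. \<kappa> (Suc j) = \<kappa> j - \<delta> j" "\<And>j. 1 \<le> \<kappa> j"
    "\<And>j. exp (- \<delta> j * of_int (M j)) \<le> \<eta> j * g (Suc j)"
    using ex_scale_parameters[OF assms] by metis
  \<comment> \<open>\<epsilon> times the weighted bound 2 exp (\<kappa> 0) of the hopping kernel is
    exactly 1; this small coupling pays for all later losses of weight.\<close>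
  define \<epsilon> where "\<epsilon> = exp (- \<kappa> 0) / 2"
  define L where "L = \<epsilon> *\<^sub>R laplacian"
  define b where "b j = (\<Sum>i<j. 10000 * \<eta> i)" for j
  have Mpos: "0 < M j" for j
  proof (induction j)
    case (Suc j)
    then show ?case using p[of j] by (simp add: MS)
  qed (simp add: M0)
  have pow1: "(1 / 2 :: real) ^ j \<le> 1" for j by (simp add: power_le_one)
  have \<eta>: "0 < \<eta> j" "\<eta> j \<le> 1 / 10000" "10000 * \<eta> j \<le> (1 / 2) ^ j" for j
    using pow1[of j] by (simp_all add: par(1))
  have b: "b j \<le> 1 / 8" for j
  proof -
    define q :: real where "q = (1 / 2) ^ j"
    have "b j = 1 / 50 * (1 - q)" unfolding q_def by (induction j) (simp_all add: b_def par(1) field_simps)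
    moreover have "0 \<le> q" by (simp add: q_def)
    ultimately have "b j \<le> 1 / 50 * 1" by simp
    then show ?thesis by simp
  qed
  define P where "P j x = (case x of (V, Q, Qi, D, R) \<Rightarrow> stage L (\<kappa> j) (b j) (M j) (g j) V Q Qi D R)" for j x
  define N where "N j x y = (case x of (V, Q, Qi, D, R) \<Rightarrow> case y of (V', Q', Qi', D', R') \<Rightarrow>
     norm (V' - V) \<le> 10000 * \<eta> j \<and> norm (Q' - Q) \<le> 10000 * \<eta> j \<and> norm (Qi' - Qi) \<le> 10000 * \<eta> j \<and>
     norm (D' - D) \<le> 10000 * \<eta> j \<and> norm R' \<le> 10000 * \<eta> j)" for j :: nat and x y :: "kernel \<times> kernel \<times> kernel \<times> kernel \<times> kernel"
  have Lper: "periodic 1 L" by (simp add: L_def periodic_def ent_laplacian)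
  have "\<exists>f. \<forall>j. P j (f j) \<and> N j (f j) (f (Suc j))"
  proof (rule dependent_nat_choice)
    have "weight_bound (\<kappa> 0) (\<bar>\<epsilon>\<bar> * (2 * exp (\<kappa> 0))) L"
      unfolding L_def by (intro weight_bound_scaleR weight_bound_laplacian)
    moreover have "\<bar>\<epsilon>\<bar> * (2 * exp (\<kappa> 0)) = 1" by (simp add: \<epsilon>_def exp_minus)
    ultimately have "weight_bound (\<kappa> 0) 1 L" by (simp only:)
    moreover have "col_bound (\<kappa> 0) 0 (\<lambda>_ _. 0)" by (simp add: col_bound_def)
    \<comment> \<open>At period 1 all sites are equivalent: no gap is demanded, and the hopping
      term, which has zero diagonal, can itself serve as the remainder.\<close>
    ultimately have "P 0 (0, 1, 1, 0, L)"
      using Lper by (simp add: P_def stage_def diagonal_def on_lattice_def M0 g0 b_def periodic_zero periodic_one L_def ent_laplacian)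
    then show "\<exists>x. P 0 x" by blast
  next
    fix x j assume "P j x"
    then obtain V Q Qi D R where x: "x = (V, Q, Qi, D, R)"
      and st: "stage L (\<kappa> j) (b j) (M j) (g j) V Q Qi D R"
      by (cases x) (auto simp: P_def)
    have p0: "0 < p j" using p[of j] by simp
    obtain V' Q' Qi' D' R' where "stage L (\<kappa> j - \<delta> j) (b j + 10000 * \<eta> j) (M j * p j) (g (Suc j)) V' Q' Qi' D' R'"
      "norm (V' - V) \<le> 10000 * \<eta> j" "norm (Q' - Q) \<le> 10000 * \<eta> j" "norm (Qi' - Qi) \<le> 10000 * \<eta> j"
      "norm (D' - D) \<le> 10000 * \<eta> j" "norm R' \<le> 10000 * \<eta> j"
      using stage_step[OF st b Mpos p0 Lper par(5,6) par(2,3) \<eta>(1,2) par(2,4) par(9)] by blast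
    then have "P (Suc j) (V', Q', Qi', D', R') \<and> N j x (V', Q', Qi', D', R')"
      unfolding P_def N_def x by (simp add: par(7) MS b_def)
    then show "\<exists>y. P (Suc j) y \<and> N j x y" by blast
  qed
  then obtain f where f: "\<And>j. P j (f j)" "\<And>j. N j (f j) (f (Suc j))" by blast
  define V Q Qi D R where "V j = fst (f j)" "Q j = fst (snd (f j))" "Qi j = fst (snd (snd (f j)))"
    "D j = fst (snd (snd (snd (f j))))" "R j = snd (snd (snd (snd (f j))))" for j
  have ff: "f j = (V j, Q j, Qi j, D j, R j)" for j by (simp add: V_Q_Qi_D_R_def)
  have st: "stage L (\<kappa> j) (b j) (M j) (g j) (V j) (Q j) (Qi j) (D j) (R j)" for j
    using f(1)[of j] by (simp add: P_def ff)
  show ?thesis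
  proof (rule exI[of _ \<epsilon>], rule exI[of _ V], rule exI[of _ Q], rule exI[of _ Qi], rule exI[of _ D],
      rule exI[of _ R], rule conjI, goal_cases)
    case 1
    show ?case by (simp add: \<epsilon>_def)
  next
    case 2
    show ?case
    proof
      fix j
      have w: "weight_bound 1 (1 / 8) A" if "weight_bound (\<kappa> j) (b j) A" for A
        using col_bound_mono[OF col_bound_anti_weight[OF that par(8)] b] .
      have "norm (V (Suc j) - V j) \<le> (1 / 2) ^ j \<and> norm (Q (Suc j) - Q j) \<le> (1 / 2) ^ j \<and>
        norm (Qi (Suc j) - Qi j) \<le> (1 / 2) ^ j \<and> norm (D (Suc j) - D j) \<le> (1 / 2) ^ j \<and>
        norm (R (Suc j)) \<le> (1 / 2) ^ j"
        using f(2)[of j] \<eta>(3)[of j] unfolding N_def ff by auto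
      then show "diagonal (V j) \<and> diagonal (D j) \<and> periodic (M j) (V j) \<and> periodic (M j) (Q j) \<and>
        periodic (M j) (Qi j) \<and> periodic (M j) (D j) \<and> periodic (M j) (R j) \<and>
        Q j * Qi j = 1 \<and> weight_bound 1 (1 / 8) (Q j - 1) \<and> weight_bound 1 (1 / 8) (Qi j - 1) \<and>
        (V j + \<epsilon> *\<^sub>R laplacian) * Q j = Q j * (D j + R j) \<and>
        norm (V (Suc j) - V j) \<le> (1 / 2) ^ j \<and> norm (Q (Suc j) - Q j) \<le> (1 / 2) ^ j \<and>
        norm (Qi (Suc j) - Qi j) \<le> (1 / 2) ^ j \<and> norm (D (Suc j) - D j) \<le> (1 / 2) ^ j \<and>
        norm (R (Suc j)) \<le> (1 / 2) ^ j"
        using st[of j] w unfolding stage_def L_def by blast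
    qed
  qed
qed


section \<open>Limits along shifts\<close>

definition shift :: "int \<Rightarrow> kernel \<Rightarrow> kernel" where
  "shift s A = Kernel (\<lambda>m n. ent A (m + s) (n + s))"

lemma col_bound_shift:
  assumes "col_bound \<kappa> C A"
  shows "col_bound \<kappa> C (\<lambda>m n. A (m + s) (n + s))"
  unfolding col_bound_def
proof (intro allI impI)
  fix n and F :: "int set" assume "finite F"
  have "(\<Sum>m\<in>F. \<bar>A (m + s) (n + s)\<bar> * exp (\<kappa> * \<bar>of_int (m - n)\<bar>))
      = (\<Sum>m\<in>(\<lambda>m. m + s) ` F. \<bar>A m (n + s)\<bar> * exp (\<kappa> * \<bar>of_int (m - (n + s))\<bar>))"
    by (subst sum.reindex) auto
  also have "\<dots> \<le> C" using \<open>finite F\<close> by (intro col_boundD[OF assms]) simp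
  finally show "(\<Sum>m\<in>F. \<bar>A (m + s) (n + s)\<bar> * exp (\<kappa> * \<bar>of_int (m - n)\<bar>)) \<le> C" .
qed

lemma ent_shift [simp]: "ent (shift s A) m n = ent A (m + s) (n + s)"
proof -
  have "(\<lambda>m n. ent A (m + s) (n + s)) \<in> {A. \<exists>C. col_bound 0 C A}"
    using col_bound_shift[OF col_bound_norm] by blast
  then show ?thesis unfolding shift_def by (simp add: Kernel_inverse)
qed

lemma weight_bound_shift: "weight_bound \<kappa> C A \<Longrightarrow> weight_bound \<kappa> C (shift s A)"
  using col_bound_shift[of \<kappa> C "ent A" s] by (simp add: ent_shift[abs_def])

lemma norm_shift_le: "norm (shift s A) \<le> norm A"
  unfolding norm_kernel_le by (intro weight_bound_shift col_bound_norm)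

lemma shift_mult: "shift s (A * B) = shift s A * shift s B"
  by (rule kernel_eqI) (simp only: ent_shift ent_mult_shift, simp add: ent_mult)

lemma shift_add: "shift s (A + B) = shift s A + shift s B"
  and shift_diff: "shift s (A - B) = shift s A - shift s B"
  and shift_one: "shift s 1 = 1"
  and shift_scaleR: "shift s (c *\<^sub>R A) = c *\<^sub>R shift s A"
  and shift_laplacian: "shift s laplacian = laplacian"
  by (rule kernel_eqI; simp add: ent_laplacian)+

text \<open>A kernel of period \<open>M\<close> sees only the residue of the shift, so it can be
  shifted by a point of the inverse limit.\<close>

lemma shift_periodic:
  assumes "periodic M A" "M dvd s - t"
  shows "shift s A = shift t A"
proof (rule kernel_eqI)
  fix m n
  have "periodic (s - t) A" using assms by (rule periodic_dvd)
  then have "ent A (m + t + (s - t)) (n + t + (s - t)) = ent A (m + t) (n + t)"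
    unfolding periodic_def by blast
  then show "ent (shift s A) m n = ent (shift t A) m n" by simp
qed

text \<open>The change from \<open>s j\<close> to \<open>s (Suc j)\<close> is invisible to
  \<open>A j\<close>, so consecutive terms differ by a shift of \<open>A (Suc j) - A j\<close> and
  the geometric bound survives.\<close>

lemma convergent_shift:
  fixes A :: "nat \<Rightarrow> kernel"
  assumes per: "\<And>j. periodic (M j) (A j)" and s: "\<And>j. M j dvd s (Suc j) - s j"
    and A: "\<And>j. norm (A (Suc j) - A j) \<le> (1 / 2) ^ j"
  shows "convergent (\<lambda>j. shift (s j) (A j))"
proof -
  define B where "B j = shift (s j) (A j)" for j
  have "norm (B (Suc j) - B j) \<le> (1 / 2) ^ j" for j
  proof -
    have "B (Suc j) - B j = shift (s (Suc j)) (A (Suc j) - A j)"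
      unfolding B_def shift_diff by (simp only: shift_periodic[OF per[of j] s[of j]])
    then show ?thesis using order_trans[OF norm_shift_le A[of j], of "s (Suc j)"] by (simp only:)
  qed
  then have "summable (\<lambda>j. B (Suc j) - B j)"
    by (intro summable_comparison_test'[OF summable_geometric[of "1 / 2 :: real"], of 0]) simp_all
  then have "convergent (\<lambda>n. (\<Sum>j<n. B (Suc j) - B j))" by (simp add: summable_iff_convergent)
  then have "convergent (\<lambda>n. B n - B 0)" by (simp add: sum_lessThan_telescope)
  then have "convergent (\<lambda>n. (B n - B 0) + B 0)" by (intro convergent_add convergent_const)
  then show ?thesis by (simp add: B_def)
qed

text \<open>A coherent \<open>s\<close> stands for a point of the group, and the limit of the
  shifted potentials is the potential along its orbit. Shifting \<open>Q\<close>, \<open>Qi\<close>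
  and \<open>D\<close> in the same way carries the diagonalisation to every point with unchanged
  constants.\<close>

lemma ex_localized_kernels:
  fixes M p :: "nat \<Rightarrow> int" and C :: real and d :: nat
  assumes M0: "M 0 = 1" and MS: "\<And>j. M (Suc j) = M j * p j" and p: "\<And>j. 2 \<le> p j"
    and poly: "\<And>j. of_int (M (Suc j)) \<le> C * of_int (M j) ^ d"
  shows "\<exists>(\<epsilon> :: real) (v :: nat \<Rightarrow> int \<Rightarrow> real). 0 < \<epsilon> \<and>
    (\<forall>j m n. M j dvd m - n \<longrightarrow> v j m = v j n) \<and> (\<forall>j n. \<bar>v (Suc j) n - v j n\<bar> \<le> (1 / 2) ^ j) \<and>
    (\<forall>s. (\<forall>j. M j dvd s (Suc j) - s j) \<longrightarrow> (\<exists>V Q Qi D.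
      (\<forall>n. (\<lambda>j. v j (n + s j)) \<longlonglongrightarrow> ent V n n) \<and> diagonal V \<and> diagonal D \<and>
      (V + \<epsilon> *\<^sub>R laplacian) * Q = Q * D \<and> Q * Qi = 1 \<and>
      weight_bound 1 (1 / 8) (Q - 1) \<and> weight_bound 1 (1 / 8) (Qi - 1)))"
proof -
  obtain \<epsilon> V Q Qi D R where \<epsilon>: "0 < \<epsilon>"
    and dg: "\<And>j. diagonal (V j)" "\<And>j. diagonal (D j)"
    and per: "\<And>j. periodic (M j) (V j)" "\<And>j. periodic (M j) (Q j)" "\<And>j. periodic (M j) (Qi j)"
      "\<And>j. periodic (M j) (D j)" "\<And>j. periodic (M j) (R j)"
    and inv: "\<And>j. Q j * Qi j = 1"
    and w: "\<And>j. weight_bound 1 (1 / 8) (Q j - 1)" "\<And>j. weight_bound 1 (1 / 8) (Qi j - 1)"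
    and eq: "\<And>j. (V j + \<epsilon> *\<^sub>R laplacian) * Q j = Q j * (D j + R j)"
    and le: "\<And>j. norm (V (Suc j) - V j) \<le> (1 / 2) ^ j" "\<And>j. norm (Q (Suc j) - Q j) \<le> (1 / 2) ^ j"
      "\<And>j. norm (Qi (Suc j) - Qi j) \<le> (1 / 2) ^ j" "\<And>j. norm (D (Suc j) - D j) \<le> (1 / 2) ^ j"
      "\<And>j. norm (R (Suc j)) \<le> (1 / 2) ^ j"
    using ex_stages[OF assms] by metis
  define v where "v j n = ent (V j) n n" for j n
  show ?thesis
  proof (intro exI[of _ \<epsilon>] exI[of _ v] conjI allI impI)
    show "0 < \<epsilon>" by (rule \<epsilon>)
    show "v j m = v j n" if "M j dvd m - n" for j m n
    proof -
      have "ent (V j) (n + (m - n)) (n + (m - n)) = ent (V j) n n"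
        using periodic_dvd[OF per(1) that] unfolding periodic_def by blast
      then show ?thesis by (simp add: v_def)
    qed
    show "\<bar>v (Suc j) n - v j n\<bar> \<le> (1 / 2) ^ j" for j n
      using ent_abs_le_norm[of "V (Suc j) - V j" n n] le(1)[of j] by (simp add: v_def)
    fix s assume s: "\<forall>j. M j dvd s (Suc j) - s j"
    have conv: "\<exists>L. (\<lambda>j. shift (s j) (A j)) \<longlonglongrightarrow> L"
      if "\<And>j. periodic (M j) (A j)" "\<And>j. norm (A (Suc j) - A j) \<le> (1 / 2) ^ j" for A
      using convergent_shift[of M A s] that s by (simp add: convergent_def)
    obtain V' Q' Qi' D' where lim: "(\<lambda>j. shift (s j) (V j)) \<longlonglongrightarrow> V'" "(\<lambda>j. shift (s j) (Q j)) \<longlonglongrightarrow> Q'"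
      "(\<lambda>j. shift (s j) (Qi j)) \<longlonglongrightarrow> Qi'" "(\<lambda>j. shift (s j) (D j)) \<longlonglongrightarrow> D'"
      using conv per le by meson
    have lim': "(\<lambda>j. shift (s (Suc j)) (A (Suc j))) \<longlonglongrightarrow> L" if "(\<lambda>j. shift (s j) (A j)) \<longlonglongrightarrow> L" for A L
      using LIMSEQ_Suc[OF that] .
    \<comment> \<open>Remainders are estimated only from stage 1 on, so the equation is passed to
      the limit along successor indices.\<close>
    have "(\<lambda>j. shift (s (Suc j)) (R (Suc j))) \<longlonglongrightarrow> 0"
    proof (rule Lim_null_comparison)
      show "\<forall>\<^sub>F j in sequentially. norm (shift (s (Suc j)) (R (Suc j))) \<le> (1 / 2) ^ j"
        using order_trans[OF norm_shift_le le(5)] by (intro always_eventually) blast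
      show "(\<lambda>j. (1 / 2 :: real) ^ j) \<longlonglongrightarrow> 0" by (intro LIMSEQ_power_zero) simp
    qed
    from tendsto_mult[OF lim'[OF lim(2)] tendsto_add[OF lim'[OF lim(4)] this]]
    have "(\<lambda>j. shift (s (Suc j)) (Q (Suc j) * (D (Suc j) + R (Suc j)))) \<longlonglongrightarrow> Q' * (D' + 0)"
      by (simp add: shift_mult shift_add)
    moreover have "(\<lambda>j. shift (s (Suc j)) (Q (Suc j) * (D (Suc j) + R (Suc j)))) \<longlonglongrightarrow> (V' + \<epsilon> *\<^sub>R laplacian) * Q'"
      unfolding eq[symmetric] shift_mult shift_add shift_scaleR shift_laplacian
      by (intro tendsto_mult tendsto_add tendsto_const lim' lim)
    ultimately have eq': "(V' + \<epsilon> *\<^sub>R laplacian) * Q' = Q' * D'"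
      using LIMSEQ_unique by fastforce
    have QQi: "Q' * Qi' = 1"
    proof -
      have "(\<lambda>j. shift (s j) (Q j * Qi j)) \<longlonglongrightarrow> Q' * Qi'"
        unfolding shift_mult by (intro tendsto_mult lim)
      then show ?thesis by (simp add: inv shift_one LIMSEQ_const_iff)
    qed
    have lv: "(\<lambda>j. v j (n + s j)) \<longlonglongrightarrow> ent V' n n" for n
      using ent_tendsto[OF lim(1), of n n] by (simp add: v_def)
    have closed_lim: "L \<in> {A. S A}" if "closed {A. S A}" "\<And>j. S (shift (s j) (A j))" "(\<lambda>j. shift (s j) (A j)) \<longlonglongrightarrow> L" for S A L
      using that by (intro Lim_in_closed_set[OF that(1) _ _ that(3)]) auto
    have dV: "diagonal V'" "diagonal D'"
      using closed_lim[OF closed_diagonal _ lim(1)] closed_lim[OF closed_diagonal _ lim(4)] dg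
      by (simp_all add: diagonal_def)
    have wl: "weight_bound 1 (1 / 8) (L - 1)"
      if "\<And>j. weight_bound 1 (1 / 8) (A j - 1)" "(\<lambda>j. shift (s j) (A j)) \<longlonglongrightarrow> L" for A L
    proof -
      have "(\<lambda>j. shift (s j) (A j - 1)) \<longlonglongrightarrow> L - 1"
        unfolding shift_diff shift_one by (intro tendsto_diff tendsto_const that)
      from closed_lim[OF closed_weight_bound _ this] show ?thesis
        using weight_bound_shift[OF that(1)] by blast
    qed
    show "\<exists>V Q Qi D. (\<forall>n. (\<lambda>j. v j (n + s j)) \<longlonglongrightarrow> ent V n n) \<and> diagonal V \<and> diagonal D \<and>
      (V + \<epsilon> *\<^sub>R laplacian) * Q = Q * D \<and> Q * Qi = 1 \<and>
      weight_bound 1 (1 / 8) (Q - 1) \<and> weight_bound 1 (1 / 8) (Qi - 1)"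
      by (rule exI[of _ V'], rule exI[of _ Q'], rule exI[of _ Qi'], rule exI[of _ D'])
         (intro conjI allI lv dV eq' QQi wl[OF w(1) lim(2)] wl[OF w(2) lim(3)])
  qed
qed


section \<open>Exponentially decaying families in \<open>\<ell>\<^sup>2(\<int>)\<close>\<close>

lemma exp_neg_abs_summable:
  fixes r :: real and m :: int
  assumes "0 < r"
  shows "(\<lambda>k :: int. exp (- r * \<bar>of_int (k - m)\<bar>)) summable_on UNIV"
proof -
  let ?f = "\<lambda>k :: int. exp (- r * \<bar>of_int k\<bar>)"
  have geo: "(\<lambda>n :: nat. c * exp (- r) ^ n) summable_on UNIV" for c
    using assms by (intro norm_summable_imp_summable_on)
      (simp only: norm_mult norm_power, intro summable_mult summable_geometric, simp)
  have e: "exp (- r * real n) = exp (- r) ^ n" for n by (simp add: exp_of_nat_mult[symmetric] mult.commute)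
  have "(?f \<circ> int) summable_on UNIV" 
    using geo[of 1] by (simp only: o_def of_int_of_nat_eq abs_of_nat e mult_1_left)
  then have 1: "?f summable_on range int"
    by (subst summable_on_reindex) (auto simp: inj_on_def)
  have "(?f \<circ> (\<lambda>n. - 1 - int n)) summable_on UNIV"
  proof -
    have "exp (- r * \<bar>of_int (- 1 - int n)\<bar>) = exp (- r) * exp (- r) ^ n" for n
      by (simp add: e[symmetric] exp_add[symmetric] algebra_simps abs_if)
    then show ?thesis using geo[of "exp (- r)"] by (simp add: o_def del: of_int_diff)
  qed
  then have 2: "?f summable_on range (\<lambda>n. - 1 - int n)"
    by (subst summable_on_reindex) (auto simp: inj_on_def)
  have "k \<in> range int \<union> range (\<lambda>n. - 1 - int n)" for k :: int
  proof (cases "k \<ge> 0")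
    case True
    then have "k = int (nat k)" by simp
    then show ?thesis by blast
  next
    case False
    then have "k = - 1 - int (nat (- 1 - k))" by simp
    then show ?thesis by blast
  qed
  then have U: "range int \<union> range (\<lambda>n. - 1 - int n) = UNIV" by blast
  have "?f summable_on UNIV"
    using summable_on_Un_disjoint[OF 1 2] unfolding U by force
  then have "?f summable_on range (\<lambda>k. k - m)"
    by (rule summable_on_subset_banach) simp
  then show ?thesis
    by (subst (asm) summable_on_reindex) (auto simp: inj_on_def o_def)
qed

definition exp_sum :: "real \<Rightarrow> real" where
  "exp_sum r = (\<Sum>\<^sub>\<infinity>k::int. exp (- r * \<bar>of_int k\<bar>))"

lemma exp_sum_shift: "(\<Sum>\<^sub>\<infinity>k. exp (- r * \<bar>of_int (k - m)\<bar>)) = exp_sum r"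
  unfolding exp_sum_def
  by (rule infsum_reindex_bij_witness[of UNIV "\<lambda>k. k + m" "\<lambda>k. k - m"]) auto

lemma exp_sum_nonneg: "0 \<le> exp_sum r"
  unfolding exp_sum_def by (intro infsum_nonneg) simp

lemma l2_norm_nonneg: "0 \<le> l2_norm u"
  unfolding l2_norm_def by (simp add: infsum_nonneg)

lemma l2_finite_sum_le: "u \<in> l2 \<Longrightarrow> finite F \<Longrightarrow> L2_set (\<lambda>n. cmod (u n)) F \<le> l2_norm u"
  unfolding l2_norm_def L2_set_def l2_def
  by (intro real_sqrt_le_mono finite_sum_le_infsum) auto

lemma l2_norm_leI:
  assumes "\<And>F. finite F \<Longrightarrow> L2_set (\<lambda>n. cmod (u n)) F \<le> c"
  shows "u \<in> l2" "l2_norm u \<le> c"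
proof -
  have c: "0 \<le> c" using assms[of "{}"] by simp
  have le: "(\<Sum>n\<in>F. (cmod (u n))\<^sup>2) \<le> c\<^sup>2" if "finite F" for F
  proof -
    have "sqrt (\<Sum>n\<in>F. (cmod (u n))\<^sup>2) \<le> c" using assms[OF that] by (simp add: L2_set_def)
    then show ?thesis by (simp add: sqrt_le_D)
  qed
  have s: "(\<lambda>n. (cmod (u n))\<^sup>2) summable_on UNIV"
    by (rule nonneg_bdd_above_summable_on) (auto intro!: bdd_aboveI2[where M = "c\<^sup>2"] le)
  then show "u \<in> l2" by (simp add: l2_def)
  have "(\<Sum>\<^sub>\<infinity>n. (cmod (u n))\<^sup>2) \<le> c\<^sup>2"
    by (rule infsum_le_finite_sums[OF s]) (use le in auto)
  then show "l2_norm u \<le> c"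
    unfolding l2_norm_def using c by (intro real_le_lsqrt) (auto simp: infsum_nonneg)
qed

lemma l2_add:
  assumes "u \<in> l2" "v \<in> l2"
  shows "(\<lambda>n. u n + v n) \<in> l2" "l2_norm (\<lambda>n. u n + v n) \<le> l2_norm u + l2_norm v"
proof -
  have "L2_set (\<lambda>n. cmod (u n + v n)) F \<le> l2_norm u + l2_norm v" if "finite F" for F
  proof -
    have "L2_set (\<lambda>n. cmod (u n + v n)) F \<le> L2_set (\<lambda>n. cmod (u n) + cmod (v n)) F"
      by (intro L2_set_mono norm_triangle_ineq) auto
    also have "\<dots> \<le> L2_set (\<lambda>n. cmod (u n)) F + L2_set (\<lambda>n. cmod (v n)) F" by (rule L2_set_triangle_ineq)
    also have "\<dots> \<le> l2_norm u + l2_norm v" by (intro add_mono l2_finite_sum_le assms that)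
    finally show ?thesis .
  qed
  then show "(\<lambda>n. u n + v n) \<in> l2" "l2_norm (\<lambda>n. u n + v n) \<le> l2_norm u + l2_norm v"
    by (auto intro: l2_norm_leI)
qed

lemma l2_scale:
  assumes "u \<in> l2"
  shows "(\<lambda>n. c * u n) \<in> l2" "l2_norm (\<lambda>n. c * u n) \<le> cmod c * l2_norm u"
proof -
  have "L2_set (\<lambda>n. cmod (c * u n)) F \<le> cmod c * l2_norm u" if "finite F" for F
    using mult_left_mono[OF l2_finite_sum_le[OF assms that], of "cmod c"]
    by (simp add: norm_mult L2_set_right_distrib)
  then show "(\<lambda>n. c * u n) \<in> l2" "l2_norm (\<lambda>n. c * u n) \<le> cmod c * l2_norm u"
    by (auto intro: l2_norm_leI)
qed

lemma l2_zero: "(\<lambda>n. 0) \<in> l2" "l2_norm (\<lambda>n. 0) \<le> 0"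
  using l2_norm_leI[of "\<lambda>n. 0" 0] by (simp_all add: L2_set_def)

lemma l2_sum:
  assumes "\<And>k. k \<in> F \<Longrightarrow> u k \<in> l2"
  shows "(\<lambda>n. \<Sum>k\<in>F. u k n) \<in> l2" "l2_norm (\<lambda>n. \<Sum>k\<in>F. u k n) \<le> (\<Sum>k\<in>F. l2_norm (u k))"
proof -
  have "(\<lambda>n. \<Sum>k\<in>F. u k n) \<in> l2 \<and> l2_norm (\<lambda>n. \<Sum>k\<in>F. u k n) \<le> (\<Sum>k\<in>F. l2_norm (u k))"
    using assms
  proof (induction F rule: infinite_finite_induct)
    case (insert k F)
    then show ?case using l2_add[of "u k" "\<lambda>n. \<Sum>k\<in>F. u k n"] by (auto intro: order_trans)
  qed (auto simp: l2_zero)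
  then show "(\<lambda>n. \<Sum>k\<in>F. u k n) \<in> l2" "l2_norm (\<lambda>n. \<Sum>k\<in>F. u k n) \<le> (\<Sum>k\<in>F. l2_norm (u k))" by auto
qed

lemma l2_diff: "u \<in> l2 \<Longrightarrow> v \<in> l2 \<Longrightarrow> (\<lambda>n. u n - v n) \<in> l2"
  using l2_add(1)[of u "\<lambda>n. - 1 * v n"] l2_scale(1)[of v "- 1"] by simp

lemma l2_entry_le: "u \<in> l2 \<Longrightarrow> cmod (u n) \<le> l2_norm u"
  using l2_finite_sum_le[of u "{n}"] by (simp add: L2_set_def)

lemma l2_exp_decay:
  assumes "0 < r" "\<And>n. cmod (u n) \<le> K * exp (- r * \<bar>of_int (n - m)\<bar>)"
  shows "u \<in> l2" "l2_norm u \<le> K * sqrt (exp_sum (2 * r))"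
proof -
  have K: "0 \<le> K" using order_trans[OF norm_ge_zero assms(2)[of m]] by simp
  have "L2_set (\<lambda>n. cmod (u n)) F \<le> K * sqrt (exp_sum (2 * r))" if F: "finite F" for F
  proof -
    have "(\<Sum>n\<in>F. (cmod (u n))\<^sup>2) \<le> (\<Sum>n\<in>F. K\<^sup>2 * exp (- (2 * r) * \<bar>of_int (n - m)\<bar>))"
    proof (rule sum_mono)
      fix n
      have "(cmod (u n))\<^sup>2 \<le> (K * exp (- r * \<bar>of_int (n - m)\<bar>))\<^sup>2" by (intro power_mono assms(2)) simp
      then show "(cmod (u n))\<^sup>2 \<le> K\<^sup>2 * exp (- (2 * r) * \<bar>of_int (n - m)\<bar>)"
        by (simp add: power_mult_distrib exp_double[symmetric] mult.assoc)
    qed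
    also have "\<dots> = K\<^sup>2 * (\<Sum>n\<in>F. exp (- (2 * r) * \<bar>of_int (n - m)\<bar>))" by (simp add: sum_distrib_left)
    also have "\<dots> \<le> K\<^sup>2 * exp_sum (2 * r)"
      unfolding exp_sum_shift[of "2 * r" m, symmetric] using assms(1) F
      by (intro mult_left_mono finite_sum_le_infsum exp_neg_abs_summable) auto
    finally have "L2_set (\<lambda>n. cmod (u n)) F \<le> sqrt (K\<^sup>2 * exp_sum (2 * r))"
      unfolding L2_set_def by (rule real_sqrt_le_mono)
    then show ?thesis using K by (simp add: real_sqrt_mult)
  qed
  then show "u \<in> l2" "l2_norm u \<le> K * sqrt (exp_sum (2 * r))" by (auto intro: l2_norm_leI)
qed

text \<open>Convergence in norm forces convergence of every entry. This makes the \<open>THE\<close>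
  in \<open>op_exp\<close> determinate.\<close>

lemma l2_sums_unique:
  assumes "l2_sums u v" "l2_sums u w"
  shows "v = w"
proof
  fix n
  have "(\<lambda>N. \<Sum>k<N. u k n) \<longlonglongrightarrow> x n" if "l2_sums u x" for x
  proof -
    have "(\<lambda>N. (\<Sum>k<N. u k n) - x n) \<longlonglongrightarrow> 0"
    proof (rule Lim_null_comparison)
      have "(\<lambda>n. (\<Sum>k<N. u k n) - x n) \<in> l2" for N
        using that unfolding l2_sums_def by (intro l2_diff l2_sum) auto
      from l2_entry_le[OF this]
      show "\<forall>\<^sub>F N in sequentially. norm ((\<Sum>k<N. u k n) - x n) \<le> l2_norm (\<lambda>n. (\<Sum>k<N. u k n) - x n)"
        by (intro always_eventually) simp
      show "(\<lambda>N. l2_norm (\<lambda>n. (\<Sum>k<N. u k n) - x n)) \<longlonglongrightarrow> 0"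
        using that by (simp add: l2_sums_def)
    qed
    then show ?thesis by (simp add: LIM_zero_iff)
  qed
  from this[OF assms(1)] this[OF assms(2)] show "v n = w n" by (rule LIMSEQ_unique)
qed

lemma op_exp_eqI: "l2_sums (\<lambda>k n. (A ^^ k) \<psi> n / fact k) \<phi> \<Longrightarrow> op_exp A \<psi> = \<phi>"
  unfolding op_exp_def by (rule the_equality) (auto intro: l2_sums_unique)

lemma l2_inner_delta: "l2_inner (delta n) \<phi> = \<phi> n"
  unfolding l2_inner_def delta_def by (subst infsum_single[of n]) auto

text \<open>Termwise domination by the real series at \<open>R\<close> gives a bound uniform over
  the disc, hence over all eigenvalues at once.\<close>

lemma exp_remainder_bound:
  fixes z :: complex
  assumes "cmod z \<le> R"
  shows "cmod ((\<Sum>k<N. z ^ k / fact k) - exp z) \<le> exp R - (\<Sum>k<N. R ^ k / fact k)"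
proof -
  have R: "0 \<le> R" using assms norm_ge_zero order_trans by blast
  have sz: "(\<lambda>k. z ^ k / fact k) sums exp z"
    using exp_converges[of z] by (simp add: scaleR_conv_of_real divide_inverse mult.commute)
  have sR: "(\<lambda>k. R ^ k / fact k) sums exp R"
    using exp_converges[of R] by (simp add: divide_inverse mult.commute)
  have tz: "(\<lambda>k. z ^ (k + N) / fact (k + N)) sums (exp z - (\<Sum>k<N. z ^ k / fact k))"
    using sums_split_initial_segment[OF sz, of N] .
  have tR: "(\<lambda>k. R ^ (k + N) / fact (k + N)) sums (exp R - (\<Sum>k<N. R ^ k / fact k))"
    using sums_split_initial_segment[OF sR, of N] .
  have "norm (exp z - (\<Sum>k<N. z ^ k / fact k)) \<le> exp R - (\<Sum>k<N. R ^ k / fact k)"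
    unfolding sums_unique[OF tz] sums_unique[OF tR]
  proof (rule norm_suminf_le)
    show "norm (z ^ (k + N) / fact (k + N)) \<le> R ^ (k + N) / fact (k + N)" for k
      using assms by (simp add: norm_divide norm_power divide_right_mono power_mono)
    show "summable (\<lambda>k. R ^ (k + N) / fact (k + N))" using tR by (rule sums_summable)
  qed
  then show ?thesis by (simp add: norm_minus_commute)
qed

lemma exp_remainder_tendsto: "(\<lambda>N. exp R - (\<Sum>k<N. R ^ k / fact k)) \<longlonglongrightarrow> (0::real)"
proof -
  have "(\<lambda>k. R ^ k / fact k) sums exp R"
    using exp_converges[of R] by (simp add: divide_inverse mult.commute)
  then have "(\<lambda>N. exp R - (\<Sum>k<N. R ^ k / fact k)) \<longlonglongrightarrow> exp R - exp R"
    unfolding sums_def by (intro tendsto_intros)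
  then show ?thesis by simp
qed


section \<open>Localization from a decaying diagonalisation\<close>

text \<open>Half of the rate is kept for the distance from n to m; the other half makes the sum over
  l finite.\<close>

lemma exp_weight_split:
  fixes n l m :: int
  shows "exp (- \<bar>of_int (n - l)\<bar>) * exp (- \<bar>of_int (l - m)\<bar>)
    \<le> exp (- (1 / 2) * \<bar>of_int (n - m)\<bar>) * exp (- (1 / 2) * \<bar>of_int (l - m)\<bar> :: real)"
proof -
  have "\<bar>n - m\<bar> \<le> \<bar>n - l\<bar> + \<bar>l - m\<bar>" by linarith
  then have "\<bar>of_int (n - m) :: real\<bar> \<le> \<bar>of_int (n - l)\<bar> + \<bar>of_int (l - m)\<bar>" by linarith
  moreover have "- y + - z \<le> - (1 / 2) * x + - (1 / 2) * z" if "x \<le> y + z" "0 \<le> y" for x y z :: real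
    using that by (simp add: field_simps)
  ultimately show ?thesis
    unfolding exp_add[symmetric] exp_le_cancel_iff by (meson abs_ge_zero)
qed

lemma infsum_diff_tendsto_0:
  fixes f :: "'i \<Rightarrow> real"
  assumes "f summable_on UNIV" "0 < e"
  shows "\<exists>G. finite G \<and> (\<forall>H. finite H \<longrightarrow> G \<subseteq> H \<longrightarrow> \<bar>infsum f (- H)\<bar> < e)"
proof -
  have "\<forall>\<^sub>F H in finite_subsets_at_top UNIV. dist (sum f H) (infsum f UNIV) < e"
    using infsum_tendsto[OF assms(1)] assms(2) by (rule tendstoD)
  then obtain G where G: "finite G" "\<And>H. finite H \<Longrightarrow> G \<subseteq> H \<Longrightarrow> dist (sum f H) (infsum f UNIV) < e"
    unfolding eventually_finite_subsets_at_top by auto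
  have "\<bar>infsum f (- H)\<bar> < e" if "finite H" "G \<subseteq> H" for H
  proof -
    have "infsum f (UNIV - H) = infsum f UNIV - sum f H"
      using that assms(1) by (subst infsum_Diff) auto
    then show ?thesis using G(2)[OF that] by (simp add: Compl_eq_Diff_UNIV dist_real_def abs_minus_commute)
  qed
  with G(1) show ?thesis by blast
qed

text \<open>The columns of \<open>q\<close> are the eigenfunctions, and \<open>qi\<close> takes the
  role that the adjoint would have for an orthonormal basis.\<close>

locale localized_basis =
  fixes q qi :: "int \<Rightarrow> int \<Rightarrow> real" and W e :: "int \<Rightarrow> real" and C B :: real
  assumes eigen: "\<And>n l. q (n + 1) l + q (n - 1) l + W n * q n l = e l * q n l"
    and q_decay: "\<And>n l. \<bar>q n l\<bar> \<le> C * exp (- \<bar>of_int (n - l)\<bar>)"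
    and qi_decay: "\<And>l m. \<bar>qi l m\<bar> \<le> C * exp (- \<bar>of_int (l - m)\<bar>)"
    and inverse: "\<And>n m. (\<Sum>\<^sub>\<infinity>l. q n l * qi l m) = (if n = m then 1 else 0)"
    and nonzero: "\<And>l. q l l \<noteq> 0"
    and e_bounded: "\<And>l. \<bar>e l\<bar> \<le> B"
begin

text \<open>Column m of Q diag(a) Qi: the functional calculus applied to \<open>delta m\<close>,
  with the function given by its values on the labels l of the eigenvalues.\<close>

definition spectral :: "(int \<Rightarrow> complex) \<Rightarrow> int \<Rightarrow> int \<Rightarrow> complex" where
  "spectral a m n = (\<Sum>\<^sub>\<infinity>l. of_real (q n l) * a l * of_real (qi l m))"

lemma C_nonneg: "0 \<le> C"
  using order_trans[OF abs_ge_zero q_decay[of 0 0]] by simp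

lemma kernel_decay:
  "\<bar>q n l * qi l m\<bar> \<le> C\<^sup>2 * exp (- (1 / 2) * \<bar>of_int (n - m)\<bar>) * exp (- (1 / 2) * \<bar>of_int (l - m)\<bar>)"
proof -
  have "\<bar>q n l * qi l m\<bar> \<le> (C * exp (- \<bar>of_int (n - l)\<bar>)) * (C * exp (- \<bar>of_int (l - m)\<bar>))"
    unfolding abs_mult by (intro mult_mono q_decay qi_decay) (auto simp: C_nonneg)
  also have "\<dots> = C\<^sup>2 * (exp (- \<bar>of_int (n - l)\<bar>) * exp (- \<bar>of_int (l - m)\<bar>))"
    by (simp add: power2_eq_square mult_ac)
  also have "\<dots> \<le> C\<^sup>2 * (exp (- (1 / 2) * \<bar>of_int (n - m)\<bar>) * exp (- (1 / 2) * \<bar>of_int (l - m)\<bar>))"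
    by (intro mult_left_mono exp_weight_split) simp
  finally show ?thesis by (simp add: mult.assoc)
qed

lemma spectral_term_bound:
  assumes "cmod (a l) \<le> A l"
  shows "cmod (of_real (q n l) * a l * of_real (qi l m))
    \<le> C\<^sup>2 * exp (- (1 / 2) * \<bar>of_int (n - m)\<bar>) * (A l * exp (- (1 / 2) * \<bar>of_int (l - m)\<bar>))"
proof -
  have "cmod (of_real (q n l) * a l * of_real (qi l m)) = cmod (a l) * \<bar>q n l * qi l m\<bar>"
    by (simp add: norm_mult abs_mult mult_ac)
  also have "\<dots> \<le> A l * (C\<^sup>2 * exp (- (1 / 2) * \<bar>of_int (n - m)\<bar>) * exp (- (1 / 2) * \<bar>of_int (l - m)\<bar>))"
    using assms order_trans[OF norm_ge_zero assms] by (intro mult_mono kernel_decay) auto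
  finally show ?thesis by (simp add: mult_ac)
qed

text \<open>The bound \<open>A\<close> may depend on l: constants serve the evolution, and the
  indicator of the complement of a finite set serves the truncation error in the completeness
  proof.\<close>

lemma spectral_bound:
  assumes a: "\<And>l. cmod (a l) \<le> A l" and s: "(\<lambda>l. A l * exp (- (1 / 2) * \<bar>of_int (l - m)\<bar>)) summable_on UNIV"
  shows "(\<lambda>l. of_real (q n l) * a l * of_real (qi l m)) summable_on UNIV"
    and "cmod (spectral a m n) \<le> C\<^sup>2 * (\<Sum>\<^sub>\<infinity>l. A l * exp (- (1 / 2) * \<bar>of_int (l - m)\<bar>))
      * exp (- (1 / 2) * \<bar>of_int (n - m)\<bar>)"
proof -
  let ?g = "\<lambda>l. C\<^sup>2 * exp (- (1 / 2) * \<bar>of_int (n - m)\<bar>) * (A l * exp (- (1 / 2) * \<bar>of_int (l - m)\<bar>))"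
  have g: "?g summable_on UNIV" using s by (rule summable_on_cmult_right)
  have abs: "(\<lambda>l. norm (of_real (q n l) * a l * of_real (qi l m))) summable_on UNIV"
    by (rule summable_on_comparison_test[OF g]) (use spectral_term_bound[of a _ A, OF a] in auto)
  then show "(\<lambda>l. of_real (q n l) * a l * of_real (qi l m)) summable_on UNIV"
    by (rule abs_summable_summable)
  have "cmod (spectral a m n) \<le> (\<Sum>\<^sub>\<infinity>l. norm (of_real (q n l) * a l * of_real (qi l m)))"
    unfolding spectral_def by (rule norm_infsum_bound[OF abs])
  also have "\<dots> \<le> infsum ?g UNIV"
    by (intro infsum_mono abs g) (use spectral_term_bound[of a _ A, OF a] in auto)
  also have "\<dots> = C\<^sup>2 * exp (- (1 / 2) * \<bar>of_int (n - m)\<bar>) * (\<Sum>\<^sub>\<infinity>l. A l * exp (- (1 / 2) * \<bar>of_int (l - m)\<bar>))"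
    using s by (intro infsum_cmult_right) auto
  finally show "cmod (spectral a m n) \<le> C\<^sup>2 * (\<Sum>\<^sub>\<infinity>l. A l * exp (- (1 / 2) * \<bar>of_int (l - m)\<bar>))
      * exp (- (1 / 2) * \<bar>of_int (n - m)\<bar>)"
    by (simp add: mult_ac)
qed

lemma spectral_bounded:
  assumes "\<And>l. cmod (a l) \<le> A"
  shows "(\<lambda>l. of_real (q n l) * a l * of_real (qi l m)) summable_on UNIV"
    and "cmod (spectral a m n) \<le> A * C\<^sup>2 * exp_sum (1 / 2) * exp (- (1 / 2) * \<bar>of_int (n - m)\<bar>)"
proof -
  have s: "(\<lambda>l. A * exp (- (1 / 2) * \<bar>of_int (l - m)\<bar>)) summable_on UNIV"
    by (intro summable_on_cmult_right exp_neg_abs_summable) simp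
  show "(\<lambda>l. of_real (q n l) * a l * of_real (qi l m)) summable_on UNIV"
    by (rule spectral_bound(1)[OF assms s])
  have "(\<Sum>\<^sub>\<infinity>l. A * exp (- (1 / 2) * \<bar>of_int (l - m)\<bar>)) = A * exp_sum (1 / 2)"
    by (simp only: infsum_cmult_right' exp_sum_shift)
  then show "cmod (spectral a m n) \<le> A * C\<^sup>2 * exp_sum (1 / 2) * exp (- (1 / 2) * \<bar>of_int (n - m)\<bar>)"
    using spectral_bound(2)[where n = n, OF assms s] by (simp add: mult_ac del: of_int_diff)
qed

lemma spectral_one: "spectral (\<lambda>_. 1) m = delta m"
proof
  fix n
  have "spectral (\<lambda>_. 1) m n = (\<Sum>\<^sub>\<infinity>l. of_real (q n l * qi l m))" by (simp add: spectral_def)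
  also have "\<dots> = of_real (\<Sum>\<^sub>\<infinity>l. q n l * qi l m)"
  proof -
    have "(\<lambda>l. norm (q n l * qi l m)) summable_on UNIV"
    proof (rule summable_on_comparison_test)
      show "(\<lambda>l. C\<^sup>2 * exp (- (1 / 2) * \<bar>of_int (n - m)\<bar>) * exp (- (1 / 2) * \<bar>of_int (l - m)\<bar>)) summable_on UNIV"
        by (intro summable_on_cmult_right exp_neg_abs_summable) simp
    qed (use kernel_decay in auto)
    then have "(\<lambda>l. q n l * qi l m) summable_on UNIV" by (rule abs_summable_summable)
    then show ?thesis by (metis has_sum_infsum has_sum_of_real_iff infsumI)
  qed
  finally show "spectral (\<lambda>_. 1) m n = delta m n" by (simp add: inverse delta_def)
qed

lemma spectral_add:
  assumes "\<And>l. cmod (a l) \<le> A" "\<And>l. cmod (b l) \<le> A'"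
  shows "spectral (\<lambda>l. a l + b l) m n = spectral a m n + spectral b m n"
  unfolding spectral_def
  by (simp only: ring_distribs) (intro infsum_add spectral_bounded(1)[OF assms(1)] spectral_bounded(1)[OF assms(2)])

lemma spectral_scale: "spectral (\<lambda>l. c * a l) m n = c * spectral a m n"
proof -
  have "spectral (\<lambda>l. c * a l) m n = (\<Sum>\<^sub>\<infinity>l. c * (of_real (q n l) * a l * of_real (qi l m)))"
    by (simp add: spectral_def mult_ac)
  then show ?thesis by (simp only: spectral_def infsum_cmult_right')
qed

lemma spectral_sum:
  fixes N :: nat
  assumes "\<And>k l. cmod (a k l) \<le> A k"
  shows "spectral (\<lambda>l. \<Sum>k<N. a k l) m n = (\<Sum>k<N. spectral (a k) m n)"
proof (induction N)
  case (Suc N)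
  have "cmod (\<Sum>k<N. a k l) \<le> (\<Sum>k<N. A k)" for l by (intro sum_norm_le assms)
  from spectral_add[OF this assms] Suc show ?case by simp
qed (simp add: spectral_def)

lemma schrodinger_spectral:
  assumes a: "\<And>l. cmod (a l) \<le> A"
  shows "schrodinger W (spectral a m) = spectral (\<lambda>l. of_real (e l) * a l) m"
proof
  fix n
  let ?t = "\<lambda>n l. complex_of_real (q n l) * a l * of_real (qi l m)"
  note s = spectral_bounded(1)[OF a]
  have "schrodinger W (spectral a m) n
      = (\<Sum>\<^sub>\<infinity>l. ?t (n + 1) l) + (\<Sum>\<^sub>\<infinity>l. ?t (n - 1) l) + (\<Sum>\<^sub>\<infinity>l. of_real (W n) * ?t n l)"
    unfolding schrodinger_def spectral_def by (simp only: infsum_cmult_right')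
  also have "\<dots> = (\<Sum>\<^sub>\<infinity>l. ?t (n + 1) l + ?t (n - 1) l + of_real (W n) * ?t n l)"
    by (simp only: infsum_add s summable_on_add summable_on_cmult_right)
  also have "\<dots> = (\<Sum>\<^sub>\<infinity>l. of_real (q n l) * (of_real (e l) * a l) * of_real (qi l m))"
  proof (rule infsum_cong)
    fix l
    have "?t (n + 1) l + ?t (n - 1) l + of_real (W n) * ?t n l
        = of_real (q (n + 1) l + q (n - 1) l + W n * q n l) * a l * of_real (qi l m)"
      by (simp add: algebra_simps)
    then show "?t (n + 1) l + ?t (n - 1) l + of_real (W n) * ?t n l
        = of_real (q n l) * (of_real (e l) * a l) * of_real (qi l m)"
      unfolding eigen by (simp add: mult_ac)
  qed
  finally show "schrodinger W (spectral a m) n = spectral (\<lambda>l. of_real (e l) * a l) m n"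
    by (simp only: spectral_def)
qed

text \<open>Powers of the operator act on \<open>spectral\<close> vectors through powers of the
  eigenvalues, so the exponential series becomes scalar. Since the eigenvalues are bounded, its
  remainder is small uniformly in l, and the exponential decay turns this into convergence in
  \<open>l2\<close>.\<close>

lemma evolution_delta:
  "evolution (schrodinger W) t (delta m) = spectral (\<lambda>l. exp (- \<i> * of_real (t * e l))) m"
proof -
  let ?A = "\<lambda>\<psi> n. - \<i> * complex_of_real t * schrodinger W \<psi> n"
  define z where "z l = - \<i> * complex_of_real (t * e l)" for l
  define R where "R = \<bar>t\<bar> * B"
  have z: "cmod (z l) \<le> R" for l
    using e_bounded[of l] by (simp add: z_def R_def norm_mult abs_mult mult_left_mono)
  have zk: "cmod (z l ^ k) \<le> R ^ k" for l k unfolding norm_power by (intro power_mono z) simp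
  have pow: "(?A ^^ k) (delta m) = spectral (\<lambda>l. z l ^ k) m" for k
  proof (induction k)
    case (Suc k)
    have "(?A ^^ Suc k) (delta m) = (\<lambda>n. - \<i> * complex_of_real t * spectral (\<lambda>l. of_real (e l) * z l ^ k) m n)"
      using Suc by (simp add: schrodinger_spectral[OF zk])
    also have "\<dots> = spectral (\<lambda>l. z l ^ Suc k) m"
      by (rule ext, subst spectral_scale[symmetric]) (simp add: z_def mult_ac)
    finally show ?case .
  qed (simp add: spectral_one)
  have zf: "cmod (z l ^ k / fact k) \<le> R ^ k / fact k" for l k
    using zk[of l k] by (simp add: norm_divide divide_right_mono)
  have partial: "(?A ^^ k) (delta m) n / fact k = spectral (\<lambda>l. z l ^ k / fact k) m n" for k n
    unfolding pow using spectral_scale[of "inverse (fact k)" "\<lambda>l. z l ^ k" m n]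
    by (simp add: divide_inverse mult.commute)
  have ze: "cmod (exp (z l)) \<le> 1" for l by (simp add: z_def)
  have l2: "spectral a m \<in> l2" "l2_norm (spectral a m) \<le> A * C\<^sup>2 * exp_sum (1 / 2) * sqrt (exp_sum (2 * (1 / 2)))"
    if "\<And>l. cmod (a l) \<le> A" for a A
    using l2_exp_decay[OF _ spectral_bounded(2)[OF that]] by auto
  define r where "r N = exp R - (\<Sum>k<N. R ^ k / fact k)" for N
  have diff: "(\<lambda>n. (\<Sum>k<N. (?A ^^ k) (delta m) n / fact k) - spectral (\<lambda>l. exp (z l)) m n)
      = spectral (\<lambda>l. (\<Sum>k<N. z l ^ k / fact k) - exp (z l)) m" for N
  proof
    fix n
    have "cmod (\<Sum>k<N. z l ^ k / fact k) \<le> (\<Sum>k<N. R ^ k / fact k)" for l by (intro sum_norm_le zf)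
    moreover have "cmod (- 1 * exp (z l)) \<le> 1" for l using ze by (simp add: norm_mult)
    ultimately have "spectral (\<lambda>l. (\<Sum>k<N. z l ^ k / fact k) + - 1 * exp (z l)) m n
      = spectral (\<lambda>l. \<Sum>k<N. z l ^ k / fact k) m n + spectral (\<lambda>l. - 1 * exp (z l)) m n"
      by (rule spectral_add)
    also have "spectral (\<lambda>l. \<Sum>k<N. z l ^ k / fact k) m n = (\<Sum>k<N. spectral (\<lambda>l. z l ^ k / fact k) m n)"
      by (rule spectral_sum[OF zf])
    finally show "(\<Sum>k<N. (?A ^^ k) (delta m) n / fact k) - spectral (\<lambda>l. exp (z l)) m n
      = spectral (\<lambda>l. (\<Sum>k<N. z l ^ k / fact k) - exp (z l)) m n"
      unfolding partial spectral_scale by simp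
  qed
  have "l2_sums (\<lambda>k n. (?A ^^ k) (delta m) n / fact k) (spectral (\<lambda>l. exp (z l)) m)"
    unfolding l2_sums_def
  proof (intro conjI allI)
    show "(\<lambda>n. (?A ^^ k) (delta m) n / fact k) \<in> l2" for k
      unfolding partial using l2(1)[OF zf] by simp
    show "spectral (\<lambda>l. exp (z l)) m \<in> l2" by (rule l2(1)[OF ze])
    show "(\<lambda>N. l2_norm (\<lambda>n. (\<Sum>k<N. (?A ^^ k) (delta m) n / fact k) - spectral (\<lambda>l. exp (z l)) m n)) \<longlonglongrightarrow> 0"
    proof (rule Lim_null_comparison)
      show "\<forall>\<^sub>F N in sequentially. norm (l2_norm (\<lambda>n. (\<Sum>k<N. (?A ^^ k) (delta m) n / fact k)
          - spectral (\<lambda>l. exp (z l)) m n)) \<le> r N * C\<^sup>2 * exp_sum (1 / 2) * sqrt (exp_sum (2 * (1 / 2)))"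
        unfolding diff r_def using l2(2)[OF exp_remainder_bound[OF z]] l2_norm_nonneg
        by (intro always_eventually) simp
      have "(\<lambda>N. r N * C\<^sup>2 * exp_sum (1 / 2) * sqrt (exp_sum (2 * (1 / 2))))
          \<longlonglongrightarrow> 0 * C\<^sup>2 * exp_sum (1 / 2) * sqrt (exp_sum (2 * (1 / 2)))"
        unfolding r_def by (intro tendsto_intros exp_remainder_tendsto)
      then show "(\<lambda>N. r N * C\<^sup>2 * exp_sum (1 / 2) * sqrt (exp_sum (2 * (1 / 2)))) \<longlonglongrightarrow> 0" by simp
    qed
  qed
  then show ?thesis unfolding evolution_def z_def by (rule op_exp_eqI)
qed

text \<open>Real eigenvalues give multipliers of modulus 1, so the bound does not involve t.\<close>

lemma evolution_decay:
  "cmod (l2_inner (delta n) (evolution (schrodinger W) t (delta m)))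
    \<le> C\<^sup>2 * exp_sum (1 / 2) * exp (- (1 / 2) * \<bar>of_int (n - m)\<bar>)"
  using spectral_bounded(2)[of "\<lambda>l. exp (- \<i> * of_real (t * e l))" 1 m n]
  by (simp add: l2_inner_delta evolution_delta del: of_int_diff)

section \<open>Completeness of the eigenfunctions\<close>

definition column :: "int \<Rightarrow> int \<Rightarrow> complex" where
  "column l n = of_real (q n l)"

lemma column_decay: "cmod (column l n) \<le> C * exp (- 1 * \<bar>of_int (n - l)\<bar>)"
  using q_decay[of n l] by (simp add: column_def)

lemma column_l2: "column l \<in> l2"
  by (rule l2_exp_decay(1)[OF _ column_decay]) simp

lemma eigenfunction_column: "eigenfunction (schrodinger W) (column l)"
  unfolding eigenfunction_def
proof (intro conjI)
  show "column l \<in> l2" by (rule column_l2)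
  show "column l \<noteq> (\<lambda>n. 0)" using nonzero[of l] by (auto simp: column_def fun_eq_iff)
  have "schrodinger W (column l) = (\<lambda>n. of_real (e l) * column l n)"
  proof
    fix n
    have "schrodinger W (column l) n = of_real (q (n + 1) l + q (n - 1) l + W n * q n l)"
      by (simp add: schrodinger_def column_def)
    then show "schrodinger W (column l) n = of_real (e l) * column l n"
      unfolding eigen by (simp add: column_def)
  qed
  then show "\<exists>E. schrodinger W (column l) = (\<lambda>n. E * column l n)" by blast
qed

text \<open>Completeness is phrased with sums over a set of functions, so the coefficients of
  indices with the same column are collected first.\<close>

lemma column_combination:
  assumes "finite G"
  shows "\<exists>F a. finite F \<and> F \<subseteq> range column \<and> (\<forall>n. (\<Sum>l\<in>G. c l * column l n) = (\<Sum>u\<in>F. a u * u n))"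
proof (intro exI conjI allI)
  show "finite (column ` G)" "column ` G \<subseteq> range column" using assms by auto
  fix n
  have "(\<Sum>l\<in>G. c l * column l n) = (\<Sum>u\<in>column ` G. \<Sum>l\<in>{l \<in> G. column l = u}. c l * column l n)"
    by (rule sum.image_gen[OF assms])
  also have "\<dots> = (\<Sum>u\<in>column ` G. (\<Sum>l\<in>{l \<in> G. column l = u}. c l) * u n)"
    unfolding sum_distrib_right by (intro sum.cong) auto
  finally show "(\<Sum>l\<in>G. c l * column l n) = (\<Sum>u\<in>column ` G. (\<Sum>l\<in>{l \<in> G. column l = u}. c l) * u n)" .
qed

text \<open>Truncating the expansion of \<open>delta m\<close> leaves \<open>spectral\<close> of an
  indicator, controlled by the tail of a summable exponential. Allowing every larger
  \<open>H\<close> lets one set serve finitely many m.\<close>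

lemma delta_approximation:
  assumes "0 < \<epsilon>"
  shows "\<exists>G. finite G \<and> (\<forall>H. finite H \<longrightarrow> G \<subseteq> H \<longrightarrow>
    (\<lambda>n. delta m n - (\<Sum>l\<in>H. of_real (qi l m) * column l n)) \<in> l2 \<and>
    l2_norm (\<lambda>n. delta m n - (\<Sum>l\<in>H. of_real (qi l m) * column l n)) \<le> \<epsilon>)"
proof -
  let ?w = "\<lambda>l. exp (- (1 / 2) * \<bar>of_int (l - m)\<bar>) :: real"
  have s: "?w summable_on UNIV" by (intro exp_neg_abs_summable) simp
  define K where "K = C\<^sup>2 * sqrt (exp_sum (2 * (1 / 2)))"
  have K: "0 \<le> K" by (simp add: K_def exp_sum_nonneg)
  obtain G where G: "finite G" "\<And>H. finite H \<Longrightarrow> G \<subseteq> H \<Longrightarrow> \<bar>infsum ?w (- H)\<bar> < \<epsilon> / (K + 1)"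
    using infsum_diff_tendsto_0[OF s, of "\<epsilon> / (K + 1)"] assms K by auto
  have "(\<lambda>n. delta m n - (\<Sum>l\<in>H. of_real (qi l m) * column l n)) \<in> l2 \<and>
    l2_norm (\<lambda>n. delta m n - (\<Sum>l\<in>H. of_real (qi l m) * column l n)) \<le> \<epsilon>" if H: "finite H" "G \<subseteq> H" for H
  proof -
    have eq: "delta m n - (\<Sum>l\<in>H. of_real (qi l m) * column l n) = spectral (\<lambda>l. if l \<in> H then 0 else 1) m n" for n
    proof -
      have "spectral (\<lambda>l. (if l \<in> H then 0 else 1) + (if l \<in> H then 1 else 0)) m n
          = spectral (\<lambda>l. if l \<in> H then 0 else 1) m n + spectral (\<lambda>l. if l \<in> H then 1 else 0) m n"
        by (rule spectral_add[where A = 1 and A' = 1]) auto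
      moreover have "(\<lambda>l. (if l \<in> H then 0 else 1) + (if l \<in> H then 1 else 0)) = (\<lambda>_. 1 :: complex)" by auto
      moreover have "spectral (\<lambda>l. if l \<in> H then 1 else 0) m n = (\<Sum>\<^sub>\<infinity>l\<in>H. of_real (q n l) * of_real (qi l m))"
        unfolding spectral_def by (rule infsum_cong_neutral) auto
      ultimately show ?thesis
        using H(1) by (simp add: spectral_one column_def mult.commute)
    qed
    let ?A = "\<lambda>l. if l \<in> H then 0 else 1 :: real"
    have sA: "(\<lambda>l. ?A l * ?w l) summable_on UNIV"
      by (rule summable_on_comparison_test[OF s]) auto
    have "(\<Sum>\<^sub>\<infinity>l. ?A l * ?w l) = infsum ?w (- H)" by (rule infsum_cong_neutral) auto
    with G(2)[OF H] have tail: "(\<Sum>\<^sub>\<infinity>l. ?A l * ?w l) \<le> \<epsilon> / (K + 1)" by linarith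
    define I where "I = (\<Sum>\<^sub>\<infinity>l. ?A l * ?w l)"
    have "cmod (spectral (\<lambda>l. if l \<in> H then 0 else 1) m n) \<le> C\<^sup>2 * I * exp (- (1 / 2) * \<bar>of_int (n - m)\<bar>)" for n
      unfolding I_def by (rule spectral_bound(2)[OF _ sA]) auto
    note l2_exp_decay[OF _ this]
    moreover have "C\<^sup>2 * I * sqrt (exp_sum (2 * (1 / 2))) \<le> \<epsilon>"
    proof -
      have "C\<^sup>2 * I * sqrt (exp_sum (2 * (1 / 2))) = K * I" by (simp add: K_def mult_ac)
      also have "\<dots> \<le> K * (\<epsilon> / (K + 1))" using tail K unfolding I_def by (rule mult_left_mono)
      also have "\<dots> \<le> \<epsilon>" using K assms by (simp add: field_simps)
      finally show ?thesis .
    qed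
    ultimately have "spectral (\<lambda>l. if l \<in> H then 0 else 1) m \<in> l2 \<and>
      l2_norm (spectral (\<lambda>l. if l \<in> H then 0 else 1) m) \<le> \<epsilon>"
      by (meson half_gt_zero order_trans zero_less_one)
    then show ?thesis unfolding eq .
  qed
  with G(1) show ?thesis by blast
qed

lemma complete_columns: "complete_in_l2 (range column)"
  unfolding complete_in_l2_def
proof (intro ballI allI impI)
  fix \<psi> :: "int \<Rightarrow> complex" and \<epsilon> :: real
  assume \<psi>: "\<psi> \<in> l2" and \<epsilon>: "0 < \<epsilon>"
  have s: "(\<lambda>n. (cmod (\<psi> n))\<^sup>2) summable_on UNIV" using \<psi> by (simp add: l2_def)
  obtain F where F: "finite F" "\<bar>infsum (\<lambda>n. (cmod (\<psi> n))\<^sup>2) (- F)\<bar> < (\<epsilon> / 2)\<^sup>2"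
    using infsum_diff_tendsto_0[OF s, of "(\<epsilon> / 2)\<^sup>2"] \<epsilon> by auto
  define \<psi>1 where "\<psi>1 n = (if n \<in> F then 0 else \<psi> n)" for n
  have \<psi>1_sum: "(\<Sum>\<^sub>\<infinity>n. (cmod (\<psi>1 n))\<^sup>2) = infsum (\<lambda>n. (cmod (\<psi> n))\<^sup>2) (- F)"
    by (rule infsum_cong_neutral) (auto simp: \<psi>1_def)
  have \<psi>1: "\<psi>1 \<in> l2"
    unfolding l2_def mem_Collect_eq by (rule summable_on_comparison_test[OF s]) (auto simp: \<psi>1_def)
  have n\<psi>1: "l2_norm \<psi>1 < \<epsilon> / 2"
    unfolding l2_norm_def \<psi>1_sum using F(2) \<epsilon> by (intro real_less_lsqrt) auto
  define S where "S = (\<Sum>m\<in>F. cmod (\<psi> m))"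
  have S: "0 \<le> S" by (simp add: S_def sum_nonneg)
  \<comment> \<open>Error allowed for each \<open>delta m\<close>: weighted by the entries of \<psi>
    on \<open>F\<close>, the total is at most \<epsilon> / 2. Adding 1 covers the case that \<psi>
    vanishes on \<open>F\<close>.\<close>
  define \<tau> where "\<tau> = \<epsilon> / (2 * (S + 1))"
  have \<tau>: "0 < \<tau>" using \<epsilon> S by (simp add: \<tau>_def)
  define good where "good m G \<longleftrightarrow> finite G \<and> (\<forall>H. finite H \<longrightarrow> G \<subseteq> H \<longrightarrow>
      (\<lambda>n. delta m n - (\<Sum>l\<in>H. of_real (qi l m) * column l n)) \<in> l2 \<and>
      l2_norm (\<lambda>n. delta m n - (\<Sum>l\<in>H. of_real (qi l m) * column l n)) \<le> \<tau>)" for m G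
  have "\<forall>m. \<exists>G. good m G" unfolding good_def by (intro allI delta_approximation[OF \<tau>])
  then obtain G where "\<forall>m. good m (G m)" by (rule choice[THEN exE])
  then have G: "\<And>m. finite (G m)" "\<And>m H. finite H \<Longrightarrow> G m \<subseteq> H \<Longrightarrow>
      (\<lambda>n. delta m n - (\<Sum>l\<in>H. of_real (qi l m) * column l n)) \<in> l2 \<and>
      l2_norm (\<lambda>n. delta m n - (\<Sum>l\<in>H. of_real (qi l m) * column l n)) \<le> \<tau>"
    unfolding good_def by blast+
  define H where "H = (\<Union>m\<in>F. G m)"
  have H: "finite H" "\<And>m. m \<in> F \<Longrightarrow> G m \<subseteq> H" using F(1) G(1) by (auto simp: H_def)
  define err where "err m n = delta m n - (\<Sum>l\<in>H. of_real (qi l m) * column l n)" for m n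
  have err: "err m \<in> l2" "l2_norm (err m) \<le> \<tau>" if "m \<in> F" for m
    using G(2)[OF H(1) H(2)[OF that]] by (auto simp: err_def[abs_def])
  define c where "c l = (\<Sum>m\<in>F. \<psi> m * of_real (qi l m))" for l
  obtain U a where U: "finite U" "U \<subseteq> range column"
    "\<And>n. (\<Sum>l\<in>H. c l * column l n) = (\<Sum>u\<in>U. a u * u n)"
    using column_combination[OF H(1), of c] by blast
  have split: "\<psi> n - (\<Sum>u\<in>U. a u * u n) = \<psi>1 n + (\<Sum>m\<in>F. \<psi> m * err m n)" for n
  proof -
    have "(\<Sum>m\<in>F. \<psi> m * delta m n) = \<psi> n - \<psi>1 n"
      using F(1) by (simp add: delta_def \<psi>1_def if_distrib[of "\<lambda>x. _ * x"] cong: if_cong)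
    moreover have "(\<Sum>m\<in>F. \<psi> m * (\<Sum>l\<in>H. of_real (qi l m) * column l n)) = (\<Sum>l\<in>H. c l * column l n)"
      unfolding c_def sum_distrib_left sum_distrib_right by (subst sum.swap) (simp add: mult_ac)
    ultimately show ?thesis
      by (simp add: U(3)[symmetric] err_def right_diff_distrib sum_subtractf)
  qed
  have "l2_norm (\<lambda>n. \<Sum>m\<in>F. \<psi> m * err m n) \<le> (\<Sum>m\<in>F. l2_norm (\<lambda>n. \<psi> m * err m n))"
    by (intro l2_sum(2) l2_scale(1) err)
  also have "\<dots> \<le> (\<Sum>m\<in>F. cmod (\<psi> m) * \<tau>)"
    by (intro sum_mono order_trans[OF l2_scale(2)] err mult_left_mono) auto
  also have "\<dots> = S * \<tau>" by (simp add: S_def sum_distrib_right)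
  also have "\<dots> \<le> \<epsilon> / 2" using S \<epsilon> by (simp add: \<tau>_def field_simps)
  finally have small: "l2_norm (\<lambda>n. \<Sum>m\<in>F. \<psi> m * err m n) \<le> \<epsilon> / 2" .
  have "l2_norm (\<lambda>n. \<psi> n - (\<Sum>u\<in>U. a u * u n)) \<le> l2_norm \<psi>1 + l2_norm (\<lambda>n. \<Sum>m\<in>F. \<psi> m * err m n)"
    unfolding split by (intro l2_add(2) \<psi>1 l2_sum(1) l2_scale(1) err)
  with small n\<psi>1 have "l2_norm (\<lambda>n. \<psi> n - (\<Sum>u\<in>U. a u * u n)) < \<epsilon>" by linarith
  with U(1,2) show "\<exists>F a. finite F \<and> F \<subseteq> range column \<and> l2_norm (\<lambda>n. \<psi> n - (\<Sum>u\<in>F. a u * u n)) < \<epsilon>"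
    by blast
qed

lemma ULE_schrodinger: "ULE 1 C (schrodinger W)"
  unfolding ULE_def
proof (intro conjI exI[of _ "range column"])
  show "uniformly_localized 1 C (range column)"
    unfolding uniformly_localized_def
  proof
    fix u assume "u \<in> range column"
    then obtain l where "u = column l" by blast
    then show "\<exists>m. \<forall>n. cmod (u n) \<le> C * exp (- 1 * real_of_int \<bar>n - m\<bar>)"
      using column_decay[of l] by (intro exI[of _ l]) simp
  qed
qed (use eigenfunction_column complete_columns in auto)

end


section \<open>Coordinates on the group\<close>

text \<open>Dividing by \<epsilon> restores the coupling 1, at the price of the large potential V /
  \<epsilon>. The constant 9/8 is 1 + 1/8; closeness of \<open>Q\<close> to the identity also keeps
  its diagonal away from 0, so no column vanishes.\<close>

lemma localized_basis_of_kernels: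
  assumes \<epsilon>: "0 < \<epsilon>" and V: "diagonal V" and D: "diagonal D"
    and eq: "(V + \<epsilon> *\<^sub>R laplacian) * Q = Q * D" and inv: "Q * Qi = 1"
    and wQ: "weight_bound 1 (1 / 8) (Q - 1)" and wQi: "weight_bound 1 (1 / 8) (Qi - 1)"
  shows "localized_basis (ent Q) (ent Qi) (\<lambda>n. ent V n n / \<epsilon>) (\<lambda>l. ent D l l / \<epsilon>) (9 / 8) (norm D / \<epsilon>)"
proof
  have decay: "\<bar>ent A n l\<bar> \<le> 9 / 8 * exp (- \<bar>of_int (n - l)\<bar>)" if "weight_bound 1 (1 / 8) (A - 1)" for A n l
  proof -
    have "weight_bound 1 (9 / 8) A"
      using weight_bound_add[OF that weight_bound_one] by simp
    from col_bound_entry[OF this, of n l] show ?thesis by (simp add: exp_minus field_simps)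
  qed
  show "\<bar>ent Q n l\<bar> \<le> 9 / 8 * exp (- \<bar>of_int (n - l)\<bar>)" for n l by (rule decay[OF wQ])
  show "\<bar>ent Qi l m\<bar> \<le> 9 / 8 * exp (- \<bar>of_int (l - m)\<bar>)" for l m by (rule decay[OF wQi])
  show "ent Q (n + 1) l + ent Q (n - 1) l + ent V n n / \<epsilon> * ent Q n l = ent D l l / \<epsilon> * ent Q n l" for n l
  proof -
    have "ent ((V + \<epsilon> *\<^sub>R laplacian) * Q) n l = ent (Q * D) n l" by (simp only: eq)
    then have "ent V n n * ent Q n l + \<epsilon> * (ent Q (n - 1) l + ent Q (n + 1) l) = ent Q n l * ent D l l"
      by (simp add: ring_distribs ent_diagonal_mult_left[OF V] ent_diagonal_mult_right[OF D] ent_laplacian_mult)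
    then show ?thesis using \<epsilon> by (simp add: field_simps)
  qed
  show "(\<Sum>\<^sub>\<infinity>l. ent Q n l * ent Qi l m) = (if n = m then 1 else 0)" for n m
    using inv by (simp add: ent_mult[symmetric])
  show "ent Q l l \<noteq> 0" for l
  proof -
    have "\<bar>ent (Q - 1) l l\<bar> \<le> 1 / 8" using col_bound_entry[OF wQ, of l l] by simp
    then show ?thesis by auto
  qed
  show "\<bar>ent D l l / \<epsilon>\<bar> \<le> norm D / \<epsilon>" for l
    using ent_abs_le_norm[of D l l] \<epsilon> by (simp add: abs_divide divide_right_mono)
qed

text \<open>Isolates what the group contributes: compatible, additive, locally constant residues,
  and an element with all residues 1 for the density argument.\<close>

lemma condition_A_coordinates:
  assumes A: "condition_A G X" and X: "topspace X = carrier G"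
  shows "\<exists>(n :: nat \<Rightarrow> nat) (c :: nat \<Rightarrow> 'a \<Rightarrow> int).
    2 \<le> n 0 \<and> (\<forall>k. n k dvd n (Suc k)) \<and> (\<forall>k. n k < n (Suc k)) \<and> (\<exists>m. \<forall>k. n (Suc k) \<le> n k ^ m) \<and>
    (\<forall>k. \<forall>x\<in>carrier G. 0 \<le> c k x \<and> c k x < int (n k) \<and> c (Suc k) x mod int (n k) = c k x) \<and>
    (\<forall>k. \<forall>x\<in>carrier G. \<forall>y\<in>carrier G. c k (x \<otimes>\<^bsub>G\<^esub> y) = (c k x + c k y) mod int (n k)) \<and>
    (\<exists>x\<in>carrier G. \<forall>k. c k x = 1) \<and>
    (\<forall>k i. openin X {x \<in> carrier G. c k x = i})"
proof -
  obtain n :: "nat \<Rightarrow> nat" and m where n: "2 \<le> n 0" "strict_mono n" "\<And>k. n k dvd n (Suc k)"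
    "\<And>k. n k < n (Suc k) \<and> n (Suc k) \<le> n k ^ m"
    and iso: "topological_group_isomorphic G X
      (inverse_limit UNIV (\<le>) (\<lambda>k. integer_mod_group (n k)) (\<lambda>k l x. x mod int (n k)))
      (inverse_limit_topology UNIV (\<le>) (\<lambda>k. integer_mod_group (n k)) (\<lambda>k l x. x mod int (n k)))"
    using A unfolding condition_A_def Let_def by blast
  define D where "D k = integer_mod_group (n k)" for k
  define L where "L = inverse_limit UNIV (\<le>) D (\<lambda>k l x. x mod int (n k))"
  define Y where "Y = inverse_limit_topology UNIV (\<le>) D (\<lambda>k l x. x mod int (n k))"
  obtain \<phi> where \<phi>: "\<phi> \<in> iso G L" "homeomorphic_map X Y \<phi>"
    using iso unfolding topological_group_isomorphic_def L_def Y_def D_def by blast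
  have n2: "2 \<le> n k" for k
    using n(1) strict_mono_less_eq[OF n(2), of 0 k] by simp
  have carD: "carrier (D k) = {0..<int (n k)}" for k
    using n2[of k] by (simp add: D_def carrier_integer_mod_group)
  have carL: "carrier L = {x. (\<forall>k. 0 \<le> x k \<and> x k < int (n k)) \<and> (\<forall>i j. i \<le> j \<longrightarrow> x j mod int (n i) = x i)}"
    by (auto simp: L_def inverse_limit_def carD PiE_iff)
  have multL: "(x \<otimes>\<^bsub>L\<^esub> y) k = (x k + y k) mod int (n k)" for x y k
    by (simp add: L_def inverse_limit_def D_def)
  define c where "c k x = \<phi> x k" for k x
  have bij: "bij_betw \<phi> (carrier G) (carrier L)" using \<phi>(1) by (simp add: iso_def)
  have \<phi>L: "\<phi> x \<in> carrier L" if "x \<in> carrier G" for x using bij that by (auto simp: bij_betw_def)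
  have hom: "\<phi> (x \<otimes>\<^bsub>G\<^esub> y) = \<phi> x \<otimes>\<^bsub>L\<^esub> \<phi> y" if "x \<in> carrier G" "y \<in> carrier G" for x y
    using \<phi>(1) that by (simp add: iso_def hom_mult)
  have "\<exists>x\<in>carrier G. \<forall>k. c k x = 1"
  proof -
    have one: "1 mod int (n k) = 1" for k using n2[of k] by (intro mod_pos_pos_trivial) auto
    have lt: "1 < int (n k)" for k using n2[of k] by simp
    have "(\<lambda>_. 1) \<in> carrier L" unfolding carL using one lt by simp
    then obtain x where "x \<in> carrier G" "\<phi> x = (\<lambda>_. 1)"
      using bij unfolding bij_betw_def by (metis imageE)
    then show ?thesis by (intro bexI[of _ x]) (simp_all add: c_def)
  qed
  moreover have "openin X {x \<in> carrier G. c k x = i}" for k i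
  proof -
    have "continuous_map X Y \<phi>" using \<phi>(2) by (rule homeomorphic_imp_continuous_map)
    then have "continuous_map X (product_topology (\<lambda>k. discrete_topology (carrier (D k))) UNIV) \<phi>"
      unfolding Y_def inverse_limit_topology_def by (rule continuous_map_into_fulltopology)
    then have ck: "continuous_map X (discrete_topology (carrier (D k))) (c k)"
      unfolding c_def using continuous_map_componentwise_UNIV by fastforce
    have "openin X {x \<in> topspace X. c k x \<in> {i} \<inter> carrier (D k)}"
      by (rule openin_continuous_map_preimage[OF ck]) simp
    moreover have "{x \<in> topspace X. c k x \<in> {i} \<inter> carrier (D k)} = {x \<in> carrier G. c k x = i}"
      using \<phi>L unfolding X carL carD c_def by auto
    ultimately show ?thesis by simp
  qed
  moreover have "0 \<le> c k x \<and> c k x < int (n k) \<and> c (Suc k) x mod int (n k) = c k x" if "x \<in> carrier G" for k x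
    using \<phi>L[OF that] by (auto simp: carL c_def)
  moreover have "c k (x \<otimes>\<^bsub>G\<^esub> y) = (c k x + c k y) mod int (n k)" if "x \<in> carrier G" "y \<in> carrier G" for k x y
    by (simp add: c_def hom[OF that] multL)
  ultimately show ?thesis
    by (intro exI[of _ n] exI[of _ c] conjI allI ballI n(1,3) n(4)[THEN conjunct1]
        exI[of _ m] n(4)[THEN conjunct2]) simp_all
qed

text \<open>A congruence, because j times the residue of \<open>a\<close> is not reduced. For
  negative j, translation by the inverse of \<open>a\<close> shows that \<open>T\<close> is onto, so
  \<open>inv_into\<close> yields genuine preimages.\<close>

lemma coordinate_iterate:
  assumes G: "group G" and a: "a \<in> carrier G" and T: "\<And>x. x \<in> carrier G \<Longrightarrow> T x = x \<otimes>\<^bsub>G\<^esub> a"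
    and c: "\<And>x y. x \<in> carrier G \<Longrightarrow> y \<in> carrier G \<Longrightarrow> c (x \<otimes>\<^bsub>G\<^esub> y) = (c x + c y) mod (N :: int)"
    and x: "x \<in> carrier G"
  shows "iterate_int (carrier G) T j x \<in> carrier G \<and>
    N dvd c (iterate_int (carrier G) T j x) - (c x + j * c a)"
proof -
  interpret G: group G by (rule G)
  have Tc: "T y \<in> carrier G" "N dvd c (T y) - (c y + c a)" if "y \<in> carrier G" for y
    using that a by (auto simp: T c mod_eq_dvd_iff[symmetric])
  define S where "S = inv_into (carrier G) T"
  have Sc: "S y \<in> carrier G" "N dvd c (S y) - (c y - c a)" if y: "y \<in> carrier G" for y
  proof -
    have "T (y \<otimes>\<^bsub>G\<^esub> inv\<^bsub>G\<^esub> a) = y" using y a by (simp add: T G.m_assoc)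
    then have "y \<in> T ` carrier G" using y a by (metis G.inv_closed G.m_closed imageI)
    then have S: "S y \<in> carrier G" "T (S y) = y" by (auto simp: S_def inv_into_into f_inv_into_f)
    then show "S y \<in> carrier G" by simp
    have "N dvd - (c (T (S y)) - (c (S y) + c a))" using Tc(2)[OF S(1)] by (simp only: dvd_minus_iff)
    then show "N dvd c (S y) - (c y - c a)" by (simp add: S(2) algebra_simps)
  qed
  have pow: "(f ^^ i) x \<in> carrier G \<and> N dvd c ((f ^^ i) x) - (c x + int i * d)"
    if f: "\<And>y. y \<in> carrier G \<Longrightarrow> f y \<in> carrier G" "\<And>y. y \<in> carrier G \<Longrightarrow> N dvd c (f y) - (c y + d)" for f d i
  proof (induction i)
    case (Suc i)
    let ?y = "(f ^^ i) x"
    have "N dvd (c (f ?y) - (c ?y + d)) + (c ?y - (c x + int i * d))"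
      using Suc f by (intro dvd_add) auto
    then show ?case using Suc f(1) by (simp add: algebra_simps)
  qed (use x in auto)
  have Sd: "N dvd c (S y) - (c y + - c a)" if "y \<in> carrier G" for y using Sc(2)[OF that] by simp
  show ?thesis
  proof (cases "j \<ge> 0")
    case True
    then show ?thesis using pow[of T "c a" "nat j"] Tc by (simp add: iterate_int_def)
  next
    case False
    then show ?thesis
      using pow[of S "- c a" "nat (- j)"] Sc(1) Sd by (simp add: iterate_int_def S_def[symmetric])
  qed
qed

theorem theorem2p38:
  fixes Omega :: "('a, 'b) monoid_scheme" and X :: "'a topology" and T :: "'a \<Rightarrow> 'a"
  assumes "procyclic_group Omega X"
    and "condition_A Omega X"
    and "translation_on Omega T"
    and "minimal_on X T"
  shows "\<exists>f :: 'a \<Rightarrow> real. continuous_map X euclideanreal f \<and>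
    (let H = (\<lambda>\<omega>. schrodinger (\<lambda>n. f (iterate_int (carrier Omega) T n \<omega>))) in
      (\<exists>r c. \<forall>\<omega>\<in>carrier Omega. ULE r c (H \<omega>)) \<and>
      (\<exists>C r' :: real. 0 < C \<and> 0 < r' \<and>
        (\<forall>\<omega>\<in>carrier Omega. \<forall>m n :: int.
          (SUP t :: real. ereal (cmod (l2_inner (delta n) (evolution (H \<omega>) t (delta m)))))
            \<le> ereal (C * exp (- r' * real_of_int \<bar>n - m\<bar>)))))"
proof -
  let ?S = "carrier Omega"
  have G: "group Omega" and X: "topspace X = ?S"
    using assms(1) by (auto simp: procyclic_group_def topological_group_def)
  interpret G: group Omega by (rule G)
  obtain n :: "nat \<Rightarrow> nat" and c :: "nat \<Rightarrow> 'a \<Rightarrow> int" and d :: nat where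
    n: "2 \<le> n 0" "\<And>k. n k dvd n (Suc k)" "\<And>k. n k < n (Suc k)" "\<And>k. n (Suc k) \<le> n k ^ d"
    and c_range: "\<And>k x. x \<in> ?S \<Longrightarrow> 0 \<le> c k x" "\<And>k x. x \<in> ?S \<Longrightarrow> c k x < int (n k)"
    and c_red: "\<And>k x. x \<in> ?S \<Longrightarrow> c (Suc k) x mod int (n k) = c k x"
    and c_mult: "\<And>k x y. x \<in> ?S \<Longrightarrow> y \<in> ?S \<Longrightarrow> c k (x \<otimes>\<^bsub>Omega\<^esub> y) = (c k x + c k y) mod int (n k)"
    and c_one: "\<exists>x\<in>?S. \<forall>k. c k x = 1" and c_open: "\<And>k i. openin X {x \<in> ?S. c k x = i}"
    using condition_A_coordinates[OF assms(2) X]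
  proof (elim exE conjE, goal_cases)
    case (1 n c d)
    then show ?case by (intro that[of n d c]) simp_all
  qed
  obtain a where a: "a \<in> ?S" and T: "\<And>x. x \<in> ?S \<Longrightarrow> T x = x \<otimes>\<^bsub>Omega\<^esub> a"
    using assms(3) by (auto simp: translation_on_def)
  have it: "iterate_int ?S T j x \<in> ?S \<and> int (n k) dvd c k (iterate_int ?S T j x) - (c k x + j * c k a)"
    if "x \<in> ?S" for x j k
    by (rule coordinate_iterate[OF G a T c_mult that])
  have n0: "0 < n k" for k using n(1) n(3) by (cases k) (auto intro: le_less_trans)

  \<comment> \<open>Minimality makes the residue of \<open>a\<close> a unit: the orbit of the
    neutral element meets the open set of elements with residue 1, and the time j at which it does
    is the inverse.\<close>
  have "\<exists>b. int (n k) dvd b * c k a - 1" for k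
  proof -
    obtain x where x: "x \<in> ?S" "c k x = 1" using c_one by blast
    have one: "\<one>\<^bsub>Omega\<^esub> \<in> ?S" by simp
    have cl: "x \<in> X closure_of (range (\<lambda>j. iterate_int (topspace X) T j \<one>\<^bsub>Omega\<^esub>))"
      using assms(4) x(1) one unfolding minimal_on_def X by (simp only:)
    obtain j where j: "c k (iterate_int ?S T j \<one>\<^bsub>Omega\<^esub>) = 1"
    proof -
      define U where "U = {y \<in> ?S. c k y = 1}"
      define Orb where "Orb = range (\<lambda>j. iterate_int ?S T j \<one>\<^bsub>Omega\<^esub>)"
      have "openin X U" "x \<in> U" "x \<in> X closure_of Orb"
        using c_open x cl by (simp_all add: U_def Orb_def X)
      then have "U \<inter> Orb \<noteq> {}" using openin_Int_closure_of_eq_empty by blast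
      then obtain y where "y \<in> U" "y \<in> Orb" by blast
      then show ?thesis using that by (auto simp: U_def Orb_def)
    qed
    have "int (n k) dvd c k \<one>\<^bsub>Omega\<^esub>"
    proof -
      have "c k \<one>\<^bsub>Omega\<^esub> mod int (n k) = (c k \<one>\<^bsub>Omega\<^esub> + c k \<one>\<^bsub>Omega\<^esub>) mod int (n k)"
        using c_mult[OF one one, of k] by (metis G.r_one one mod_mod_trivial)
      then show ?thesis by (simp add: mod_eq_dvd_iff)
    qed
    from dvd_add[OF it[OF one, where k = k and j = j, THEN conjunct2, unfolded j] this]
    have "int (n k) dvd - (j * c k a - 1)" by (simp add: algebra_simps)
    then show ?thesis by (auto simp only: dvd_minus_iff)
  qed
  then have "\<forall>k. \<exists>b. int (n k) dvd b * c k a - 1" by (rule allI)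
  then obtain b where "\<forall>k. int (n k) dvd b k * c k a - 1" by (rule choice[THEN exE])
  then have b: "\<And>k. int (n k) dvd b k * c k a - 1" by (rule spec)

  \<comment> \<open>Dividing by the residue of \<open>a\<close> turns \<open>T\<close> into adding
    1. Index 0 matches the initial period 1, so coordinate k sits at index k + 1.\<close>
  define s where "s x j = (case j of 0 \<Rightarrow> 0 | Suc k \<Rightarrow> b k * c k x)" for x j
  define M where "M j = (case j of 0 \<Rightarrow> 1 | Suc k \<Rightarrow> int (n k))" for j
  define p where "p j = (case j of 0 \<Rightarrow> int (n 0) | Suc k \<Rightarrow> int (n (Suc k) div n k))" for j
  have c_red': "int (n k) dvd c (Suc k) x - c k x" if "x \<in> ?S" for k x
    using c_red[OF that, of k] c_range[OF that, of k] by (simp add: mod_eq_dvd_iff[symmetric])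
  have b_red: "int (n k) dvd b (Suc k) - b k" for k
  proof -
    have "int (n k) dvd int (n (Suc k))" using n(2) by simp
    then have 1: "int (n k) dvd b (Suc k) * c (Suc k) a - 1" using b dvd_trans by blast
    \<comment> \<open>Both are inverses of the same unit modulo \<open>n k\<close>; the identity
      displays their difference as a combination of multiples of \<open>n k\<close>.\<close>
    have "b (Suc k) - b k = (b (Suc k) * c (Suc k) a - 1) * b k
        - b (Suc k) * ((b k * c k a - 1) + b k * (c (Suc k) a - c k a))"
      by (simp add: algebra_simps)
    then show ?thesis by (simp only:)
      (rule dvd_diff[OF dvd_mult2[OF 1] dvd_mult[OF dvd_add[OF b dvd_mult[OF c_red'[OF a]]]]])
  qed
  have s_red: "M j dvd s x (Suc j) - s x j" if "x \<in> ?S" for x j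
  proof (cases j)
    case (Suc k)
    have "b (Suc k) * c (Suc k) x - b k * c k x = (b (Suc k) - b k) * c (Suc k) x + b k * (c (Suc k) x - c k x)"
      by (simp add: algebra_simps)
    then show ?thesis
      using b_red[of k] c_red'[OF that, of k] by (simp add: Suc s_def M_def)
  qed (simp add: M_def)
  have s_iterate: "M j dvd s (iterate_int ?S T i x) j - (i + s x j)" if "x \<in> ?S" for x i j
  proof (cases j)
    case (Suc k)
    have "b k * c k (iterate_int ?S T i x) - (i + b k * c k x)
      = b k * (c k (iterate_int ?S T i x) - (c k x + i * c k a)) + i * (b k * c k a - 1)"
      by (simp add: algebra_simps)
    then show ?thesis
      using b[of k] it[OF that, where k = k and j = i] by (simp add: Suc s_def M_def)
  qed (simp add: M_def)
  have M0: "M 0 = 1" by (simp add: M_def)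
  have MS: "M (Suc j) = M j * p j" for j
    using n(2) by (cases j) (auto simp: M_def p_def of_nat_mult[symmetric] simp del: of_nat_mult)
  have p2: "2 \<le> p j" for j
  proof (cases j)
    case (Suc k)
    obtain q where q: "n (Suc k) = n k * q" using n(2)[of k] by (elim dvdE)
    have "q \<noteq> 0" "q \<noteq> 1" using n(3)[of k] q by auto
    then show ?thesis using q n0[of k] by (simp add: Suc p_def)
  qed (use n(1) in \<open>simp add: p_def\<close>)
  \<comment> \<open>The factor \<open>n 0\<close> covers j = 0, where the right-hand power is a
    power of 1; later the growth bound of the sequence applies.\<close>
  have poly: "of_int (M (Suc j)) \<le> real (n 0) * of_int (M j) ^ d" for j
  proof (cases j)
    case (Suc k)
    have "n (Suc k) \<le> n 0 * n k ^ d" by (rule order_trans[OF n(4)]) (use n(1) in simp)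
    then show ?thesis by (simp add: Suc M_def flip: of_nat_power of_nat_mult)
  qed (simp add: M_def)

  obtain \<epsilon> :: real and v :: "nat \<Rightarrow> int \<Rightarrow> real" where \<epsilon>: "0 < \<epsilon>"
    and v_per: "\<And>j i i'. M j dvd i - i' \<Longrightarrow> v j i = v j i'"
    and v_diff: "\<And>j i. \<bar>v (Suc j) i - v j i\<bar> \<le> (1 / 2) ^ j"
    and ex: "\<And>t. (\<And>j. M j dvd t (Suc j) - t j) \<Longrightarrow> \<exists>V Q Qi D.
      (\<forall>i. (\<lambda>j. v j (i + t j)) \<longlonglongrightarrow> ent V i i) \<and> diagonal V \<and> diagonal D \<and>
      (V + \<epsilon> *\<^sub>R laplacian) * Q = Q * D \<and> Q * Qi = 1 \<and>
      weight_bound 1 (1 / 8) (Q - 1) \<and> weight_bound 1 (1 / 8) (Qi - 1)"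
    using ex_localized_kernels[OF M0 MS p2 poly] by blast
  define f where "f x = lim (\<lambda>j. v j (s x j)) / \<epsilon>" for x
  have lim: "(\<lambda>j. v j (s x j)) \<longlonglongrightarrow> \<epsilon> * f x" if x: "x \<in> ?S" for x
  proof -
    obtain V where "\<And>i. (\<lambda>j. v j (i + s x j)) \<longlonglongrightarrow> ent V i i" using ex[of "s x"] s_red[OF x] by blast
    from this[of 0] have "convergent (\<lambda>j. v j (s x j))" by (auto simp: convergent_def)
    then show ?thesis using \<epsilon> by (simp add: f_def convergent_LIMSEQ_iff)
  qed
  have close: "\<bar>\<epsilon> * f x - v j (s x j)\<bar> \<le> 2 * (1 / 2) ^ j" if x: "x \<in> ?S" for x j
  proof -
    have step: "\<bar>v (Suc i) (s x (Suc i)) - v i (s x i)\<bar> \<le> (1 / 2) ^ i" for i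
      using v_diff[of i "s x (Suc i)"] v_per[OF s_red[OF x, of i]] by simp
    have "\<bar>v (j + i) (s x (j + i)) - v j (s x j)\<bar> \<le> 2 * (1 / 2) ^ j - 2 * (1 / 2) ^ (j + i)" for i
    proof (induction i)
      case (Suc i)
      have "(1 / 2 :: real) ^ (j + Suc i) * 2 = (1 / 2) ^ (j + i)" by simp
      then show ?case using Suc step[of "j + i"] by simp
    qed simp
    then have le: "\<bar>v (j + i) (s x (j + i)) - v j (s x j)\<bar> \<le> 2 * (1 / 2) ^ j" for i
      by (rule order_trans) simp
    have "(\<lambda>i. v (i + j) (s x (i + j))) \<longlonglongrightarrow> \<epsilon> * f x"
      using LIMSEQ_ignore_initial_segment[OF lim[OF x]] .
    then have "(\<lambda>i. \<bar>v (j + i) (s x (j + i)) - v j (s x j)\<bar>) \<longlonglongrightarrow> \<bar>\<epsilon> * f x - v j (s x j)\<bar>"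
      by (intro tendsto_intros) (simp add: add.commute)
    then show ?thesis by (rule LIMSEQ_le_const2) (use le in auto)
  qed
  have cont: "continuous_map X euclideanreal f"
    unfolding Met_TC.continuous_map_to_metric[of X f, unfolded mtopology_is_euclidean] X
  proof (intro ballI allI impI)
    fix x and e :: real assume x: "x \<in> ?S" and e: "0 < e"
    have "0 < \<epsilon> * e / 4" using e \<epsilon> by simp
    then obtain j where j: "(1 / 2 :: real) ^ j < \<epsilon> * e / 4"
      using real_arch_pow_inv[of "\<epsilon> * e / 4" "1 / 2"] by auto
    \<comment> \<open>Coordinate j fixes the entry of \<open>s\<close> at index j + 1, hence
      \<epsilon> f up to one geometric tail at each of the two points.\<close>
    define U where "U = {y \<in> ?S. c j y = c j x}"
    have near: "f y \<in> Met_TC.mball (f x) e" if "y \<in> U" for y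
    proof -
      have y: "y \<in> ?S" "c j y = c j x" using that by (auto simp: U_def)
      define q :: real where "q = (1 / 2) ^ Suc j"
      have sy: "s y (Suc j) = s x (Suc j)" by (simp add: s_def y(2))
      have "\<bar>\<epsilon> * f x - \<epsilon> * f y\<bar> \<le> 4 * q"
        using close[OF x, of "Suc j", folded q_def] close[OF y(1), of "Suc j", folded q_def, unfolded sy]
        by (simp add: abs_le_iff)
      also have "4 * q < \<epsilon> * e"
      proof -
        have "8 * q < \<epsilon> * e" using j by (simp add: q_def)
        moreover have "0 < q" by (simp add: q_def)
        ultimately show ?thesis by simp
      qed
      finally have "\<epsilon> * \<bar>f x - f y\<bar> < \<epsilon> * e" using \<epsilon> by (simp add: abs_mult right_diff_distrib[symmetric])
      then show ?thesis using \<epsilon> by (simp add: dist_real_def)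
    qed
    have "openin X U" "x \<in> U" using c_open x by (auto simp: U_def)
    then show "\<exists>U. openin X U \<and> x \<in> U \<and> (\<forall>y\<in>U. f y \<in> Met_TC.mball (f x) e)" using near by blast
  qed
  define K where "K = (9 / 8 :: real)\<^sup>2 * exp_sum (1 / 2) + 1"
  have K: "0 < K" using exp_sum_nonneg[of "1 / 2"] by (simp add: K_def add_nonneg_pos)
  define H where "H \<omega> = schrodinger (\<lambda>i. f (iterate_int ?S T i \<omega>))" for \<omega>
  have main: "ULE 1 (9 / 8) (H \<omega>) \<and>
      (\<forall>t i i'. cmod (l2_inner (delta i) (evolution (H \<omega>) t (delta i'))) \<le> K * exp (- (1 / 2) * real_of_int \<bar>i - i'\<bar>))"
    if \<omega>: "\<omega> \<in> ?S" for \<omega>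
  proof -
    obtain V Q Qi D where V: "\<And>i. (\<lambda>j. v j (i + s \<omega> j)) \<longlonglongrightarrow> ent V i i"
      and ker: "diagonal V" "diagonal D" "(V + \<epsilon> *\<^sub>R laplacian) * Q = Q * D" "Q * Qi = 1"
        "weight_bound 1 (1 / 8) (Q - 1)" "weight_bound 1 (1 / 8) (Qi - 1)"
      using ex[OF s_red[OF \<omega>]] by blast
    \<comment> \<open>Moving i steps along the orbit and shifting the site by i give congruent
      arguments, on which the periodic approximants agree; so both limits coincide.\<close>
    have "f (iterate_int ?S T i \<omega>) = ent V i i / \<epsilon>" for i
    proof -
      have "(\<lambda>j. v j (s (iterate_int ?S T i \<omega>) j)) \<longlonglongrightarrow> ent V i i"
        using V[of i] by (simp only: v_per[OF s_iterate[OF \<omega>]])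
      then have "\<epsilon> * f (iterate_int ?S T i \<omega>) = ent V i i"
        using lim[of "iterate_int ?S T i \<omega>"] it[OF \<omega>, where j = i] LIMSEQ_unique by blast
      then show ?thesis using \<epsilon> by (simp add: field_simps)
    qed
    then have H: "H \<omega> = schrodinger (\<lambda>i. ent V i i / \<epsilon>)" by (simp add: H_def)
    interpret localized_basis "ent Q" "ent Qi" "\<lambda>i. ent V i i / \<epsilon>" "\<lambda>l. ent D l l / \<epsilon>" "9 / 8" "norm D / \<epsilon>"
      by (rule localized_basis_of_kernels[OF \<epsilon> ker])
    have "cmod (l2_inner (delta i) (evolution (H \<omega>) t (delta i'))) \<le> K * exp (- (1 / 2) * real_of_int \<bar>i - i'\<bar>)" for t i i'
    proof -
      have "cmod (l2_inner (delta i) (evolution (H \<omega>) t (delta i')))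
          \<le> (9 / 8)\<^sup>2 * exp_sum (1 / 2) * exp (- (1 / 2) * real_of_int \<bar>i - i'\<bar>)"
        unfolding H of_int_abs by (rule evolution_decay)
      also have "\<dots> \<le> K * exp (- (1 / 2) * real_of_int \<bar>i - i'\<bar>)"
        by (intro mult_right_mono) (auto simp: K_def)
      finally show ?thesis .
    qed
    then show ?thesis unfolding H using ULE_schrodinger by blast
  qed
  show ?thesis
    unfolding Let_def
  proof (intro exI[of _ f] conjI cont)
    show "\<exists>r c. \<forall>\<omega>\<in>?S. ULE r c (schrodinger (\<lambda>n. f (iterate_int ?S T n \<omega>)))"
      using main unfolding H_def by blast
    show "\<exists>C r'. 0 < C \<and> 0 < r' \<and> (\<forall>\<omega>\<in>?S. \<forall>m n.
        (SUP t. ereal (cmod (l2_inner (delta n) (evolution (schrodinger (\<lambda>n. f (iterate_int ?S T n \<omega>))) t (delta m)))))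
          \<le> ereal (C * exp (- r' * real_of_int \<bar>n - m\<bar>)))"
      using main K unfolding H_def
      by (intro exI[of _ K] exI[of _ "1 / 2 :: real"]) (auto intro!: SUP_least)
  qed
qed

end
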